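(* Let $r\ge 1$ be a fixed integer. For every collectable $r$-pattern $P$ there is a constant $b_P>0$, depending only on the type of $P$ (so $b_P=b_{P'}$ whenever $P$ and $P'$ have the same type), such that, if $M$ is a uniformly random $r$-matching of size $n$ (on the vertex set $\{1,\dots,rn\}$), then \[ \frac{L_P(M)}{n^{1/r}}\to b_P \quad\text{in probability, as } n\to\infty .\]
   Context: An (ordered) $r$-matching is an $r$-uniform hypergraph on a totally ordered vertex set in which every vertex is contained in exactly one edge; its size is its number of edges. An $r$-pattern is an $r$-matching of size $2$ on the vertex set $\{1,\dots,2r\}$. For an $r$-pattern $P$, an $r$-matching is a $P$-clique if every pair of its edges (with the induced ordering on their $2r$ vertices) is order-isomorphic to $P$; $L_P(M)$ is the size of the largest $P$-clique formed by a subset of the edges of $M$. An $r$-pattern $P$ is collectable if there are arbitrarily large $P$-cliques. A run in a pattern is a sequence of consecutive vertices in the same edge. A pattern is splittable if its vertex set can be partitioned into blocks of consecutive vertices, each consisting of two runs of the same length coming from different edges; this partition is then unique and is called the block partition of $P$. It is known (Dudek, Grytczuk and Ruciński) that an $r$-pattern is collectable if and only if it is splittable. If $P$ has block partition $J_1\cup\dots\cup J_\ell$, the type of $P$ is the (number-theoretic, i.e. unordered) partition $|J_1|/2+\dots+|J_\ell|/2$ of $r$. *)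

theory Defs
  imports "HOL-Probability.Probability" "HOL-Library.Disjoint_Sets"
begin

text \<open>
  Vertices are natural numbers; every finite totally ordered set embeds into them.
  A matching is represented by its set of edges.
\<close>

definition r_matching :: "nat \<Rightarrow> nat set \<Rightarrow> nat set set \<Rightarrow> bool" where
  "r_matching r V M \<longleftrightarrow>
     finite V \<and> (\<forall>e\<in>M. e \<subseteq> V \<and> card e = r) \<and> (\<forall>v\<in>V. \<exists>!e. e \<in> M \<and> v \<in> e)"

definition matchings_of_size :: "nat \<Rightarrow> nat \<Rightarrow> nat set set set" where
  "matchings_of_size r n = {M. r_matching r {1..r * n} M \<and> card M = n}"

definition r_pattern :: "nat \<Rightarrow> nat set set \<Rightarrow> bool" where
  "r_pattern r P \<longleftrightarrow> r_matching r {1..2 * r} P \<and> card P = 2"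

text \<open>Every vertex of a matching lies in an edge, so the vertex set is the union of the edges.\<close>

definition order_isomorphic :: "nat set set \<Rightarrow> nat set set \<Rightarrow> bool" where
  "order_isomorphic M N \<longleftrightarrow> (\<exists>f. strict_mono_on (\<Union>M) f \<and> (`) f ` M = N)"

definition is_clique :: "nat \<Rightarrow> nat set set \<Rightarrow> nat set set \<Rightarrow> bool" where
  "is_clique r P C \<longleftrightarrow>
     r_matching r (\<Union>C) C \<and> (\<forall>e\<in>C. \<forall>f\<in>C. e \<noteq> f \<longrightarrow> order_isomorphic {e, f} P)"

definition largest_clique :: "nat \<Rightarrow> nat set set \<Rightarrow> nat set set \<Rightarrow> nat" where
  "largest_clique r P M = Max {card C | C. C \<subseteq> M \<and> is_clique r P C}"

definition collectable :: "nat \<Rightarrow> nat set set \<Rightarrow> bool" where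
  "collectable r P \<longleftrightarrow> (\<forall>k. \<exists>C. is_clique r P C \<and> k \<le> card C)"

text \<open>
  A block consists of two adjacent runs of the same length \<open>m\<close> in different edges; the runs
  need not be maximal.
\<close>

definition is_block :: "nat set set \<Rightarrow> nat set \<Rightarrow> bool" where
  "is_block P J \<longleftrightarrow>
     (\<exists>a m e f. m \<ge> 1 \<and> e \<in> P \<and> f \<in> P \<and> e \<noteq> f \<and> J = {a..<a + 2 * m} \<and>
        {a..<a + m} \<subseteq> e \<and> {a + m..<a + 2 * m} \<subseteq> f)"

definition is_block_partition :: "nat set set \<Rightarrow> nat set set \<Rightarrow> bool" where
  "is_block_partition P B \<longleftrightarrow> partition_on (\<Union>P) B \<and> (\<forall>J\<in>B. is_block P J)"

definition splittable :: "nat set set \<Rightarrow> bool" where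
  "splittable P \<longleftrightarrow> (\<exists>B. is_block_partition P B)"

definition block_partition :: "nat set set \<Rightarrow> nat set set" where
  "block_partition P = (THE B. is_block_partition P B)"

text \<open>
  The type is an unordered partition of \<open>r\<close>, hence a multiset. It is meaningful for splittable
  patterns, whose block partition is unique by \<open>is_block_partition_unique\<close> below.
\<close>

definition pattern_type :: "nat set set \<Rightarrow> nat multiset" where
  "pattern_type P = image_mset (\<lambda>J. card J div 2) (mset_set (block_partition P))"

definition converges_in_probability ::
    "(nat \<Rightarrow> 'a pmf) \<Rightarrow> (nat \<Rightarrow> 'a \<Rightarrow> real) \<Rightarrow> real \<Rightarrow> bool" where
  "converges_in_probability p X c \<longleftrightarrow>
     (\<forall>\<epsilon>>0. (\<lambda>n. measure_pmf.prob (p n) {x. \<bar>X n x - c\<bar> > \<epsilon>}) \<longlonglongrightarrow> 0)"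

lemma is_block_partition_subset:
  assumes P: "r_matching r V P"
    and B: "is_block_partition P B" and B': "is_block_partition P B'"
  shows "B \<subseteq> B'"
proof -
  have same: "e = e'" if "e \<in> P" "e' \<in> P" "v \<in> e" "v \<in> e'" for v e e'
    using P that unfolding r_matching_def by blast
  have key: "\<forall>B B' m. is_block_partition P B \<longrightarrow> is_block_partition P B' \<longrightarrow> m \<ge> 1 \<longrightarrow>
      {a..<a + 2 * m} \<in> B \<longrightarrow> {a..<a + 2 * m} \<in> B'" for a
  proof (induction a rule: less_induct)
    case (less a)
    show ?case
    proof (intro allI impI)
      fix B B' :: "nat set set" and m :: nat
      assume B: "is_block_partition P B" and B': "is_block_partition P B'"
        and m: "m \<ge> 1" and J: "{a..<a + 2 * m} \<in> B"
      have aJ: "a \<in> {a..<a + 2 * m}" using m by simp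
      then have "a \<in> \<Union>P"
        using J B unfolding is_block_partition_def partition_on_def by blast
      then obtain J' where J': "J' \<in> B'" "a \<in> J'"
        using B' by (auto simp: is_block_partition_def partition_on_def)
      obtain a' m' e' f' where b': "m' \<ge> 1" "e' \<in> P" "f' \<in> P" "e' \<noteq> f'"
          "J' = {a'..<a' + 2 * m'}" "{a'..<a' + m'} \<subseteq> e'" "{a' + m'..<a' + 2 * m'} \<subseteq> f'"
        using B' J'(1) unfolding is_block_partition_def is_block_def by metis
      have "is_block P {a..<a + 2 * m}"
        using B J by (auto simp: is_block_partition_def)
      then obtain c k e f where b: "k \<ge> 1" "e \<in> P" "f \<in> P" "e \<noteq> f"
          "{a..<a + 2 * m} = {c..<c + 2 * k}" "{c..<c + k} \<subseteq> e" "{c + k..<c + 2 * k} \<subseteq> f"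
        unfolding is_block_def by metis
      have ck: "c = a" "k = m"
        using b(1,5) m by (auto simp: atLeastLessThan_eq_iff)
      have "a' = a"
      proof (rule ccontr)
        assume "a' \<noteq> a"
        with J'(2) b'(5) have lt: "a' < a" by simp
        have J'B: "J' \<in> B"
          using less.IH[OF lt] B B' b'(1,5) J'(1) by blast
        have "J' = {a..<a + 2 * m}"
          using B J J'B J'(2) aJ unfolding is_block_partition_def partition_on_def disjoint_def
          by blast
        then have "a' \<in> {a..<a + 2 * m}" using b'(1,5) by auto
        with lt show False by simp
      qed
      have sub: "{a..<a + m} \<subseteq> e" "{a + m..<a + 2 * m} \<subseteq> f"
          "{a..<a + m'} \<subseteq> e'" "{a + m'..<a + 2 * m'} \<subseteq> f'"
        using b(6,7) b'(6,7) ck \<open>a' = a\<close> by simp_all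
      have "a \<in> e" "a \<in> e'" using subsetD[OF sub(1), of a] subsetD[OF sub(3), of a] m b'(1) by simp_all
      then have ee: "e = e'" using same b(2) b'(2) by blast
      have "m = m'"
      proof (rule ccontr)
        assume "m \<noteq> m'"
        then consider "m < m'" | "m' < m" by linarith
        then show False
        proof cases
          case 1
          then have "a + m \<in> e'" "a + m \<in> f"
            using subsetD[OF sub(2), of "a + m"] subsetD[OF sub(3), of "a + m"] m by simp_all
          then show False using same b(2-4) b'(2-4) ee by blast
        next
          case 2
          then have "a + m' \<in> e" "a + m' \<in> f'"
            using subsetD[OF sub(1), of "a + m'"] subsetD[OF sub(4), of "a + m'"] b'(1) by simp_all
          then show False using same b(2-4) b'(2-4) ee by blast
        qed
      qed
      then show "{a..<a + 2 * m} \<in> B'" using J'(1) b'(5) \<open>a' = a\<close> by simp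
    qed
  qed
  show ?thesis
  proof
    fix J assume "J \<in> B"
    moreover from this B obtain a m where "m \<ge> 1" "J = {a..<a + 2 * m}"
      unfolding is_block_partition_def is_block_def by metis
    ultimately show "J \<in> B'" using key B B' by blast
  qed
qed

lemma is_block_partition_unique:
  assumes "r_matching r V P" "is_block_partition P B" "is_block_partition P B'"
  shows "B = B'"
  using is_block_partition_subset[OF assms(1)] assms(2,3) by blast

lemma block_partition_eq:
  assumes "r_matching r V P" "is_block_partition P B"
  shows "block_partition P = B"
  unfolding block_partition_def
  using assms(2) is_block_partition_unique[OF assms(1)] by (rule the_equality) (use assms(2) in auto)

lemma finite_matchings_of_size: "finite (matchings_of_size r n)"
proof (rule finite_subset)
  show "matchings_of_size r n \<subseteq> Pow (Pow {1..r * n})"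
    by (auto simp: matchings_of_size_def r_matching_def)
qed simp

lemma matchings_of_size_nonempty:
  assumes "r \<ge> 1"
  shows "matchings_of_size r n \<noteq> {}"
proof -
  let ?E = "\<lambda>i. {r * i + 1..r * i + r}"
  have mem: "v \<in> ?E i \<longleftrightarrow> v \<ge> 1 \<and> i = (v - 1) div r" for v i
  proof
    assume v: "v \<in> ?E i"
    then have "v - 1 = r * i + (v - 1 - r * i)" "v - 1 - r * i < r" using assms by auto
    then have "(v - 1) div r = i"
      using assms by (metis add.right_neutral div_less div_mult_self4 not_one_le_zero)
    with v show "v \<ge> 1 \<and> i = (v - 1) div r" by auto
  next
    assume v: "v \<ge> 1 \<and> i = (v - 1) div r"
    define w where "w = (v - 1) mod r"
    have "v - 1 = r * i + w" "w < r" using v assms by (simp_all add: w_def)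
    then show "v \<in> ?E i" using v by (auto simp del: One_nat_def)
  qed
  have inj: "inj_on ?E {..<n}"
  proof (rule inj_onI)
    fix i j assume "?E i = ?E j"
    moreover have "r * i + 1 \<in> ?E i" using assms by simp
    ultimately have "r * i + 1 \<in> ?E i" "r * i + 1 \<in> ?E j" by blast+
    then show "i = j" using mem by metis
  qed
  have "r_matching r {1..r * n} (?E ` {..<n})"
    unfolding r_matching_def
  proof (intro conjI ballI)
    fix e assume "e \<in> ?E ` {..<n}"
    then obtain i where i: "i < n" "e = ?E i" by auto
    have "r * (i + 1) \<le> r * n" using i by (intro mult_le_mono2) simp
    with i show "e \<subseteq> {1..r * n}" by auto
    show "card e = r" using i by simp
  next
    fix v assume v: "v \<in> {1..r * n}"
    then have "v - 1 < n * r"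
      unfolding atLeastAtMost_iff mult.commute[of r n] by linarith
    then have "(v - 1) div r < n"
      using assms by (simp add: div_less_iff_less_mult)
    moreover have "v \<in> ?E ((v - 1) div r)" using mem v by auto
    moreover have "e = ?E ((v - 1) div r)" if e: "e \<in> ?E ` {..<n} \<and> v \<in> e" for e
    proof -
      from e obtain i where i: "e = ?E i" by blast
      with e have "v \<in> ?E i" by simp
      then have "i = (v - 1) div r" using mem by blast
      with i show ?thesis by simp
    qed
    ultimately show "\<exists>!e. e \<in> ?E ` {..<n} \<and> v \<in> e"
      by (intro ex1I[of _ "?E ((v - 1) div r)"] conjI imageI lessThan_iff[THEN iffD2])
  qed simp
  moreover have "card (?E ` {..<n}) = n" using inj by (simp add: card_image)
  ultimately show ?thesis unfolding matchings_of_size_def by blast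
qed

end

theory Submission
  imports Defs "HOL-Real_Asymp.Real_Asymp" "HOL-Combinatorics.Multiset_Permutations"
begin

text \<open>
  Three edges of a large \<open>P\<close>-clique already show how \<open>P\<close> looks: the comparison of the \<open>u\<close>-th vertex
  of one edge with the \<open>v\<close>-th vertex of a later edge is a transitive and co-transitive relation, so the
  positions \<open>0, \<dots>, r - 1\<close> split into consecutive classes (\<open>collectable_structure\<close>). The classes
  are the blocks of \<open>P\<close>. Cutting every edge at the class boundaries into chunks, an edge set is a
  \<open>P\<close>-clique if and only if all chunks belonging to an earlier class lie before all chunks belonging to
  a later class and, within each class, the chunks are linearly separated, in an order that is the order of
  the edges or its reverse, depending on the block. A \<open>P\<close>-clique is thus a division of the vertex
  set into intervals, one per block, together with a chain in the product of the separation orders.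
  
  For a fixed division into intervals the edges that respect it are, apart from their number, independent
  tuples of uniformly random chunks. Let \<open>\<Lambda> n\<close> be the expected length of the longest chain among
  \<open>n\<close> such tuples. Placing \<open>q\<close> small boxes along the diagonal gives
  \<open>\<Lambda> n \<ge> q * \<Lambda> k\<close>, up to a small error, if each box receives a little more than \<open>k\<close> of the
  \<open>n\<close> tuples, that is, if \<open>n / q ^ r\<close> is slightly larger than \<open>k\<close>. Together with the bound
  \<open>\<Lambda> n = O(n powr (1 / r))\<close> from a first moment computation this forces \<open>\<Lambda> n / n powr (1 / r)\<close> to
  converge to a positive constant (\<open>root_limit_of_superadditive\<close>). The constant depends only on the
  block sizes: reversing a block is a reflection of one coordinate.
  
  The longest chain is concentrated because it is self-bounding: deleting a point changes its length by at
  most one, and changes it only if the point lies on a fixed longest chain. By the Efron-Stein inequality its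
  variance is at most its expectation (\<open>variance_clique_number_le\<close>), so that Chebyshev's inequality
  suffices and only expectations have to be computed.
  
  It remains to optimise over the division. An edge respects the division into intervals of relative lengths
  \<open>x j\<close> with probability \<open>r! * (\<Prod>j. x j ^ m j / m j!)\<close>, where \<open>m j\<close> are the block sizes, and the
  weighted inequality of arithmetic and geometric means shows that \<open>x j = m j / r\<close> is optimal. This
  division gives the lower bound. For the upper bound the division is rounded to a bounded number of cells,
  which leaves a bounded number of cases and enlarges the intervals by an arbitrarily small factor.
  
  Independence is obtained by sampling \<open>n\<close> independent \<open>r\<close>-subsets of \<open>{..<Q}\<close>. For \<open>Q\<close> large in
  terms of \<open>n\<close> they are disjoint with probability at least one half, and conditioned on this their order
  type is a uniformly random matching, so an event has at most twice the probability for the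
  random matching (\<open>matching_prob_le\<close>).
\<close>


section \<open>Clique numbers and the Efron-Stein inequality\<close>

definition clique_number :: "('a \<Rightarrow> 'a \<Rightarrow> bool) \<Rightarrow> 'a set \<Rightarrow> nat" where
  "clique_number R A = Max {card C | C. C \<subseteq> A \<and> pairwise R C}"

lemma clique_number_attained:
  assumes "finite A"
  obtains C where "C \<subseteq> A" "pairwise R C" "card C = clique_number R A"
proof -
  let ?S = "{card C | C. C \<subseteq> A \<and> pairwise R C}"
  have "?S = card ` {C. C \<subseteq> A \<and> pairwise R C}" by auto
  moreover have "finite {C. C \<subseteq> A \<and> pairwise R C}"
    by (rule finite_subset[of _ "Pow A"]) (use assms in auto)
  ultimately have "finite ?S" by simp
  moreover have "card {} \<in> ?S" by (rule CollectI, rule exI[of _ "{}"]) (simp add: pairwise_def)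
  ultimately have "Max ?S \<in> ?S" by (intro Max_in) auto
  then show ?thesis using that unfolding clique_number_def by auto
qed

lemma card_le_clique_number:
  assumes "finite A" "C \<subseteq> A" "pairwise R C"
  shows "card C \<le> clique_number R A"
proof -
  let ?S = "{card C | C. C \<subseteq> A \<and> pairwise R C}"
  have "?S = card ` {C. C \<subseteq> A \<and> pairwise R C}" by auto
  moreover have "finite {C. C \<subseteq> A \<and> pairwise R C}"
    by (rule finite_subset[of _ "Pow A"]) (use assms in auto)
  ultimately have "finite ?S" by simp
  moreover have "card C \<in> ?S" using assms by blast
  ultimately show ?thesis unfolding clique_number_def by (intro Max_ge)
qed

lemma clique_number_le_card:
  assumes "finite A" shows "clique_number R A \<le> card A"
  using clique_number_attained[OF assms] card_mono[OF assms] by metis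

lemma clique_number_mono:
  assumes "finite B" "A \<subseteq> B" shows "clique_number R A \<le> clique_number R B"
proof -
  have "finite A" using assms finite_subset by blast
  then obtain C where "C \<subseteq> A" "pairwise R C" "card C = clique_number R A"
    using clique_number_attained by blast
  then show ?thesis using card_le_clique_number[OF assms(1), of C R] assms(2) by force
qed

lemma clique_number_empty [simp]: "clique_number R {} = 0"
  using clique_number_le_card[of "{}" R] by simp

lemma clique_number_insert_le:
  assumes "finite A" shows "clique_number R (insert x A) \<le> Suc (clique_number R A)"
proof -
  obtain C where C: "C \<subseteq> insert x A" "pairwise R C" "card C = clique_number R (insert x A)"
    using clique_number_attained assms by (metis finite_insert)
  have "card (C - {x}) \<le> clique_number R A"
    using C assms by (intro card_le_clique_number) (auto simp: pairwise_def)
  moreover have "card C \<le> Suc (card (C - {x}))"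
    using card_Diff1_le by (metis C(1) card_Suc_Diff1 assms finite_insert finite_subset le_refl
        Diff_empty Diff_insert0 lessI less_imp_le)
  ultimately show ?thesis using C by simp
qed

text \<open>
  Cliques found by the partial maps \<open>\<phi> i\<close> on their domains lift to \<open>A\<close>, and if points of different domains
  are always related, their union is a clique. With a single index this transports a clique number along
  one partial map.
\<close>
lemma sum_clique_number_le:
  assumes "finite A" "finite I"
    and phi: "\<And>i x x' y y'. \<lbrakk>i \<in> I; x \<in> A; x' \<in> A; \<phi> i x = Some y; \<phi> i x' = Some y'; R' y y'\<rbrakk> \<Longrightarrow> R x x'"
    and cross: "\<And>i i' x x'. \<lbrakk>i \<in> I; i' \<in> I; i \<noteq> i'; x \<in> A; x' \<in> A; \<phi> i x \<noteq> None; \<phi> i' x' \<noteq> None\<rbrakk>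
      \<Longrightarrow> x \<noteq> x' \<and> R x x'"
  shows "(\<Sum>i\<in>I. clique_number R' {y. \<exists>x\<in>A. \<phi> i x = Some y}) \<le> clique_number R A"
proof -
  let ?B = "\<lambda>i. {y. \<exists>x\<in>A. \<phi> i x = Some y}"
  have finB: "finite (?B i)" for i
  proof (rule finite_subset)
    show "?B i \<subseteq> (\<lambda>x. the (\<phi> i x)) ` A" by force
  qed (use assms in simp)
  have "\<forall>i. \<exists>C. C \<subseteq> ?B i \<and> pairwise R' C \<and> card C = clique_number R' (?B i)"
  proof
    fix i
    obtain C where "C \<subseteq> ?B i" "pairwise R' C" "card C = clique_number R' (?B i)"
      by (rule clique_number_attained[OF finB[of i]])
    then show "\<exists>C. C \<subseteq> ?B i \<and> pairwise R' C \<and> card C = clique_number R' (?B i)"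
      by (intro exI conjI)
  qed
  from choice[OF this] obtain C where
    Call: "\<forall>i. C i \<subseteq> ?B i \<and> pairwise R' (C i) \<and> card (C i) = clique_number R' (?B i)" ..
  have C: "C i \<subseteq> ?B i" "pairwise R' (C i)" "card (C i) = clique_number R' (?B i)" for i
    using spec[OF Call, of i] by - (elim conjE, assumption)+
  define g where "g i y = (SOME x. x \<in> A \<and> \<phi> i x = Some y)" for i y
  have g: "g i y \<in> A" "\<phi> i (g i y) = Some y" if "y \<in> C i" for i y
  proof -
    have "\<exists>x. x \<in> A \<and> \<phi> i x = Some y" using subsetD[OF C(1) that] by auto
    from someI_ex[OF this] show "g i y \<in> A" "\<phi> i (g i y) = Some y" unfolding g_def by simp_all
  qed
  let ?D = "\<Union>i\<in>I. g i ` C i"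
  have inj: "inj_on (g i) (C i)" for i
  proof (rule inj_onI)
    fix y y' assume y: "y \<in> C i" "y' \<in> C i" "g i y = g i y'"
    have "Some y = Some y'" using g(2)[OF y(1)] g(2)[OF y(2)] y(3) by argo
    then show "y = y'" by simp
  qed
  have disj: "g i ` C i \<inter> g i' ` C i' = {}" if ii: "i \<in> I" "i' \<in> I" "i \<noteq> i'" for i i'
  proof -
    have "g i y \<noteq> g i' y'" if "y \<in> C i" "y' \<in> C i'" for y y'
      using cross[OF ii g(1)[OF that(1)] g(1)[OF that(2)]] g(2)[OF that(1)] g(2)[OF that(2)] by auto
    then show ?thesis by auto
  qed
  have finC: "finite (C i)" for i using C(1) finB by (rule finite_subset)
  have "card ?D = (\<Sum>i\<in>I. card (g i ` C i))"
    using assms(2) finC disj by (intro card_UN_disjoint) auto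
  also have "\<dots> = (\<Sum>i\<in>I. clique_number R' (?B i))"
    using inj C(3) by (simp add: card_image)
  finally have "card ?D = (\<Sum>i\<in>I. clique_number R' (?B i))" .
  moreover have "pairwise R ?D"
  proof (intro pairwiseI)
    fix x x' assume "x \<in> ?D" "x' \<in> ?D" "x \<noteq> x'"
    then obtain i y i' y' where *: "i \<in> I" "y \<in> C i" "x = g i y" "i' \<in> I" "y' \<in> C i'" "x' = g i' y'"
      by auto
    show "R x x'"
    proof (cases "i = i'")
      case True
      then have "R' y y'" using C(2)[of i] * \<open>x \<noteq> x'\<close> by (auto simp: pairwise_def)
      then show ?thesis using phi[of i x x' y y'] * True g by auto
    next
      case False
      then show ?thesis using cross[of i i' x x'] * g by auto
    qed
  qed
  moreover have "?D \<subseteq> A" using g(1) by auto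
  ultimately show ?thesis using card_le_clique_number[OF assms(1), of ?D R] by simp
qed

lemma expectation_bind_finite:
  fixes h :: "'b \<Rightarrow> real"
  assumes "finite (set_pmf p)" "\<And>x. x \<in> set_pmf p \<Longrightarrow> finite (set_pmf (f x))"
  shows "measure_pmf.expectation (bind_pmf p f) h =
    measure_pmf.expectation p (\<lambda>x. measure_pmf.expectation (f x) h)"
  using assms
  by (simp add: pmf_expectation_bind[of "set_pmf p"] integral_measure_pmf[of "set_pmf p"])

lemma expectation_mono_finite:
  fixes f g :: "'b \<Rightarrow> real"
  assumes "finite (set_pmf p)" "\<And>x. x \<in> set_pmf p \<Longrightarrow> f x \<le> g x"
  shows "measure_pmf.expectation p f \<le> measure_pmf.expectation p g"
  using assms
  by (intro integral_mono_AE integrable_measure_pmf_finite) (auto simp: AE_measure_pmf_iff)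

definition delete_nth :: "nat \<Rightarrow> 'a list \<Rightarrow> 'a list" where
  "delete_nth i xs = take i xs @ drop (Suc i) xs"

lemma finite_set_replicate_pmf: "finite (set_pmf p) \<Longrightarrow> finite (set_pmf (replicate_pmf n p))"
  using finite_lists_length_eq[of "set_pmf p" n] by (simp add: set_replicate_pmf lists_eq_set conj_commute Collect_conj_eq)

lemma expectation_square_ge:
  fixes f :: "'b \<Rightarrow> real"
  assumes "finite (set_pmf p)"
  shows "(measure_pmf.expectation p f)\<^sup>2 \<le> measure_pmf.expectation p (\<lambda>x. (f x)\<^sup>2)"
proof -
  let ?m = "measure_pmf.expectation p f"
  have int: "integrable p g" for g :: "'b \<Rightarrow> real" using assms by (rule integrable_measure_pmf_finite)
  have "0 \<le> measure_pmf.expectation p (\<lambda>x. (f x - ?m)\<^sup>2)" by simp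
  also have "\<dots> = measure_pmf.expectation p (\<lambda>x. (f x)\<^sup>2) - ?m\<^sup>2"
    using measure_pmf.variance_eq[OF int[of f] int] by simp
  finally show ?thesis by simp
qed

text \<open>
  Induction on the number of coordinates: the variance splits into the average of the conditional variances
  given the first entry, to which the induction hypothesis applies, and the variance of the conditional
  expectation. Averaging over the other entries only decreases the latter, which is therefore at most the
  mean square of the change caused by deleting the first entry.
\<close>
lemma Efron_Stein:
  fixes f :: "'a list \<Rightarrow> real"
  assumes fin: "finite (set_pmf p)"
  shows "measure_pmf.variance (replicate_pmf n p) f \<le>
    measure_pmf.expectation (replicate_pmf n p) (\<lambda>xs. \<Sum>i<n. (f xs - f (delete_nth i xs))\<^sup>2)"
proof (induction n arbitrary: f)
  case 0
  then show ?case by simp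
next
  case (Suc n)
  let ?q = "replicate_pmf n p"
  let ?E = "measure_pmf.expectation"
  have finq: "finite (set_pmf ?q)" using fin by (rule finite_set_replicate_pmf)
  have intp: "integrable p g" for g :: "'a \<Rightarrow> real" using fin by (rule integrable_measure_pmf_finite)
  have intq: "integrable ?q g" for g :: "'a list \<Rightarrow> real" using finq by (rule integrable_measure_pmf_finite)
  have finSq: "finite (set_pmf (replicate_pmf (Suc n) p))" using fin by (rule finite_set_replicate_pmf)
  have intS: "integrable (replicate_pmf (Suc n) p) g" for g :: "'a list \<Rightarrow> real"
    using finSq by (rule integrable_measure_pmf_finite)
  have ES: "?E (replicate_pmf (Suc n) p) g = ?E p (\<lambda>x. ?E ?q (\<lambda>ys. g (x # ys)))" for g :: "'a list \<Rightarrow> real"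
    using fin finq by (simp add: expectation_bind_finite)
  let ?F = "\<lambda>x. ?E ?q (\<lambda>ys. f (x # ys))"
  let ?a = "?E ?q f"
  have "measure_pmf.variance (replicate_pmf (Suc n) p) f =
      ?E (replicate_pmf (Suc n) p) (\<lambda>xs. (f xs)\<^sup>2) - (?E (replicate_pmf (Suc n) p) f)\<^sup>2"
    by (rule measure_pmf.variance_eq[OF intS intS])
  also have "\<dots> = ?E p (\<lambda>x. ?E ?q (\<lambda>ys. (f (x # ys))\<^sup>2)) - (?E p ?F)\<^sup>2"
    by (simp add: ES del: replicate_pmf.simps)
  also have "\<dots> = ?E p (\<lambda>x. ?E ?q (\<lambda>ys. (f (x # ys))\<^sup>2) - (?F x)\<^sup>2) + (?E p (\<lambda>x. (?F x)\<^sup>2) - (?E p ?F)\<^sup>2)"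
    using intp by simp
  also have "(?E p (\<lambda>x. (?F x)\<^sup>2) - (?E p ?F)\<^sup>2) \<le> ?E p (\<lambda>x. ?E ?q (\<lambda>ys. (f (x # ys) - f ys)\<^sup>2))"
  proof -
    have "?E p (\<lambda>x. (?F x - ?a)\<^sup>2) = ?E p (\<lambda>x. (?F x)\<^sup>2) + ?a\<^sup>2 - 2 * ?E p ?F * ?a"
      by (simp add: power2_diff intp)
    moreover have "0 \<le> (?E p ?F)\<^sup>2 + ?a\<^sup>2 - 2 * ?E p ?F * ?a"
      by (simp flip: power2_diff)
    ultimately have "?E p (\<lambda>x. (?F x)\<^sup>2) - (?E p ?F)\<^sup>2 \<le> ?E p (\<lambda>x. (?F x - ?a)\<^sup>2)"
      by linarith
    also have "\<dots> \<le> ?E p (\<lambda>x. ?E ?q (\<lambda>ys. (f (x # ys) - f ys)\<^sup>2))"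
    proof (rule expectation_mono_finite[OF fin])
      fix x
      have "?F x - ?a = ?E ?q (\<lambda>ys. f (x # ys) - f ys)" using intq by simp
      then show "(?F x - ?a)\<^sup>2 \<le> ?E ?q (\<lambda>ys. (f (x # ys) - f ys)\<^sup>2)"
        using expectation_square_ge[OF finq, of "\<lambda>ys. f (x # ys) - f ys"] by simp
    qed
    finally show ?thesis .
  qed
  also have "?E p (\<lambda>x. ?E ?q (\<lambda>ys. (f (x # ys))\<^sup>2) - (?F x)\<^sup>2) \<le>
      ?E p (\<lambda>x. ?E ?q (\<lambda>ys. \<Sum>i<n. (f (x # ys) - f (x # delete_nth i ys))\<^sup>2))"
  proof (rule expectation_mono_finite[OF fin])
    fix x
    show "?E ?q (\<lambda>ys. (f (x # ys))\<^sup>2) - (?F x)\<^sup>2 \<le> ?E ?q (\<lambda>ys. \<Sum>i<n. (f (x # ys) - f (x # delete_nth i ys))\<^sup>2)"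
      using Suc.IH[of "\<lambda>ys. f (x # ys)"] measure_pmf.variance_eq[OF intq[of "\<lambda>ys. f (x # ys)"] intq] by simp
  qed
  also have "?E p (\<lambda>x. ?E ?q (\<lambda>ys. \<Sum>i<n. (f (x # ys) - f (x # delete_nth i ys))\<^sup>2)) +
      ?E p (\<lambda>x. ?E ?q (\<lambda>ys. (f (x # ys) - f ys)\<^sup>2)) =
      ?E p (\<lambda>x. ?E ?q (\<lambda>ys. \<Sum>i<Suc n. (f (x # ys) - f (delete_nth i (x # ys)))\<^sup>2))"
    by (simp add: intp intq sum.lessThan_Suc_shift delete_nth_def del: sum.lessThan_Suc)
  also have "\<dots> = ?E (replicate_pmf (Suc n) p) (\<lambda>xs. \<Sum>i<Suc n. (f xs - f (delete_nth i xs))\<^sup>2)"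
    by (simp add: ES del: replicate_pmf.simps sum.lessThan_Suc)
  finally show ?case by simp
qed

section \<open>Random sets sampled at independent sites\<close>

lemma set_delete_nth:
  assumes i: "i < length xs"
  shows "set (delete_nth i xs) = {xs ! k | k. k < length xs \<and> k \<noteq> i}"
proof -
  have "set (drop (Suc i) xs) = {xs ! k | k. i < k \<and> k < length xs}"
  proof -
    have "xs ! k \<in> set (drop (Suc i) xs)" if k: "i < k" "k < length xs" for k
    proof -
      have "drop (Suc i) xs ! (k - Suc i) = xs ! k" using k by simp
      moreover have "k - Suc i < length (drop (Suc i) xs)" using k by simp
      ultimately show ?thesis by (metis nth_mem)
    qed
    moreover have "\<exists>k. x = xs ! k \<and> i < k \<and> k < length xs" if x: "x \<in> set (drop (Suc i) xs)" for x
    proof -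
      obtain k where "k < length (drop (Suc i) xs)" "drop (Suc i) xs ! k = x"
        using x unfolding in_set_conv_nth by blast
      then show ?thesis by (intro exI[of _ "Suc i + k"]) auto
    qed
    ultimately show ?thesis by blast
  qed
  moreover have "set (take i xs) = {xs ! k | k. k < i}"
    using nth_image[of i xs, symmetric] i by auto
  moreover have "{xs ! k | k. k < length xs \<and> k \<noteq> i} =
      {xs ! k | k. k < i} \<union> {xs ! k | k. i < k \<and> k < length xs}"
    using i by (auto simp: neq_iff)
  ultimately show ?thesis unfolding delete_nth_def by simp
qed

definition site_values :: "'b option list \<Rightarrow> 'b set" where
  "site_values xs = {y. Some y \<in> set xs}"

lemma finite_site_values [simp]: "finite (site_values xs)"
  by (rule finite_subset[of _ "the ` set xs"]) (force simp: site_values_def)+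

text \<open>
  Fix a largest clique and for each of its elements one entry carrying it. Deleting any other entry does not
  change the clique number, and deleting one of these entries lowers it by at most one.
\<close>
lemma clique_number_self_bounding:
  fixes xs :: "'b option list" and R :: "'b \<Rightarrow> 'b \<Rightarrow> bool"
  defines "f \<equiv> \<lambda>xs. real (clique_number R (site_values xs))"
  shows "(\<Sum>i<length xs. (f xs - f (delete_nth i xs))\<^sup>2) \<le> f xs"
proof -
  obtain C where C: "C \<subseteq> site_values xs" "pairwise R C" "card C = clique_number R (site_values xs)"
    using clique_number_attained[OF finite_site_values] by blast
  have "\<forall>y\<in>C. \<exists>i. i < length xs \<and> xs ! i = Some y"
    using C(1) by (auto simp: site_values_def in_set_conv_nth subset_iff)
  from bchoice[OF this] obtain g where g: "\<And>y. y \<in> C \<Longrightarrow> g y < length xs \<and> xs ! g y = Some y" by blast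
  have finC: "finite C" using C(1) finite_site_values by (rule finite_subset)
  have "(f xs - f (delete_nth i xs))\<^sup>2 \<le> (if i \<in> g ` C then 1 else 0)" if i: "i < length xs" for i
  proof -
    have sub: "site_values (delete_nth i xs) \<subseteq> site_values xs" using set_delete_nth[OF i] by (auto simp: site_values_def)
    then have le: "f (delete_nth i xs) \<le> f xs" unfolding f_def by (simp add: clique_number_mono)
    show ?thesis
    proof (cases "i \<in> g ` C")
      case True
      then obtain y where y: "i = g y" "y \<in> C" by auto
      have "site_values xs \<subseteq> insert y (site_values (delete_nth i xs))"
      proof
        fix z assume "z \<in> site_values xs"
        then obtain k where k: "k < length xs" "xs ! k = Some z" by (auto simp: site_values_def in_set_conv_nth)
        then show "z \<in> insert y (site_values (delete_nth i xs))"
          using set_delete_nth[OF i] g[OF y(2)] y(1) unfolding site_values_def by (cases "k = i") force+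
      qed
      then have "clique_number R (site_values xs) \<le> clique_number R (insert y (site_values (delete_nth i xs)))"
        by (intro clique_number_mono) auto
      also have "\<dots> \<le> Suc (clique_number R (site_values (delete_nth i xs)))"
        by (rule clique_number_insert_le) simp
      finally have "f xs - f (delete_nth i xs) \<le> 1" unfolding f_def by linarith
      then have "(f xs - f (delete_nth i xs))\<^sup>2 \<le> 1" using le by (simp add: power_le_one)
      then show ?thesis using True by simp
    next
      case False
      have "C \<subseteq> site_values (delete_nth i xs)"
      proof
        fix y assume y: "y \<in> C"
        then have "g y \<noteq> i" using False by auto
        then have "xs ! g y \<in> set (delete_nth i xs)" using set_delete_nth[OF i] g[OF y] by blast
        then show "y \<in> site_values (delete_nth i xs)" using g[OF y] by (simp add: site_values_def)
      qed
      then have "card C \<le> clique_number R (site_values (delete_nth i xs))"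
        using C(2) by (intro card_le_clique_number) auto
      then have "f xs = f (delete_nth i xs)" using le C(3) unfolding f_def by simp
      then show ?thesis by simp
    qed
  qed
  then have "(\<Sum>i<length xs. (f xs - f (delete_nth i xs))\<^sup>2) \<le> (\<Sum>i<length xs. if i \<in> g ` C then 1 else 0)"
    by (intro sum_mono) auto
  also have "\<dots> = real (card ({..<length xs} \<inter> g ` C))" by (simp add: sum.If_cases)
  also have "\<dots> \<le> real (card C)"
    using card_mono[of "g ` C" "{..<length xs} \<inter> g ` C"] card_image_le[OF finC, of g] finC by simp
  finally show ?thesis using C(3) unfolding f_def by simp
qed

text \<open>
  A site that yields \<open>None\<close> is empty. Empty sites turn the restriction to a subset, and more generally any
  partial map, into an operation on the law of a single site.
\<close>
primrec sample_set :: "nat \<Rightarrow> 'b option pmf \<Rightarrow> 'b set pmf" where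
  "sample_set 0 \<nu> = return_pmf {}"
| "sample_set (Suc n) \<nu> = do {x \<leftarrow> \<nu>; A \<leftarrow> sample_set n \<nu>; return_pmf (set_option x \<union> A)}"

lemma sample_set_eq: "sample_set n \<nu> = map_pmf site_values (replicate_pmf n \<nu>)"
proof (induction n)
  case 0 then show ?case by (simp add: site_values_def)
next
  case (Suc n)
  have "site_values (x # xs) = set_option x \<union> site_values xs" for x and xs :: "'a option list"
    by (cases x) (auto simp: site_values_def)
  then show ?case by (simp add: Suc map_pmf_def bind_assoc_pmf bind_return_pmf)
qed

lemma finite_set_pmf_sample_set: "finite (set_pmf \<nu>) \<Longrightarrow> finite (set_pmf (sample_set n \<nu>))"
  by (simp add: sample_set_eq finite_set_replicate_pmf)

lemma set_pmf_sample_set: "A \<in> set_pmf (sample_set n \<nu>) \<Longrightarrow> finite A \<and> card A \<le> n \<and> Some ` A \<subseteq> set_pmf \<nu>"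
proof -
  assume "A \<in> set_pmf (sample_set n \<nu>)"
  then obtain xs where xs: "A = site_values xs" "set xs \<subseteq> set_pmf \<nu>" "length xs = n"
    by (auto simp: sample_set_eq set_replicate_pmf lists_eq_set)
  have "card A = card (Some ` A)" by (simp add: card_image)
  also have "\<dots> \<le> card (set xs)" using xs by (intro card_mono) (auto simp: site_values_def)
  finally show ?thesis using xs card_length[of xs] finite_site_values[of xs] by (auto simp: site_values_def)
qed

definition expected_clique :: "('b \<Rightarrow> 'b \<Rightarrow> bool) \<Rightarrow> nat \<Rightarrow> 'b option pmf \<Rightarrow> real" where
  "expected_clique R n \<nu> = measure_pmf.expectation (sample_set n \<nu>) (\<lambda>A. real (clique_number R A))"

text \<open>
  The only concentration property used: when the expected clique number tends to infinity, the clique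
  number is asymptotically equal to it with high probability.
\<close>
lemma variance_clique_number_le:
  assumes "finite (set_pmf \<nu>)"
  shows "measure_pmf.variance (sample_set n \<nu>) (\<lambda>A. real (clique_number R A)) \<le> expected_clique R n \<nu>"
proof -
  let ?f = "\<lambda>xs. real (clique_number R (site_values xs))"
  have "measure_pmf.variance (sample_set n \<nu>) (\<lambda>A. real (clique_number R A)) =
      measure_pmf.variance (replicate_pmf n \<nu>) ?f"
    by (simp add: sample_set_eq)
  also have "\<dots> \<le> measure_pmf.expectation (replicate_pmf n \<nu>) (\<lambda>xs. \<Sum>i<n. (?f xs - ?f (delete_nth i xs))\<^sup>2)"
    by (rule Efron_Stein[OF assms])
  also have "\<dots> \<le> measure_pmf.expectation (replicate_pmf n \<nu>) ?f"
  proof (rule expectation_mono_finite[OF finite_set_replicate_pmf[OF assms]])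
    fix xs assume "xs \<in> set_pmf (replicate_pmf n \<nu>)"
    then have "length xs = n" by (simp add: set_replicate_pmf)
    then show "(\<Sum>i<n. (?f xs - ?f (delete_nth i xs))\<^sup>2) \<le> ?f xs"
      using clique_number_self_bounding[of R xs] by simp
  qed
  also have "\<dots> = expected_clique R n \<nu>" by (simp add: expected_clique_def sample_set_eq)
  finally show ?thesis .
qed

lemma expectation_sample_set_Suc:
  fixes f :: "'b set \<Rightarrow> real"
  assumes "finite (set_pmf \<nu>)"
  shows "measure_pmf.expectation (sample_set (Suc n) \<nu>) f =
    measure_pmf.expectation \<nu> (\<lambda>x. measure_pmf.expectation (sample_set n \<nu>) (\<lambda>A. f (set_option x \<union> A)))"
  using assms by (simp add: expectation_bind_finite finite_set_pmf_sample_set)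

lemma expectation_option:
  fixes h :: "'b option \<Rightarrow> real"
  assumes "finite (set_pmf \<nu>)" "finite S" "\<And>y. Some y \<in> set_pmf \<nu> \<Longrightarrow> y \<in> S"
  shows "measure_pmf.expectation \<nu> h = h None + (\<Sum>y\<in>S. pmf \<nu> (Some y) * (h (Some y) - h None))"
proof -
  let ?S = "insert None (Some ` S)"
  have sub: "set_pmf \<nu> \<subseteq> ?S"
  proof
    fix x assume "x \<in> set_pmf \<nu>"
    then show "x \<in> ?S" using assms(3) by (cases x) auto
  qed
  have "(\<Sum>x\<in>?S. pmf \<nu> x) = 1" using sub assms(2) by (intro sum_pmf_eq_1) auto
  then have None: "pmf \<nu> None = 1 - (\<Sum>y\<in>S. pmf \<nu> (Some y))"
    using assms(2) by (simp add: sum.reindex)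
  have "measure_pmf.expectation \<nu> h = (\<Sum>x\<in>?S. pmf \<nu> x * h x)"
    using sub assms(2) by (subst integral_measure_pmf[of ?S]) auto
  also have "\<dots> = pmf \<nu> None * h None + (\<Sum>y\<in>S. pmf \<nu> (Some y) * h (Some y))"
    using assms(2) by (simp add: sum.reindex)
  also have "\<dots> = h None + (\<Sum>y\<in>S. pmf \<nu> (Some y) * (h (Some y) - h None))"
    by (simp add: None right_diff_distrib sum_subtractf sum_distrib_right left_diff_distrib)
  finally show ?thesis .
qed

text \<open>
  The sites are exchanged one at a time. Moving mass from \<open>None\<close> to an element enlarges the sampled set and
  so does not decrease the expectation of a monotone function.
\<close>
lemma expectation_sample_set_dominated:
  fixes f :: "'b set \<Rightarrow> real"
  assumes fin: "finite (set_pmf \<mu>)" "finite (set_pmf \<nu>)"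
    and dom: "\<And>y. pmf \<mu> (Some y) \<le> pmf \<nu> (Some y)"
    and mono: "\<And>A B. finite B \<Longrightarrow> A \<subseteq> B \<Longrightarrow> f A \<le> f B"
  shows "measure_pmf.expectation (sample_set n \<mu>) f \<le> measure_pmf.expectation (sample_set n \<nu>) f"
  using mono
proof (induction n arbitrary: f)
  case 0 then show ?case by simp
next
  case (Suc n)
  let ?S = "the ` (set_pmf \<mu> \<union> set_pmf \<nu>)"
  have S: "finite ?S" "\<And>y. Some y \<in> set_pmf \<mu> \<Longrightarrow> y \<in> ?S" "\<And>y. Some y \<in> set_pmf \<nu> \<Longrightarrow> y \<in> ?S"
    using fin by force+
  let ?h = "\<lambda>x. measure_pmf.expectation (sample_set n \<nu>) (\<lambda>A. f (set_option x \<union> A))"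
  have fr: "finite (set_pmf (sample_set n \<nu>))" using fin finite_set_pmf_sample_set by blast
  have "measure_pmf.expectation (sample_set (Suc n) \<mu>) f \<le> measure_pmf.expectation \<mu> ?h"
    unfolding expectation_sample_set_Suc[OF fin(1)]
  proof (rule expectation_mono_finite[OF fin(1)], rule Suc.IH)
    fix x :: "'b option" and A B :: "'b set" assume "finite B" "A \<subseteq> B"
    then show "f (set_option x \<union> A) \<le> f (set_option x \<union> B)"
      by (intro Suc.prems) auto
  qed
  also have "\<dots> = ?h None + (\<Sum>y\<in>?S. pmf \<mu> (Some y) * (?h (Some y) - ?h None))"
    by (rule expectation_option[OF fin(1) S(1,2)])
  also have "\<dots> \<le> ?h None + (\<Sum>y\<in>?S. pmf \<nu> (Some y) * (?h (Some y) - ?h None))"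
  proof (intro add_left_mono sum_mono mult_right_mono dom)
    fix y
    have "?h None \<le> ?h (Some y)"
    proof (rule expectation_mono_finite[OF fr])
      fix A assume "A \<in> set_pmf (sample_set n \<nu>)"
      then have "finite A" using set_pmf_sample_set by blast
      then show "f (set_option None \<union> A) \<le> f (set_option (Some y) \<union> A)"
        by (intro Suc.prems) auto
    qed
    then show "0 \<le> ?h (Some y) - ?h None" by simp
  qed
  also have "\<dots> = measure_pmf.expectation (sample_set (Suc n) \<nu>) f"
    unfolding expectation_sample_set_Suc[OF fin(2)] by (rule expectation_option[OF fin(2) S(1,3), symmetric])
  finally show ?case .
qed

lemma expected_clique_dominated:
  assumes "finite (set_pmf \<mu>)" "finite (set_pmf \<nu>)" "\<And>y. pmf \<mu> (Some y) \<le> pmf \<nu> (Some y)"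
  shows "expected_clique R n \<mu> \<le> expected_clique R n \<nu>"
  unfolding expected_clique_def using assms by (intro expectation_sample_set_dominated) (auto intro: clique_number_mono)

lemma expected_clique_nonneg: "0 \<le> expected_clique R n \<nu>"
  unfolding expected_clique_def by simp

lemma expected_clique_le:
  assumes "finite (set_pmf \<nu>)" shows "expected_clique R n \<nu> \<le> n"
proof -
  have "expected_clique R n \<nu> \<le> measure_pmf.expectation (sample_set n \<nu>) (\<lambda>_. real n)"
    unfolding expected_clique_def
  proof (intro expectation_mono_finite finite_set_pmf_sample_set assms)
    fix A assume "A \<in> set_pmf (sample_set n \<nu>)"
    then have "finite A" "card A \<le> n" using set_pmf_sample_set by blast+
    then show "real (clique_number R A) \<le> real n"
      using clique_number_le_card[of A R] by simp
  qed
  then show ?thesis by simp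
qed

lemma expected_clique_mono:
  assumes fin: "finite (set_pmf \<nu>)" and "n \<le> n'" shows "expected_clique R n \<nu> \<le> expected_clique R n' \<nu>"
proof (rule lift_Suc_mono_le[OF _ assms(2)])
  fix n
  have fr: "finite (set_pmf (sample_set n \<nu>))" using fin finite_set_pmf_sample_set by blast
  have "expected_clique R n \<nu> = measure_pmf.expectation \<nu> (\<lambda>x. expected_clique R n \<nu>)" by simp
  also have "\<dots> \<le> expected_clique R (Suc n) \<nu>"
    unfolding expected_clique_def expectation_sample_set_Suc[OF fin]
    using set_pmf_sample_set
    by (intro expectation_mono_finite[OF fin] expectation_mono_finite[OF fr])
       (auto intro!: clique_number_mono)
  finally show "expected_clique R n \<nu> \<le> expected_clique R (Suc n) \<nu>" .
qed

lemma sample_set_map_option: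
  fixes \<psi> :: "'a \<Rightarrow> 'b option"
  shows "sample_set n (map_pmf (\<lambda>z. Option.bind z \<psi>) \<mu>) = map_pmf (\<lambda>A. {y. \<exists>x\<in>A. \<psi> x = Some y}) (sample_set n \<mu>)"
proof (induction n)
  case 0 then show ?case by simp
next
  case (Suc n)
  have *: "{y. \<exists>x\<in>set_option z \<union> A. \<psi> x = Some y} = set_option (Option.bind z \<psi>) \<union> {y. \<exists>x\<in>A. \<psi> x = Some y}" for z A
  proof (cases z)
    case (Some x) then show ?thesis by (cases "\<psi> x") auto
  qed simp
  have "sample_set (Suc n) (map_pmf (\<lambda>z. Option.bind z \<psi>) \<mu>) =
      do {z \<leftarrow> \<mu>; A \<leftarrow> sample_set n \<mu>; return_pmf (set_option (Option.bind z \<psi>) \<union> {y. \<exists>x\<in>A. \<psi> x = Some y})}"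
    by (simp only: sample_set.simps Suc bind_map_pmf)
  also have "\<dots> = map_pmf (\<lambda>A. {y. \<exists>x\<in>A. \<psi> x = Some y}) (sample_set (Suc n) \<mu>)"
    by (simp only: sample_set.simps map_bind_pmf map_return_pmf *)
  finally show ?case .
qed

lemma sum_expected_clique_le:
  fixes \<mu> :: "'a option pmf" and \<phi> :: "'i \<Rightarrow> 'a \<Rightarrow> 'b option"
  assumes fin: "finite (set_pmf \<mu>)" and I: "finite I"
    and phi: "\<And>i x x' y y'. \<lbrakk>i \<in> I; Some x \<in> set_pmf \<mu>; Some x' \<in> set_pmf \<mu>;
       \<phi> i x = Some y; \<phi> i x' = Some y'; R' y y'\<rbrakk> \<Longrightarrow> R x x'"
    and cross: "\<And>i i' x x'. \<lbrakk>i \<in> I; i' \<in> I; i \<noteq> i'; Some x \<in> set_pmf \<mu>; Some x' \<in> set_pmf \<mu>;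
       \<phi> i x \<noteq> None; \<phi> i' x' \<noteq> None\<rbrakk> \<Longrightarrow> x \<noteq> x' \<and> R x x'"
  shows "(\<Sum>i\<in>I. expected_clique R' n (map_pmf (\<lambda>z. Option.bind z (\<phi> i)) \<mu>)) \<le> expected_clique R n \<mu>"
proof -
  have fr: "finite (set_pmf (sample_set n \<mu>))" using fin finite_set_pmf_sample_set by blast
  have int: "integrable (sample_set n \<mu>) g" for g :: "'a set \<Rightarrow> real" using fr by (rule integrable_measure_pmf_finite)
  have "(\<Sum>i\<in>I. expected_clique R' n (map_pmf (\<lambda>z. Option.bind z (\<phi> i)) \<mu>)) =
    measure_pmf.expectation (sample_set n \<mu>) (\<lambda>A. \<Sum>i\<in>I. real (clique_number R' {y. \<exists>x\<in>A. \<phi> i x = Some y}))"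
    unfolding expected_clique_def by (simp add: int sample_set_map_option)
  also have "\<dots> \<le> expected_clique R n \<mu>"
    unfolding expected_clique_def
  proof (rule expectation_mono_finite[OF fr])
    fix A assume "A \<in> set_pmf (sample_set n \<mu>)"
    then have A: "finite A" "Some ` A \<subseteq> set_pmf \<mu>" using set_pmf_sample_set by blast+
    then have S: "Some x \<in> set_pmf \<mu>" if "x \<in> A" for x using that by (simp add: image_subset_iff)
    have "(\<Sum>i\<in>I. clique_number R' {y. \<exists>x\<in>A. \<phi> i x = Some y}) \<le> clique_number R A"
    proof (rule sum_clique_number_le[OF A(1) I])
      fix i x x' y y' assume *: "i \<in> I" "x \<in> A" "x' \<in> A" "\<phi> i x = Some y" "\<phi> i x' = Some y'" "R' y y'"
      show "R x x'" by (rule phi[OF *(1) S[OF *(2)] S[OF *(3)] *(4-6)])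
    next
      fix i i' x x' assume *: "i \<in> I" "i' \<in> I" "i \<noteq> i'" "x \<in> A" "x' \<in> A" "\<phi> i x \<noteq> None" "\<phi> i' x' \<noteq> None"
      show "x \<noteq> x' \<and> R x x'" by (rule cross[OF *(1-3) S[OF *(4)] S[OF *(5)] *(6,7)])
    qed
    then show "(\<Sum>i\<in>I. real (clique_number R' {y. \<exists>x\<in>A. \<phi> i x = Some y})) \<le> real (clique_number R A)"
      by (simp only: of_nat_sum[symmetric] of_nat_le_iff)
  qed
  finally show ?thesis .
qed

definition thin :: "real \<Rightarrow> 'b option pmf \<Rightarrow> 'b option pmf" where
  "thin p \<nu> = do {b \<leftarrow> bernoulli_pmf p; if b then \<nu> else return_pmf None}"

lemma pmf_thin: "p \<in> {0..1} \<Longrightarrow> pmf (thin p \<nu>) (Some y) = p * pmf \<nu> (Some y)"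
  unfolding thin_def by (simp add: pmf_bind)

lemma finite_set_thin: "finite (set_pmf \<nu>) \<Longrightarrow> finite (set_pmf (thin p \<nu>))"
  unfolding thin_def by (auto simp: set_bind_pmf)

lemma sample_set_thin:
  assumes p: "p \<in> {0..1}"
  shows "sample_set n (thin p \<nu>) = bind_pmf (binomial_pmf n p) (\<lambda>k. sample_set k \<nu>)"
proof (induction n)
  case 0 then show ?case using p by (simp add: binomial_pmf_0 bind_return_pmf)
next
  case (Suc n)
  have "sample_set (Suc n) (thin p \<nu>) = do {b \<leftarrow> bernoulli_pmf p; x \<leftarrow> (if b then \<nu> else return_pmf None);
      k \<leftarrow> binomial_pmf n p; A \<leftarrow> sample_set k \<nu>; return_pmf (set_option x \<union> A)}"
    by (simp add: Suc) (simp add: thin_def bind_assoc_pmf)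
  also have "\<dots> = do {b \<leftarrow> bernoulli_pmf p; k \<leftarrow> binomial_pmf n p; x \<leftarrow> (if b then \<nu> else return_pmf None);
      A \<leftarrow> sample_set k \<nu>; return_pmf (set_option x \<union> A)}"
    by (subst bind_commute_pmf) simp
  also have "\<dots> = do {b \<leftarrow> bernoulli_pmf p; k \<leftarrow> binomial_pmf n p; sample_set ((if b then 1 else 0) + k) \<nu>}"
    by (intro bind_pmf_cong refl) (simp add: bind_return_pmf bind_return_pmf')
  also have "\<dots> = bind_pmf (binomial_pmf (Suc n) p) (\<lambda>k. sample_set k \<nu>)"
    using p by (simp add: binomial_pmf_Suc bind_assoc_pmf bind_return_pmf)
  finally show ?case .
qed

lemma expected_clique_thin:
  assumes "p \<in> {0..1}" "finite (set_pmf \<nu>)"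
  shows "expected_clique R n (thin p \<nu>) = measure_pmf.expectation (binomial_pmf n p) (\<lambda>k. expected_clique R k \<nu>)"
  unfolding expected_clique_def sample_set_thin[OF assms(1)] using assms
  by (intro expectation_bind_finite finite_set_pmf_sample_set) auto

lemma binomial_mean:
  assumes "p \<in> {0..1}"
  shows "measure_pmf.expectation (binomial_pmf n p) real = n * p"
proof (induction n)
  case 0 then show ?case using assms by (simp add: binomial_pmf_0)
next
  case (Suc n)
  then show ?case using assms
    by (simp add: binomial_pmf_Suc expectation_bind_finite finite_set_pmf_binomial_pmf algebra_simps)
qed

text \<open>
  The Efron-Stein inequality for the number of successes: deleting a coordinate changes this number by one
  if the coordinate is a success and not at all otherwise.
\<close>
lemma binomial_variance_le:
  assumes "p \<in> {0..1}"
  shows "measure_pmf.variance (binomial_pmf n p) real \<le> n * p"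
proof -
  let ?q = "replicate_pmf n (bernoulli_pmf p)"
  let ?f = "\<lambda>xs. real (length (filter id xs))"
  have fin: "finite (set_pmf (bernoulli_pmf p))" by simp
  have "measure_pmf.variance (binomial_pmf n p) real = measure_pmf.variance ?q ?f"
    using assms by (simp add: binomial_pmf_altdef)
  also have "\<dots> \<le> measure_pmf.expectation ?q (\<lambda>xs. \<Sum>i<n. (?f xs - ?f (delete_nth i xs))\<^sup>2)"
    by (rule Efron_Stein[OF fin])
  also have "\<dots> \<le> measure_pmf.expectation ?q ?f"
  proof (rule expectation_mono_finite[OF finite_set_replicate_pmf[OF fin]])
    fix xs :: "bool list" assume "xs \<in> set_pmf ?q"
    then have n: "n = length xs" by (simp add: set_replicate_pmf)
    have "(?f xs - ?f (delete_nth i xs))\<^sup>2 = (if xs ! i then 1 else 0)" if "i < length xs" for i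
    proof -
      have "filter id xs = filter id (take i xs @ xs ! i # drop (Suc i) xs)"
        by (subst id_take_nth_drop[OF that]) simp
      then show ?thesis by (simp add: delete_nth_def)
    qed
    then have "(\<Sum>i<n. (?f xs - ?f (delete_nth i xs))\<^sup>2) = (\<Sum>i<length xs. if xs ! i then 1 else 0)"
      unfolding n by (intro sum.cong) auto
    also have "\<dots> = real (card {i. i < length xs \<and> xs ! i})"
      by (simp add: sum.If_cases Int_def)
    also have "\<dots> = ?f xs" by (simp add: length_filter_conv_card)
    finally show "(\<Sum>i<n. (?f xs - ?f (delete_nth i xs))\<^sup>2) \<le> ?f xs" by simp
  qed
  also have "\<dots> = n * p" using binomial_mean[OF assms, of n] assms by (simp add: binomial_pmf_altdef o_def)
  finally show ?thesis .
qed

lemma Chebyshev_finite: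
  fixes f :: "'b \<Rightarrow> real"
  assumes "finite (set_pmf M)" "a > 0"
  shows "measure_pmf.prob M {x. a \<le> \<bar>f x - measure_pmf.expectation M f\<bar>} \<le> measure_pmf.variance M f / a\<^sup>2"
proof -
  have "integrable M g" for g :: "'b \<Rightarrow> real" using assms(1) by (rule integrable_measure_pmf_finite)
  from measure_pmf.Chebyshev_inequality[of f M a, OF _ this assms(2)] show ?thesis by simp
qed

lemma binomial_lower_tail:
  assumes p: "p \<in> {0..1}" and k: "real k < n * p"
  shows "measure_pmf.prob (binomial_pmf n p) {..<k} \<le> n * p / (n * p - k)\<^sup>2"
proof -
  let ?M = "binomial_pmf n p"
  have "measure_pmf.prob ?M {..<k} \<le> measure_pmf.prob ?M {x. n * p - k \<le> \<bar>real x - n * p\<bar>}"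
    by (intro measure_pmf.finite_measure_mono) auto
  also have "\<dots> \<le> measure_pmf.variance ?M real / (n * p - k)\<^sup>2"
    using Chebyshev_finite[of ?M "n * p - k" real] binomial_mean[OF p] k p
    by (simp add: finite_set_pmf_binomial_pmf)
  also have "\<dots> \<le> n * p / (n * p - k)\<^sup>2"
    using binomial_variance_le[OF p] by (intro divide_right_mono) auto
  finally show ?thesis .
qed

text \<open>
  At least \<open>k\<close> of the \<open>n\<close> sites survive the thinning, except with a probability that Chebyshev's inequality
  bounds.
\<close>
lemma expected_clique_thin_ge:
  assumes p: "p \<in> {0..1}" and k: "real k < n * p" and fin: "finite (set_pmf \<nu>)"
  shows "expected_clique R n (thin p \<nu>) \<ge> expected_clique R k \<nu> * (1 - n * p / (n * p - k)\<^sup>2)"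
proof -
  let ?M = "binomial_pmf n p"
  have finM: "finite (set_pmf ?M)" using p by (rule finite_set_pmf_binomial_pmf)
  have "expected_clique R k \<nu> * (1 - n * p / (n * p - k)\<^sup>2) \<le> expected_clique R k \<nu> * (1 - measure_pmf.prob ?M {..<k})"
    using binomial_lower_tail[OF p k] by (intro mult_left_mono) (auto simp: expected_clique_nonneg)
  also have "1 - measure_pmf.prob ?M {..<k} = measure_pmf.prob ?M {k..}"
    using measure_pmf.prob_compl[of "{..<k}" ?M] by (simp add: Compl_eq_Diff_UNIV[symmetric] Compl_lessThan)
  also have "expected_clique R k \<nu> * measure_pmf.prob ?M {k..} = measure_pmf.expectation ?M (\<lambda>x. expected_clique R k \<nu> * indicator {k..} x)"
    by simp
  also have "\<dots> \<le> measure_pmf.expectation ?M (\<lambda>x. expected_clique R x \<nu>)"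
    by (intro expectation_mono_finite[OF finM]) (auto simp: indicator_def expected_clique_nonneg expected_clique_mono[OF fin])
  finally show ?thesis by (simp add: expected_clique_thin[OF p fin])
qed

text \<open>
  A union bound over the assignments of the elements of \<open>C\<close> to distinct sites would give this with a falling
  factorial. Adding one site at a time, the new site carries at most one element of \<open>C\<close>, and
  \<open>n ^ t + t * n ^ (t - 1) \<le> (n + 1) ^ t\<close> closes the induction.
\<close>
lemma prob_subset_sample_set:
  assumes fin: "finite (set_pmf \<nu>)" and "0 \<le> \<rho>"
  shows "finite C \<Longrightarrow> (\<And>y. y \<in> C \<Longrightarrow> pmf \<nu> (Some y) \<le> \<rho>) \<Longrightarrow>
    measure_pmf.prob (sample_set n \<nu>) {A. C \<subseteq> A} \<le> (n * \<rho>) ^ card C"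
proof (induction n arbitrary: C)
  case 0
  then show ?case by (cases "C = {}") (auto simp: indicator_def card_gt_0_iff)
next
  case (Suc n)
  let ?P = "\<lambda>C. measure_pmf.prob (sample_set n \<nu>) {A. C \<subseteq> A}"
  let ?t = "card C"
  let ?S = "the ` set_pmf \<nu> \<union> C"
  have "measure_pmf.prob (sample_set (Suc n) \<nu>) {A. C \<subseteq> A} =
     measure_pmf.expectation (sample_set (Suc n) \<nu>) (indicator {A. C \<subseteq> A})" by simp
  also have "\<dots> = measure_pmf.expectation \<nu> (\<lambda>x. ?P (C - set_option x))"
  proof -
    have "(indicator {A. C \<subseteq> A} (set_option x \<union> A) :: real) = indicator {A. C - set_option x \<subseteq> A} A" for x A
      by (auto simp: indicator_def)
    then show ?thesis unfolding expectation_sample_set_Suc[OF fin] by simp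
  qed
  also have "\<dots> = ?P C + (\<Sum>y\<in>?S. pmf \<nu> (Some y) * (?P (C - {y}) - ?P C))"
    using Suc.prems(1) fin by (subst expectation_option[of \<nu> ?S]) (force simp: image_iff)+
  also have "(\<Sum>y\<in>?S. pmf \<nu> (Some y) * (?P (C - {y}) - ?P C)) = (\<Sum>y\<in>C. pmf \<nu> (Some y) * (?P (C - {y}) - ?P C))"
    using Suc.prems(1) fin by (intro sum.mono_neutral_right) auto
  also have "?P C + \<dots> \<le> (n * \<rho>) ^ ?t + (\<Sum>y\<in>C. \<rho> * (n * \<rho>) ^ (?t - 1))"
  proof (intro add_mono sum_mono)
    show "?P C \<le> (n * \<rho>) ^ ?t" using Suc.IH[of C] Suc.prems by simp
    fix y assume y: "y \<in> C"
    have le: "?P (C - {y}) \<le> (n * \<rho>) ^ (?t - 1)"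
      using Suc.IH[of "C - {y}"] Suc.prems y by simp
    have "?P C \<le> ?P (C - {y})" by (intro measure_pmf.finite_measure_mono) auto
    then have "pmf \<nu> (Some y) * (?P (C - {y}) - ?P C) \<le> \<rho> * (?P (C - {y}) - ?P C)"
      using Suc.prems(2)[OF y] by (intro mult_right_mono) auto
    also have "\<dots> \<le> \<rho> * (n * \<rho>) ^ (?t - 1)" using le assms(2) by (intro mult_left_mono) (auto simp: measure_nonneg intro: order_trans[rotated])
    finally show "pmf \<nu> (Some y) * (?P (C - {y}) - ?P C) \<le> \<rho> * (n * \<rho>) ^ (?t - 1)" .
  qed
  also have "\<dots> \<le> (Suc n * \<rho>) ^ ?t"
  proof (cases ?t)
    case 0 then show ?thesis by simp
  next
    case (Suc s)
    have "real n ^ Suc s + Suc s * real n ^ s \<le> (real n + 1) ^ Suc s"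
    proof (induction s)
      case (Suc s)
      have "real n ^ Suc (Suc s) + Suc (Suc s) * real n ^ Suc s \<le>
          (real n + 1) * (real n ^ Suc s + Suc s * real n ^ s)"
        by (simp add: algebra_simps)
      also have "\<dots> \<le> (real n + 1) * (real n + 1) ^ Suc s" by (intro mult_left_mono Suc) auto
      finally show ?case by simp
    qed simp
    then have "\<rho> ^ Suc s * (real n ^ Suc s + Suc s * real n ^ s) \<le> \<rho> ^ Suc s * (real n + 1) ^ Suc s"
      using assms(2) by (intro mult_left_mono) auto
    moreover have "\<rho> ^ Suc s * (real n + 1) ^ Suc s = (Suc n * \<rho>) ^ Suc s"
      by (simp only: power_mult_distrib of_nat_Suc) (simp add: mult.commute add.commute)
    moreover have "\<rho> ^ Suc s * (real n ^ Suc s + Suc s * real n ^ s) = (n * \<rho>) ^ Suc s + Suc s * (\<rho> * (n * \<rho>) ^ s)"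
      by (simp only: power_mult_distrib power_Suc) (simp add: algebra_simps)
    ultimately have "(n * \<rho>) ^ Suc s + Suc s * (\<rho> * (n * \<rho>) ^ s) \<le> (Suc n * \<rho>) ^ Suc s"
      by linarith
    then show ?thesis using Suc by simp
  qed
  finally show ?case .
qed

section \<open>Tuples of chunks and their scaling\<close>

text \<open>
  Choosing one preimage for each element of \<open>Z'\<close> yields pairwise different sets \<open>Z\<close>.
\<close>
lemma card_sections_ge:
  assumes "finite A" "finite Z'" and fib: "\<And>y. y \<in> Z' \<Longrightarrow> card {x\<in>A. \<phi> x = y} = c"
  shows "c ^ card Z' \<le> card {Z. Z \<subseteq> A \<and> \<phi> ` Z = Z' \<and> card Z = card Z'}"
proof -
  let ?P = "PiE Z' (\<lambda>y. {x\<in>A. \<phi> x = y})"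
  have g: "\<phi> (g y) = y" "g y \<in> A" if "g \<in> ?P" "y \<in> Z'" for g y
    using PiE_mem[OF that] by auto
  have inj: "inj_on (\<lambda>g. g ` Z') ?P"
  proof (rule inj_onI)
    fix g h assume gh: "g \<in> ?P" "h \<in> ?P" "g ` Z' = h ` Z'"
    show "g = h"
    proof (rule PiE_ext[OF gh(1,2)])
      fix y assume y: "y \<in> Z'"
      then have "g y \<in> h ` Z'" using gh(3) by blast
      then obtain y' where y': "y' \<in> Z'" "g y = h y'" by auto
      then have "y = y'" using g(1)[OF gh(1) y] g(1)[OF gh(2) y'(1)] by argo
      then show "g y = h y" using y' by simp
    qed
  qed
  have "h ` Z' \<subseteq> A \<and> \<phi> ` (h ` Z') = Z' \<and> card (h ` Z') = card Z'" if h: "h \<in> ?P" for h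
  proof (intro conjI)
    show "h ` Z' \<subseteq> A" using g(2)[OF h] by auto
    show "\<phi> ` (h ` Z') = Z'" unfolding image_image using g(1)[OF h] by simp
    show "card (h ` Z') = card Z'"
    proof (rule card_image, rule inj_onI)
      fix y y' assume "y \<in> Z'" "y' \<in> Z'" "h y = h y'"
      then show "y = y'" using g(1)[OF h \<open>y \<in> Z'\<close>] g(1)[OF h \<open>y' \<in> Z'\<close>] by argo
    qed
  qed
  then have "(\<lambda>g. g ` Z') ` ?P \<subseteq> {Z. Z \<subseteq> A \<and> \<phi> ` Z = Z' \<and> card Z = card Z'}"
    unfolding image_subset_iff mem_Collect_eq by (rule ballI)
  moreover have "finite {Z. Z \<subseteq> A \<and> \<phi> ` Z = Z' \<and> card Z = card Z'}"
    by (rule finite_subset[of _ "Pow A"]) (use assms(1) in auto)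
  ultimately have "card ((\<lambda>g. g ` Z') ` ?P) \<le> card {Z. Z \<subseteq> A \<and> \<phi> ` Z = Z' \<and> card Z = card Z'}"
    by (intro card_mono)
  then have "card ?P \<le> card {Z. Z \<subseteq> A \<and> \<phi> ` Z = Z' \<and> card Z = card Z'}"
    using card_image[OF inj] by simp
  moreover have "card ?P = c ^ card Z'" using assms by (simp add: card_PiE)
  ultimately show ?thesis by simp
qed

lemma pmf_map_ge: "f x = y \<Longrightarrow> pmf p x \<le> pmf (map_pmf f p) y"
  unfolding pmf_map by (subst measure_pmf_single[symmetric]) (rule measure_pmf.finite_measure_mono, auto)

text \<open>
  There are \<open>l\<close> blocks, and an edge meets the \<open>j\<close>-th one in a chunk of \<open>m j\<close> vertices. An edge is recorded
  as the tuple of its chunks, a function on \<open>{..<l}\<close>.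
\<close>
locale block_sizes =
  fixes l :: nat and m :: "nat \<Rightarrow> nat"
  assumes l_pos: "0 < l" and m_pos: "\<And>j. j < l \<Longrightarrow> 0 < m j"
begin

definition r :: nat where "r = (\<Sum>j<l. m j)"

definition block_tuples :: "(nat \<Rightarrow> nat set) \<Rightarrow> (nat \<Rightarrow> nat set) set" where
  "block_tuples A = PiE {..<l} (\<lambda>j. {Z. Z \<subseteq> A j \<and> card Z = m j})"

definition precedes :: "(nat \<Rightarrow> bool) \<Rightarrow> (nat \<Rightarrow> nat set) \<Rightarrow> (nat \<Rightarrow> nat set) \<Rightarrow> bool" where
  "precedes d Y Y' \<longleftrightarrow> (\<forall>j<l. \<forall>y\<in>Y j. \<forall>y'\<in>Y' j. if d j then y < y' else y' < y)"

text \<open>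
  The direction \<open>d\<close> records which blocks of the pattern reverse the order of the edges. The cliques of this
  relation are the chains of tuples.
\<close>
definition comparable :: "(nat \<Rightarrow> bool) \<Rightarrow> (nat \<Rightarrow> nat set) \<Rightarrow> (nat \<Rightarrow> nat set) \<Rightarrow> bool" where
  "comparable d Y Y' \<longleftrightarrow> precedes d Y Y' \<or> precedes d Y' Y"

text \<open>
  The probability that \<open>m j\<close> independent uniform points of each \<open>A j\<close> form a prescribed tuple of sets.
  Coinciding points are discarded, which leaves a total mass of at most one. In return
  the weights scale exactly under restriction to subintervals and under maps with fibres of equal size.
\<close>
definition tuple_weight :: "(nat \<Rightarrow> nat set) \<Rightarrow> real" where
  "tuple_weight A = (\<Prod>j<l. fact (m j) / real (card (A j)) ^ m j)"

definition tuple_pmf :: "(nat \<Rightarrow> nat set) \<Rightarrow> (nat \<Rightarrow> nat set) option pmf" where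
  "tuple_pmf A = thin (real (card (block_tuples A)) * tuple_weight A) (map_pmf Some (pmf_of_set (block_tuples A)))"

lemma r_pos: "0 < r"
proof -
  have "m 0 \<le> r" unfolding r_def using l_pos by (intro member_le_sum) auto
  then show ?thesis using m_pos[OF l_pos] by simp
qed

lemma tuple_weight_nonneg: "0 \<le> tuple_weight A"
  unfolding tuple_weight_def by (intro prod_nonneg) auto

lemma block_tuplesD: "Y \<in> block_tuples A \<Longrightarrow> j < l \<Longrightarrow> Y j \<subseteq> A j \<and> card (Y j) = m j \<and> finite (Y j) \<and> Y j \<noteq> {}"
proof -
  assume "Y \<in> block_tuples A" "j < l"
  then have "Y j \<in> {Z. Z \<subseteq> A j \<and> card Z = m j}"
    using PiE_mem[OF \<open>Y \<in> block_tuples A\<close>[unfolded block_tuples_def], of j] by simp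
  then have *: "Y j \<subseteq> A j" "card (Y j) = m j" by simp_all
  have "0 < card (Y j)" using *(2) m_pos[OF \<open>j < l\<close>] by simp
  then have "finite (Y j) \<and> Y j \<noteq> {}" using card_gt_0_iff[of "Y j"] by blast
  with * show ?thesis by (intro conjI) (elim conjE, assumption)+
qed

lemma block_tuples_mem: "Y \<in> block_tuples A \<Longrightarrow> j < l \<Longrightarrow> y \<in> Y j \<Longrightarrow> y \<in> A j"
  using block_tuplesD[of Y A j] by blast

lemma finite_block_tuples:
  assumes "\<And>j. j < l \<Longrightarrow> finite (A j)" shows "finite (block_tuples A)"
  unfolding block_tuples_def
proof (rule finite_PiE)
  fix j assume "j \<in> {..<l}"
  then show "finite {Z. Z \<subseteq> A j \<and> card Z = m j}"
    using assms by (auto intro: finite_subset[of _ "Pow (A j)"])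
qed simp

lemma card_block_tuples:
  assumes "\<And>j. j < l \<Longrightarrow> finite (A j)" shows "card (block_tuples A) = (\<Prod>j<l. card (A j) choose m j)"
  unfolding block_tuples_def using assms by (simp add: card_PiE n_subsets)

lemma mass_tuple_pmf:
  assumes "\<And>j. j < l \<Longrightarrow> finite (A j)" shows "real (card (block_tuples A)) * tuple_weight A \<in> {0..1}"
proof -
  have "real (card (block_tuples A)) * tuple_weight A = (\<Prod>j<l. real (card (A j) choose m j) * (fact (m j) / real (card (A j)) ^ m j))"
    using assms by (simp add: card_block_tuples tuple_weight_def flip: prod.distrib)
  also have "\<dots> \<le> (\<Prod>j<l. 1)"
  proof (intro prod_mono conjI)
    fix j assume "j \<in> {..<l}"
    have "real ((card (A j) choose m j) * fact (m j)) \<le> real (card (A j) ^ m j)"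
      using binomial_fact_pow[of "card (A j)" "m j"] by (simp only: of_nat_le_iff)
    then show "real (card (A j) choose m j) * (fact (m j) / real (card (A j)) ^ m j) \<le> 1"
      by (cases "card (A j) = 0") (auto simp: divide_simps power_0_left)
  qed auto
  finally show ?thesis using tuple_weight_nonneg[of A] by simp
qed

lemma pmf_tuple_pmf:
  assumes "\<And>j. j < l \<Longrightarrow> finite (A j)"
  shows "pmf (tuple_pmf A) (Some Y) = (if Y \<in> block_tuples A then tuple_weight A else 0)"
proof (cases "block_tuples A = {}")
  case True
  then show ?thesis using mass_tuple_pmf[of A, OF assms] unfolding tuple_pmf_def by (simp add: pmf_thin)
next
  case False
  have inj: "pmf (map_pmf Some (pmf_of_set (block_tuples A))) (Some Y) = pmf (pmf_of_set (block_tuples A)) Y"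
    by (rule pmf_map_inj') simp
  have "pmf (tuple_pmf A) (Some Y) = real (card (block_tuples A)) * tuple_weight A * pmf (map_pmf Some (pmf_of_set (block_tuples A))) (Some Y)"
    unfolding tuple_pmf_def by (rule pmf_thin[OF mass_tuple_pmf[of A, OF assms]])
  then show ?thesis unfolding inj
    using False finite_block_tuples[of A, OF assms] by (simp add: indicator_def)
qed

lemma set_pmf_tuple_pmf:
  assumes "\<And>j. j < l \<Longrightarrow> finite (A j)" shows "set_pmf (tuple_pmf A) \<subseteq> insert None (Some ` block_tuples A)"
proof
  fix x assume x: "x \<in> set_pmf (tuple_pmf A)"
  show "x \<in> insert None (Some ` block_tuples A)"
  proof (cases x)
    case (Some Y)
    then have "pmf (tuple_pmf A) (Some Y) \<noteq> 0" using x by (simp add: set_pmf_iff)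
    then show ?thesis using pmf_tuple_pmf[of A Y, OF assms] Some by (auto split: if_splits)
  qed simp
qed

lemma finite_set_tuple_pmf:
  assumes "\<And>j. j < l \<Longrightarrow> finite (A j)" shows "finite (set_pmf (tuple_pmf A))"
  by (rule finite_subset[OF set_pmf_tuple_pmf[of A, OF assms]]) (auto simp: finite_block_tuples assms)

lemma tuple_pmf_support: "(\<And>j. j < l \<Longrightarrow> finite (A j)) \<Longrightarrow> Some Y \<in> set_pmf (tuple_pmf A) \<Longrightarrow> Y \<in> block_tuples A"
  using set_pmf_tuple_pmf by blast

text \<open>
  Taking images under \<open>\<phi> j\<close> maps the law on \<open>A\<close>, after discarding tuples on which it is not injective, to
  a law dominating the one on \<open>A'\<close>: each tuple has at least \<open>\<Prod>j. c j ^ m j\<close> preimages of weight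
  \<open>tuple_weight A\<close>, and \<open>card (A j) = c j * card (A' j)\<close>. Comparable images come from comparable tuples
  because \<open>\<phi> j\<close> preserves or reverses strict inequalities. This covers translations, reflections and
  refinements of the ground sets.
\<close>
lemma expected_clique_tuple_pmf_compare:
  assumes fin: "\<And>j. j < l \<Longrightarrow> finite (A j)" "\<And>j. j < l \<Longrightarrow> finite (A' j)"
    and maps: "\<And>j x. j < l \<Longrightarrow> x \<in> A j \<Longrightarrow> \<phi> j x \<in> A' j"
    and fib: "\<And>j y. j < l \<Longrightarrow> y \<in> A' j \<Longrightarrow> card {x\<in>A j. \<phi> j x = y} = c j"
    and c: "\<And>j. j < l \<Longrightarrow> 0 < c j"
    and mono: "\<And>j x x'. \<lbrakk>j < l; x \<in> A j; x' \<in> A j; \<phi> j x < \<phi> j x'\<rbrakk> \<Longrightarrow> if d j = d' j then x < x' else x' < x"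
  shows "expected_clique (comparable d') n (tuple_pmf A') \<le> expected_clique (comparable d) n (tuple_pmf A)"
proof -
  define im where "im Y = (\<lambda>j\<in>{..<l}. \<phi> j ` Y j)" for Y :: "nat \<Rightarrow> nat set"
  define \<Phi> where "\<Phi> Y = (if im Y \<in> block_tuples A' then Some (im Y) else None)" for Y
  note finW = finite_set_tuple_pmf[of A, OF fin(1)] finite_set_tuple_pmf[of A', OF fin(2)]
  let ?\<mu> = "map_pmf (\<lambda>z. Option.bind z \<Phi>) (tuple_pmf A)"
  have cardA: "card (A j) = c j * card (A' j)" if "j < l" for j
  proof -
    have "card (A j) = card (\<Union>y\<in>A' j. {x\<in>A j. \<phi> j x = y})"
      by (rule arg_cong[of _ _ card]) (use maps[OF that] in auto)
    also have "\<dots> = (\<Sum>y\<in>A' j. card {x\<in>A j. \<phi> j x = y})"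
      using fin that by (intro card_UN_disjoint) auto
    also have "\<dots> = c j * card (A' j)" using fib[OF that] by simp
    finally show ?thesis .
  qed
  have wA: "tuple_weight A' = (\<Prod>j<l. real (c j) ^ m j) * tuple_weight A"
    unfolding tuple_weight_def prod.distrib[symmetric]
  proof (intro prod.cong refl)
    fix j assume "j \<in> {..<l}"
    then have "j < l" by simp
    then show "fact (m j) / real (card (A' j)) ^ m j = real (c j) ^ m j * (fact (m j) / real (card (A j)) ^ m j)"
      using c[of j] by (simp add: cardA power_mult_distrib)
  qed
  have "expected_clique (comparable d') n (tuple_pmf A') \<le> expected_clique (comparable d') n ?\<mu>"
  proof (rule expected_clique_dominated)
    show "finite (set_pmf (tuple_pmf A'))" "finite (set_pmf ?\<mu>)" using finW by auto
    fix Y'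
    show "pmf (tuple_pmf A') (Some Y') \<le> pmf ?\<mu> (Some Y')"
    proof (cases "Y' \<in> block_tuples A'")
      case True
      let ?S = "{Y \<in> block_tuples A. im Y = Y'}"
      let ?Z = "\<lambda>j. {Z. Z \<subseteq> A j \<and> \<phi> j ` Z = Y' j \<and> card Z = card (Y' j)}"
      have "PiE {..<l} ?Z \<subseteq> ?S"
      proof (intro subsetI CollectI conjI)
        fix Y assume Y: "Y \<in> PiE {..<l} ?Z"
        then show "Y \<in> block_tuples A" using block_tuplesD[OF True] by (auto simp: block_tuples_def PiE_iff)
        show "im Y = Y'"
        proof
          fix j show "im Y j = Y' j"
            using Y True by (cases "j < l") (auto simp: im_def PiE_iff block_tuples_def extensional_def)
        qed
      qed
      then have "card (PiE {..<l} ?Z) \<le> card ?S" using finite_block_tuples[of A] fin by (intro card_mono) auto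
      moreover have "(\<Prod>j<l. c j ^ m j) \<le> card (PiE {..<l} ?Z)"
        unfolding card_PiE[OF finite_lessThan]
      proof (intro prod_mono conjI)
        fix j assume "j \<in> {..<l}"
        then have j: "j < l" by simp
        show "c j ^ m j \<le> card (?Z j)"
          using card_sections_ge[of "A j" "Y' j" "\<phi> j" "c j"] block_tuplesD[OF True j] fin j fib by (auto simp: subset_iff)
      qed auto
      ultimately have "(\<Prod>j<l. c j ^ m j) \<le> card ?S" by linarith
      then have "real (\<Prod>j<l. c j ^ m j) \<le> real (card ?S)" by (simp only: of_nat_le_iff)
      then have "tuple_weight A' \<le> real (card ?S) * tuple_weight A"
        unfolding wA using tuple_weight_nonneg[of A] by (intro mult_right_mono) auto
      also have "\<dots> = (\<Sum>z\<in>Some ` ?S. pmf (tuple_pmf A) z)"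
        using pmf_tuple_pmf[of A] fin by (simp add: sum.reindex)
      also have "\<dots> = measure (tuple_pmf A) (Some ` ?S)"
        using finite_block_tuples[of A] fin by (intro measure_measure_pmf_finite[symmetric]) auto
      also have "\<dots> \<le> pmf ?\<mu> (Some Y')"
        unfolding pmf_map using True by (intro measure_pmf.finite_measure_mono) (auto simp: \<Phi>_def)
      finally show ?thesis using pmf_tuple_pmf[of A' Y'] True fin by simp
    qed (use pmf_tuple_pmf[of A' Y'] fin in simp)
  qed
  also have "\<dots> = (\<Sum>i\<in>{()}. expected_clique (comparable d') n ?\<mu>)" by simp
  also have "\<dots> \<le> expected_clique (comparable d) n (tuple_pmf A)"
  proof (rule sum_expected_clique_le[where \<phi> = "\<lambda>_. \<Phi>"])
    have precedes: "precedes d x x' \<or> precedes d x' x"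
      if x: "x \<in> block_tuples A" "x' \<in> block_tuples A" "precedes d' (im x) (im x')" for x x'
    proof -
      have "if d j then y < y' else y' < y" if j: "j < l" "y \<in> x j" "y' \<in> x' j" for j y y'
      proof -
        have "if d' j then \<phi> j y < \<phi> j y' else \<phi> j y' < \<phi> j y"
          using x(3) j unfolding precedes_def im_def by auto
        moreover have "y \<in> A j" "y' \<in> A j" using block_tuples_mem[OF x(1) j(1,2)] block_tuples_mem[OF x(2) j(1,3)] by simp_all
        ultimately show ?thesis using mono[OF j(1), of y y'] mono[OF j(1), of y' y]
          by (auto split: if_splits)
      qed
      then show ?thesis unfolding precedes_def by blast
    qed
    fix x x' y y' assume *: "Some x \<in> set_pmf (tuple_pmf A)" "Some x' \<in> set_pmf (tuple_pmf A)"
      "\<Phi> x = Some y" "\<Phi> x' = Some y'" "comparable d' y y'"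
    then have "x \<in> block_tuples A" "x' \<in> block_tuples A" "y = im x" "y' = im x'"
      using tuple_pmf_support[of A] fin by (auto simp: \<Phi>_def split: if_splits)
    then show "comparable d x x'" using precedes[of x x'] precedes[of x' x] *(5) unfolding comparable_def by auto
  qed (use finW in auto)
  finally show ?thesis .
qed

abbreviation asc :: "nat \<Rightarrow> bool" where "asc \<equiv> (\<lambda>_. True)"

definition box :: "(nat \<Rightarrow> nat) \<Rightarrow> nat \<Rightarrow> nat set" where "box s = (\<lambda>j. {..<s j})"

lemma finite_box [simp]: "finite (box s j)" and card_box [simp]: "card (box s j) = s j"
  by (simp_all add: box_def)

text \<open>
  The \<open>q\<close> diagonal subboxes are pairwise ordered, so chains inside them can be concatenated. A site falls
  into a given subbox with probability \<open>1 / q ^ r\<close>, and is then distributed like a site of that box.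
  The expectations of the subboxes add up by linearity.
\<close>
lemma expected_clique_tuple_pmf_box_superadditive:
  assumes q: "q > 0"
  shows "q * expected_clique (comparable asc) n (thin (1 / real q ^ r) (tuple_pmf (box s))) \<le> expected_clique (comparable asc) n (tuple_pmf (box (\<lambda>j. q * s j)))"
proof -
  let ?B = "box (\<lambda>j. q * s j)"
  define lift where "lift i Y = (\<lambda>j\<in>{..<l}. (\<lambda>x. i * s j + x) ` Y j)" for i and Y :: "nat \<Rightarrow> nat set"
  define \<phi> where "\<phi> i Y = (if \<forall>j<l. Y j \<subseteq> {i * s j..<i * s j + s j}
      then Some (\<lambda>j\<in>{..<l}. (\<lambda>x. x - i * s j) ` Y j) else None)" for i and Y :: "nat \<Rightarrow> nat set"
  have p: "1 / real q ^ r \<in> {0..1}" using q by (simp add: divide_simps)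
  have "tuple_weight ?B = 1 / real q ^ r * tuple_weight (box s)"
    unfolding tuple_weight_def r_def
    by (simp add: power_mult_distrib power_sum prod.distrib prod_dividef)
  note wB = this
  have "expected_clique (comparable asc) n (thin (1 / real q ^ r) (tuple_pmf (box s))) \<le> expected_clique (comparable asc) n (map_pmf (\<lambda>z. Option.bind z (\<phi> i)) (tuple_pmf ?B))"
    if i: "i < q" for i
  proof (rule expected_clique_dominated)
    show "finite (set_pmf (thin (1 / real q ^ r) (tuple_pmf (box s))))" by (intro finite_set_thin finite_set_tuple_pmf) simp
    show "finite (set_pmf (map_pmf (\<lambda>z. Option.bind z (\<phi> i)) (tuple_pmf ?B)))" using finite_set_tuple_pmf[of ?B] by simp
    fix Y
    show "pmf (thin (1 / real q ^ r) (tuple_pmf (box s))) (Some Y) \<le> pmf (map_pmf (\<lambda>z. Option.bind z (\<phi> i)) (tuple_pmf ?B)) (Some Y)"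
    proof (cases "Y \<in> block_tuples (box s)")
      case True
      have le: "i * s j + s j \<le> q * s j" for j
        using i by (metis Suc_leI add.commute mult_Suc mult_le_mono1)
      have L: "lift i Y \<in> block_tuples ?B"
        unfolding block_tuples_def
      proof (rule PiE_I)
        fix j assume "j \<in> {..<l}"
        then have j: "j < l" by simp
        have "(\<lambda>x. i * s j + x) ` Y j \<subseteq> ?B j" using block_tuplesD[OF True j] le[of j] by (fastforce simp: box_def)
        moreover have "card ((\<lambda>x. i * s j + x) ` Y j) = m j" using block_tuplesD[OF True j] by (subst card_image) auto
        ultimately show "lift i Y j \<in> {Z. Z \<subseteq> ?B j \<and> card Z = m j}" using j by (simp add: lift_def)
      qed (simp add: lift_def)
      have "\<phi> i (lift i Y) = Some Y"
      proof -
        have "\<forall>j<l. lift i Y j \<subseteq> {i * s j..<i * s j + s j}"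
          using block_tuples_mem[OF True] by (auto simp: lift_def box_def)
        moreover have "(\<lambda>j\<in>{..<l}. (\<lambda>x. x - i * s j) ` lift i Y j) = Y"
        proof
          fix j show "(\<lambda>j\<in>{..<l}. (\<lambda>x. x - i * s j) ` lift i Y j) j = Y j"
            using True by (cases "j < l") (auto simp: lift_def block_tuples_def PiE_iff extensional_def image_image)
        qed
        ultimately show ?thesis by (simp add: \<phi>_def)
      qed
      then have "pmf (tuple_pmf ?B) (Some (lift i Y)) \<le> pmf (map_pmf (\<lambda>z. Option.bind z (\<phi> i)) (tuple_pmf ?B)) (Some Y)"
        by (intro pmf_map_ge) simp
      then show ?thesis using True L by (simp add: pmf_thin[OF p] pmf_tuple_pmf wB)
    qed (simp add: pmf_thin[OF p] pmf_tuple_pmf)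
  qed
  then have "(\<Sum>i\<in>{..<q}. expected_clique (comparable asc) n (thin (1 / real q ^ r) (tuple_pmf (box s)))) \<le>
      (\<Sum>i\<in>{..<q}. expected_clique (comparable asc) n (map_pmf (\<lambda>z. Option.bind z (\<phi> i)) (tuple_pmf ?B)))"
    by (intro sum_mono) auto
  also have "\<dots> \<le> expected_clique (comparable asc) n (tuple_pmf ?B)"
  proof (rule sum_expected_clique_le)
    show "finite (set_pmf (tuple_pmf ?B))" by (rule finite_set_tuple_pmf) simp
    have precedes: "precedes asc x x'" if "precedes asc y y'" "\<phi> i x = Some y" "\<phi> i x' = Some y'" for i x x' y y'
      unfolding precedes_def
    proof (intro allI impI ballI)
      fix j u u' assume j: "j < l" "u \<in> x j" "u' \<in> x' j"
      have "u - i * s j \<in> y j" "u' - i * s j \<in> y' j" using j that(2,3) by (auto simp: \<phi>_def split: if_splits)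
      then have "u - i * s j < u' - i * s j" using that(1) j unfolding precedes_def by auto
      then show "if True then u < u' else u' < u" by simp
    qed
    fix i x x' y y' assume "\<phi> i x = Some y" "\<phi> i x' = Some y'" "comparable asc y y'"
    then show "comparable asc x x'" using precedes unfolding comparable_def by blast
  next
    have cross: "precedes asc x x'" if "i < i'" "\<phi> i x \<noteq> None" "\<phi> i' x' \<noteq> None" for i i' :: nat and x x'
      unfolding precedes_def
    proof (intro allI impI ballI)
      fix j u u' assume j: "j < l" "u \<in> x j" "u' \<in> x' j"
      have "x j \<subseteq> {i * s j..<i * s j + s j}" "x' j \<subseteq> {i' * s j..<i' * s j + s j}"
        using that(2,3) j(1) unfolding \<phi>_def by (auto split: if_splits)
      then have u: "u < i * s j + s j" "i' * s j \<le> u'" using j by auto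
      have "i * s j + s j \<le> i' * s j" using that(1) by (metis Suc_leI add.commute mult_Suc mult_le_mono1)
      then show "if True then u < u' else u' < u" using u by simp
    qed
    fix i i' x x' assume *: "i \<in> {..<q}" "i' \<in> {..<q}" "i \<noteq> i'" "Some x \<in> set_pmf (tuple_pmf ?B)"
      "Some x' \<in> set_pmf (tuple_pmf ?B)" "\<phi> i x \<noteq> None" "\<phi> i' x' \<noteq> None"
    have "precedes asc x x' \<or> precedes asc x' x" using cross[of i i' x x'] cross[of i' i x' x] * by linarith
    moreover have "x 0 \<noteq> {}" using tuple_pmf_support[of ?B x] *(4) block_tuplesD[of x ?B 0] l_pos by auto
    ultimately show "x \<noteq> x' \<and> comparable asc x x'" using l_pos unfolding comparable_def precedes_def by auto
  qed simp
  finally show ?thesis by simp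
qed

end

section \<open>The first moment bound on chains\<close>

lemma power_div_fact_le_exp:
  assumes "0 \<le> (x::real)" shows "x ^ n / fact n \<le> exp x"
proof -
  have "summable (\<lambda>n. x ^ n /\<^sub>R fact n)" by (rule summable_exp_generic)
  then have "(\<Sum>k\<in>{n}. x ^ k /\<^sub>R fact k) \<le> (\<Sum>k. x ^ k /\<^sub>R fact k)"
    using assms by (intro sum_le_suminf) auto
  then show ?thesis by (simp add: exp_def divide_inverse mult.commute)
qed

text \<open>
  From \<open>N ^ N / N! \<le> exp N \<le> 3 ^ N\<close> with \<open>N = t * m\<close> and \<open>m! \<le> m ^ m\<close>.
\<close>
lemma fact_power_div_fact_le:
  assumes "0 < t" "0 < m"
  shows "fact m ^ t / fact (t * m) \<le> ((3::real) / t) ^ (t * m)"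
proof -
  let ?N = "t * m"
  have "real ?N ^ ?N / fact ?N \<le> exp (real ?N)" by (rule power_div_fact_le_exp) simp
  also have "\<dots> = exp 1 ^ ?N" by (simp flip: exp_of_nat_mult del: of_nat_mult)
  also have "\<dots> \<le> 3 ^ ?N" by (intro power_mono exp_le) simp
  finally have f: "real ?N ^ ?N \<le> 3 ^ ?N * fact ?N" by (simp add: divide_simps mult.commute)
  have "(fact m :: real) \<le> real m ^ m"
    using fact_le_power[of m, where 'a = real] by simp
  then have "(fact m :: real) ^ t \<le> (real m ^ m) ^ t" by (intro power_mono) auto
  also have "\<dots> = real m ^ ?N" by (simp add: power_mult[symmetric] mult.commute)
  finally have "fact m ^ t / fact ?N \<le> real m ^ ?N / (real ?N ^ ?N / 3 ^ ?N)"
    using f assms by (intro frac_le) (auto simp: divide_simps mult.commute)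
  also have "\<dots> = (3 / t) ^ ?N" using assms by (simp add: power_divide[symmetric] del: of_nat_mult) (simp add: power_divide power_mult_distrib)
  finally show ?thesis .
qed

lemma ex_strict_mono_bij:
  fixes A :: "nat set"
  assumes "finite A"
  obtains f where "bij_betw f {..<card A} A" "strict_mono_on {..<card A} f"
proof -
  obtain f where f: "strict_mono_on {..<card A} f" "\<forall>n<card A. f n \<in> A"
    using finite_enumerate[OF assms] by blast
  have inj: "inj_on f {..<card A}" using f(1) by (rule strict_mono_on_imp_inj_on)
  have "f ` {..<card A} = A"
    using f(2) assms by (intro card_subset_eq) (auto simp: card_image[OF inj])
  then show ?thesis using that f(1) inj by (auto simp: bij_betw_def)
qed

context block_sizes
begin

lemma precedes_ascD: "precedes asc Y Y' \<Longrightarrow> j < l \<Longrightarrow> y \<in> Y j \<Longrightarrow> y' \<in> Y' j \<Longrightarrow> y < y'"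
  unfolding precedes_def by simp

lemma precedes_asc_disjoint: "precedes asc Y Y' \<Longrightarrow> j < l \<Longrightarrow> Y j \<inter> Y' j = {}"
  using precedes_ascD[of Y Y' j] by blast

text \<open>
  The tuple whose first chunk has the smallest minimum: any comparable tuple must follow it.
\<close>
lemma chain_min:
  assumes "finite C" "C \<noteq> {}" "C \<subseteq> block_tuples A" "pairwise (comparable asc) C"
  obtains Y where "Y \<in> C" "\<And>Y'. Y' \<in> C \<Longrightarrow> Y' \<noteq> Y \<Longrightarrow> precedes asc Y Y'"
proof -
  obtain Y where Y: "Y \<in> C" "\<And>Y'. Y' \<in> C \<Longrightarrow> Min (Y 0) \<le> Min (Y' 0)"
    using arg_min_if_finite[OF assms(1,2), of "\<lambda>Y. Min (Y 0)"] by (meson not_le)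
  have "precedes asc Y Y'" if Y': "Y' \<in> C" "Y' \<noteq> Y" for Y'
  proof (rule ccontr)
    assume "\<not> precedes asc Y Y'"
    then have s: "precedes asc Y' Y" using assms(4) Y(1) Y' unfolding pairwise_def comparable_def by metis
    have t: "finite (Y 0)" "Y 0 \<noteq> {}" "finite (Y' 0)" "Y' 0 \<noteq> {}"
      using block_tuplesD[of Y A 0] block_tuplesD[of Y' A 0] assms(3) Y(1) Y'(1) l_pos by auto
    then have "Min (Y 0) \<in> Y 0" "Min (Y' 0) \<in> Y' 0" by simp_all
    then have "Min (Y' 0) < Min (Y 0)" using s l_pos unfolding precedes_def by auto
    then show False using Y(2)[OF Y'(1)] by simp
  qed
  then show ?thesis using that Y(1) by blast
qed

text \<open>
  In every block the chunk of the least tuple is the initial segment of size \<open>m j\<close> of the union, so that the least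
  tuples of both chains agree and can be removed. Hence chains can be counted by their unions.
\<close>
lemma chain_unique:
  assumes "finite C" "C \<subseteq> block_tuples A" "pairwise (comparable asc) C"
    and "finite D" "D \<subseteq> block_tuples A" "pairwise (comparable asc) D"
    and "\<And>j. j < l \<Longrightarrow> (\<Union>Y\<in>C. Y j) = (\<Union>Y\<in>D. Y j)"
  shows "C = D"
  using assms
proof (induction "card C" arbitrary: C D)
  case 0
  then have "C = {}" by simp
  then have "(\<Union>Y\<in>D. Y 0) = {}" using 0(8)[of 0] l_pos by simp
  moreover have "Y 0 \<noteq> {}" if "Y \<in> D" for Y using block_tuplesD[of Y A 0] that 0(6) l_pos by auto
  ultimately show ?case using \<open>C = {}\<close> by auto
next
  case (Suc n)
  note C = Suc.prems(1-3) and D = Suc.prems(4-6) and U = Suc.prems(7)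
  have "C \<noteq> {}" using Suc.hyps(2) by auto
  then obtain Y where Y: "Y \<in> C" "\<And>Y'. Y' \<in> C \<Longrightarrow> Y' \<noteq> Y \<Longrightarrow> precedes asc Y Y'"
    using chain_min[OF C(1) _ C(2,3)] by metis
  have "Y 0 \<noteq> {}" using block_tuplesD[of Y A 0] Y(1) C(2) l_pos by auto
  then have "D \<noteq> {}" using U[OF l_pos] Y(1) by auto
  then obtain Z where Z: "Z \<in> D" "\<And>Y'. Y' \<in> D \<Longrightarrow> Y' \<noteq> Z \<Longrightarrow> precedes asc Z Y'"
    using chain_min[OF D(1) _ D(2,3)] by metis
  have tY: "Y \<in> block_tuples A" "Z \<in> block_tuples A" using Y(1) Z(1) C(2) D(2) by auto
  have initial: "v \<in> Y j" if asm: "E \<subseteq> block_tuples A" "Y \<in> E" "\<And>Y'. Y' \<in> E \<Longrightarrow> Y' \<noteq> Y \<Longrightarrow> precedes asc Y Y'"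
    "j < l" "v \<in> (\<Union>Y\<in>E. Y j)" "u \<in> Y j" "v < u" for Y E j u v
  proof (rule ccontr)
    assume "v \<notin> Y j"
    then obtain Y' where "Y' \<in> E" "Y' \<noteq> Y" "v \<in> Y' j" using asm(5) by auto
    then show False using precedes_ascD[OF asm(3)[of Y'] asm(4,6), of v] asm(7) by simp
  qed
  have "Y = Z"
  proof (rule PiE_ext[OF tY[unfolded block_tuples_def]])
    fix j assume "j \<in> {..<l}"
    then have j: "j < l" by simp
    note tj = block_tuplesD[OF tY(1) j] block_tuplesD[OF tY(2) j]
    show "Y j = Z j"
    proof (rule ccontr)
      assume ne: "Y j \<noteq> Z j"
      have "\<not> Y j \<subseteq> Z j" using card_subset_eq[of "Z j" "Y j"] tj ne by auto
      then obtain u where u: "u \<in> Y j" "u \<notin> Z j" by auto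
      have "\<not> Z j \<subseteq> Y j" using card_subset_eq[of "Y j" "Z j"] tj ne by auto
      then obtain v where v: "v \<in> Z j" "v \<notin> Y j" by auto
      have uU: "u \<in> (\<Union>Y\<in>D. Y j)" "v \<in> (\<Union>Y\<in>C. Y j)" using u v U[OF j] Y(1) Z(1) by auto
      consider "u < v" | "v < u" using u v by (metis linorder_neqE_nat)
      then show False
      proof cases
        case 1
        then show False using initial[OF D(2) Z j uU(1) v(1)] u(2) by simp
      next
        case 2
        then show False using initial[OF C(2) Y j uU(2) u(1)] v(2) by simp
      qed
    qed
  qed
  have rest: "(\<Union>Y'\<in>E - {Y}. Y' j) = (\<Union>Y'\<in>E. Y' j) - Y j"
    if "Y \<in> E" "\<And>Y'. Y' \<in> E \<Longrightarrow> Y' \<noteq> Y \<Longrightarrow> precedes asc Y Y'" "j < l" for E j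
  proof -
    have "Y' j \<inter> Y j = {}" if "Y' \<in> E" "Y' \<noteq> Y" for Y'
      using \<open>\<And>Y'. Y' \<in> E \<Longrightarrow> Y' \<noteq> Y \<Longrightarrow> precedes asc Y Y'\<close>[OF that] \<open>j < l\<close> precedes_asc_disjoint[of Y Y' j] by blast
    then show ?thesis by blast
  qed
  have "C - {Y} = D - {Y}"
  proof (rule Suc.hyps(1))
    show "n = card (C - {Y})" using Suc.hyps(2) Y(1) C(1) by simp
    show "finite (C - {Y})" "finite (D - {Y})" using C D by auto
    show "C - {Y} \<subseteq> block_tuples A" "D - {Y} \<subseteq> block_tuples A" using C D by auto
    show "pairwise (comparable asc) (C - {Y})" "pairwise (comparable asc) (D - {Y})"
      using C(3) D(3) by (auto intro: pairwise_subset)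
    fix j assume j: "j < l"
    show "(\<Union>Y\<in>C - {Y}. Y j) = (\<Union>Y\<in>D - {Y}. Y j)"
      using rest[OF Y j] rest[of D, OF _ _ j] Z U[OF j] \<open>Y = Z\<close> by simp
  qed
  then show ?case using Y(1) Z(1) \<open>Y = Z\<close> by auto
qed

text \<open>
  In each block, the union of the chunks of a chain of \<open>t\<close> tuples is a set of \<open>t * m j\<close> elements.
\<close>
lemma card_chains_le:
  assumes fin: "\<And>j. j < l \<Longrightarrow> finite (A j)"
  shows "card {C. C \<subseteq> block_tuples A \<and> pairwise (comparable asc) C \<and> card C = t} \<le> (\<Prod>j<l. card (A j) choose (t * m j))"
proof -
  let ?Ch = "{C. C \<subseteq> block_tuples A \<and> pairwise (comparable asc) C \<and> card C = t}"
  let ?f = "\<lambda>C. \<lambda>j\<in>{..<l}. \<Union>Y\<in>C. Y j"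
  let ?T = "PiE {..<l} (\<lambda>j. {Z. Z \<subseteq> A j \<and> card Z = t * m j})"
  have finC: "finite C" if "C \<in> ?Ch" for C using that finite_subset[OF _ finite_block_tuples[of A, OF fin]] by auto
  have "inj_on ?f ?Ch"
  proof (rule inj_onI)
    fix C D assume CD: "C \<in> ?Ch" "D \<in> ?Ch" "?f C = ?f D"
    have "(\<Union>Y\<in>C. Y j) = (\<Union>Y\<in>D. Y j)" if "j < l" for j using fun_cong[OF CD(3), of j] that by simp
    then show "C = D" using CD(1,2) finC[OF CD(1)] finC[OF CD(2)] by (intro chain_unique[of C A D]) auto
  qed
  moreover have "?f ` ?Ch \<subseteq> ?T"
  proof (rule image_subsetI)
    fix C assume C: "C \<in> ?Ch"
    show "?f C \<in> ?T"
    proof (rule PiE_I)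
      fix j assume "j \<in> {..<l}"
      then have j: "j < l" by simp
      have tj: "Y j \<subseteq> A j" "card (Y j) = m j" "finite (Y j)" if "Y \<in> C" for Y
        using block_tuplesD[of Y A j] C j that by auto
      have "card (\<Union>Y\<in>C. Y j) = (\<Sum>Y\<in>C. card (Y j))"
      proof (rule card_UN_disjoint[OF finC[OF C]], use tj in blast, intro ballI impI)
        fix Y Y' assume Y: "Y \<in> C" "Y' \<in> C" "Y \<noteq> Y'"
        then have "comparable asc Y Y'" using C by (auto simp: pairwise_def)
        then show "Y j \<inter> Y' j = {}" using precedes_asc_disjoint[OF _ j, of Y Y'] precedes_asc_disjoint[OF _ j, of Y' Y]
          unfolding comparable_def by blast
      qed
      also have "\<dots> = t * m j" using tj C by simp
      finally show "?f C j \<in> {Z. Z \<subseteq> A j \<and> card Z = t * m j}" using tj(1) j by auto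
    qed auto
  qed
  moreover have "finite ?T"
  proof (rule finite_PiE)
    fix j assume "j \<in> {..<l}"
    then show "finite {Z. Z \<subseteq> A j \<and> card Z = t * m j}" using fin by (auto intro: finite_subset[of _ "Pow (A j)"])
  qed simp
  ultimately have "card ?Ch \<le> card ?T" by (rule card_inj_on_le)
  also have "card ?T = (\<Prod>j<l. card (A j) choose (t * m j))" using fin by (simp add: card_PiE n_subsets)
  finally show ?thesis .
qed

text \<open>
  First moment method: a chain of \<open>t\<close> given tuples is sampled with probability at most
  \<open>(k * tuple_weight A) ^ t\<close>, and the number of chains of length \<open>t\<close> is bounded by a product of binomial
  coefficients.
\<close>
lemma prob_clique_number_tuple_pmf_ge:
  assumes fin: "\<And>j. j < l \<Longrightarrow> finite (A j)" and t: "0 < t"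
  shows "measure_pmf.prob (sample_set k (tuple_pmf A)) {B. t \<le> clique_number (comparable asc) B} \<le> (k * (3 / t) ^ r) ^ t"
proof -
  let ?Ch = "{C. C \<subseteq> block_tuples A \<and> pairwise (comparable asc) C \<and> card C = t}"
  have finT: "finite (block_tuples A)" using finite_block_tuples[of A, OF fin] .
  have finCh: "finite ?Ch" by (rule finite_subset[of _ "Pow (block_tuples A)"]) (use finT in auto)
  have finC: "finite C" if "C \<in> ?Ch" for C using that finite_subset[OF _ finT] by auto
  have "measure_pmf.prob (sample_set k (tuple_pmf A)) {B. t \<le> clique_number (comparable asc) B} \<le>
      measure_pmf.prob (sample_set k (tuple_pmf A)) (\<Union>C\<in>?Ch. {B. C \<subseteq> B})"
  proof (rule measure_pmf.finite_measure_mono_AE)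
    show "AE B in sample_set k (tuple_pmf A). B \<in> {B. t \<le> clique_number (comparable asc) B} \<longrightarrow> B \<in> (\<Union>C\<in>?Ch. {B. C \<subseteq> B})"
    proof (rule AE_pmfI, rule impI)
      fix B assume B: "B \<in> set_pmf (sample_set k (tuple_pmf A))" "B \<in> {B. t \<le> clique_number (comparable asc) B}"
      have finB: "finite B" and "Some ` B \<subseteq> set_pmf (tuple_pmf A)" using set_pmf_sample_set[OF B(1)] by auto
      then have sub: "B \<subseteq> block_tuples A" using tuple_pmf_support[of A, OF fin] by auto
      obtain C where C: "C \<subseteq> B" "pairwise (comparable asc) C" "card C = clique_number (comparable asc) B"
        by (rule clique_number_attained[OF finB])
      then obtain C' where "C' \<subseteq> C" "card C' = t" using B(2) obtain_subset_with_card_n[of t C] by auto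
      then show "B \<in> (\<Union>C\<in>?Ch. {B. C \<subseteq> B})" using C sub pairwise_subset[OF C(2)] by blast
    qed
  qed auto
  also have "\<dots> \<le> (\<Sum>C\<in>?Ch. measure_pmf.prob (sample_set k (tuple_pmf A)) {B. C \<subseteq> B})"
    using finCh by (intro measure_pmf.finite_measure_subadditive_finite) auto
  also have "\<dots> \<le> (\<Sum>C\<in>?Ch. (k * tuple_weight A) ^ t)"
  proof (rule sum_mono)
    fix C assume C: "C \<in> ?Ch"
    then show "measure_pmf.prob (sample_set k (tuple_pmf A)) {B. C \<subseteq> B} \<le> (k * tuple_weight A) ^ t"
      using prob_subset_sample_set[OF finite_set_tuple_pmf[of A, OF fin] tuple_weight_nonneg[of A] finC[OF C], of k] pmf_tuple_pmf[of A, OF fin] tuple_weight_nonneg[of A]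
      by auto
  qed
  also have "\<dots> = real (card ?Ch) * (k * tuple_weight A) ^ t" by simp
  also have "\<dots> \<le> real (\<Prod>j<l. card (A j) choose (t * m j)) * (k * tuple_weight A) ^ t"
    using card_chains_le[of A t, OF fin] tuple_weight_nonneg[of A] by (intro mult_right_mono) (auto simp: of_nat_le_iff simp del: of_nat_prod)
  also have "\<dots> = k ^ t * (\<Prod>j<l. real (card (A j) choose (t * m j)) * (fact (m j) / real (card (A j)) ^ m j) ^ t)"
    unfolding tuple_weight_def by (simp add: power_mult_distrib prod.distrib prod_power_distrib)
  also have "\<dots> \<le> k ^ t * (\<Prod>j<l. (3 / t) ^ (t * m j))"
  proof (intro mult_left_mono prod_mono conjI)
    fix j assume "j \<in> {..<l}"
    then have j: "j < l" by simp
    let ?a = "card (A j)"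
    have "real ((?a choose (t * m j)) * fact (t * m j)) \<le> real (?a ^ (t * m j))"
      using binomial_fact_pow[of ?a "t * m j"] by (simp only: of_nat_le_iff)
    then have b: "real (?a choose (t * m j)) * fact (t * m j) \<le> (real ?a ^ m j) ^ t"
      by (simp add: power_mult[symmetric] mult.commute)
    have "real (?a choose (t * m j)) * (fact (m j) / real ?a ^ m j) ^ t \<le> fact (m j) ^ t / fact (t * m j)"
    proof (cases "?a = 0")
      case True
      then show ?thesis using t m_pos[OF j] by (simp add: power_0_left)
    next
      case False
      then show ?thesis using b by (simp add: power_divide divide_simps mult.commute mult.left_commute mult_le_cancel_left)
    qed
    also have "\<dots> \<le> (3 / t) ^ (t * m j)" using fact_power_div_fact_le[OF t m_pos[OF j]] .
    finally show "real (?a choose (t * m j)) * (fact (m j) / real ?a ^ m j) ^ t \<le> (3 / t) ^ (t * m j)" .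
  qed auto
  also have "\<dots> = (k * (3 / t) ^ r) ^ t"
    unfolding r_def by (simp add: power_sum[symmetric] power_mult_distrib power_mult[symmetric] sum_distrib_left[symmetric] mult.commute)
  finally show ?thesis .
qed

text \<open>
  For \<open>t\<close> about \<open>6 * k powr (1 / r)\<close> the first moment bound is at most \<open>1 / k\<close>, while the clique number never
  exceeds \<open>k\<close>.
\<close>
lemma expected_clique_tuple_pmf_le:
  assumes fin: "\<And>j. j < l \<Longrightarrow> finite (A j)" and k: "1 \<le> k"
  shows "expected_clique (comparable asc) k (tuple_pmf A) \<le> 8 * real k powr (1 / r)"
proof -
  define x where "x = real k powr (1 / r)"
  have x1: "1 \<le> x" using k unfolding x_def by (simp add: ge_one_powr_ge_zero)
  have xr: "x ^ r = k" using k r_pos unfolding x_def by (simp add: powr_realpow[symmetric] powr_powr)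
  define t where "t = nat \<lceil>6 * x\<rceil>"
  have t: "6 * x \<le> t" "real t \<le> 6 * x + 1" unfolding t_def using x1 by linarith+
  have t0: "0 < t" using t(1) x1 by linarith
  let ?P = "measure_pmf.prob (sample_set k (tuple_pmf A)) {B. t \<le> clique_number (comparable asc) B}"
  have "?P \<le> (k * (3 / t) ^ r) ^ t" by (rule prob_clique_number_tuple_pmf_ge[OF fin t0])
  also have "k * (3 / t) ^ r = (3 * x / t) ^ r" by (simp add: xr[symmetric] power_mult_distrib power_divide)
  also have "\<dots> ^ t \<le> ((1 / 2) ^ r) ^ t"
    using t t0 x1 by (intro power_mono) (auto simp: divide_simps)
  also have "\<dots> = ((1 / 2) ^ t) ^ r" by (simp only: power_mult[symmetric] mult.commute)
  also have "\<dots> \<le> (1 / x) ^ r"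
  proof (intro power_mono)
    have "x \<le> real t" using t x1 by linarith
    also have "\<dots> \<le> 2 ^ t" by (rule of_nat_less_two_power[THEN less_imp_le])
    finally show "(1 / 2) ^ t \<le> 1 / x" using x1 by (simp add: power_divide divide_simps)
  qed auto
  also have "\<dots> = 1 / k" by (simp add: power_divide xr)
  finally have P: "k * ?P \<le> 1" using k by (simp add: divide_simps mult.commute)
  have "finite (set_pmf (tuple_pmf A))" by (rule finite_set_tuple_pmf) (rule fin)
  then have finr: "finite (set_pmf (sample_set k (tuple_pmf A)))" by (rule finite_set_pmf_sample_set)
  have "expected_clique (comparable asc) k (tuple_pmf A) \<le> measure_pmf.expectation (sample_set k (tuple_pmf A))
      (\<lambda>B. real t + real k * indicator {B. t \<le> clique_number (comparable asc) B} B)"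
    unfolding expected_clique_def
  proof (rule expectation_mono_finite[OF finr])
    fix B assume B: "B \<in> set_pmf (sample_set k (tuple_pmf A))"
    then have "clique_number (comparable asc) B \<le> k"
      using set_pmf_sample_set[OF B] clique_number_le_card[of B "comparable asc"] by auto
    then show "real (clique_number (comparable asc) B) \<le> real t + real k * indicator {B. t \<le> clique_number (comparable asc) B} B"
      by (auto simp: indicator_def)
  qed
  also have "\<dots> = t + k * ?P"
    by (subst Bochner_Integration.integral_add[OF integrable_measure_pmf_finite[OF finr] integrable_measure_pmf_finite[OF finr]]) simp
  also have "\<dots> \<le> 8 * x" using P t x1 by linarith
  finally show ?thesis unfolding x_def .
qed

end

section \<open>The growth constant of the longest chain\<close>

text \<open>
  The left hand side decreases in \<open>\<mu>\<close>, so the extreme case is \<open>\<mu> = (1 + \<eta>) * k\<close>, where it is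
  \<open>(1 / \<eta>\<^sup>2 + 1 / \<eta>) / k\<close>.
\<close>
lemma chebyshev_factor:
  fixes k \<mu> \<eta> :: real
  assumes "0 < \<eta>" "0 < k" "(1 + \<eta>) * k \<le> \<mu>" "(1 / \<eta>\<^sup>2 + 1 / \<eta>) / \<eta> \<le> k"
  shows "\<mu> / (\<mu> - k)\<^sup>2 \<le> \<eta>"
proof -
  have a: "\<eta> * k \<le> \<mu> - k" using assms by (simp add: algebra_simps)
  then have pos: "0 < \<mu> - k" using assms by (meson less_le_trans mult_pos_pos)
  have "1 / (\<mu> - k) \<le> 1 / (\<eta> * k)" using a assms by (intro divide_left_mono mult_pos_pos pos) auto
  have "\<mu> / (\<mu> - k)\<^sup>2 = 1 / (\<mu> - k) + k * (1 / (\<mu> - k))\<^sup>2"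
    using pos by (simp add: divide_simps power2_eq_square)
  also have "\<dots> \<le> 1 / (\<eta> * k) + k * (1 / (\<eta> * k))\<^sup>2"
    using \<open>1 / (\<mu> - k) \<le> 1 / (\<eta> * k)\<close> pos assms by (intro add_mono mult_left_mono power_mono) auto
  also have "\<dots> = (1 / \<eta>\<^sup>2 + 1 / \<eta>) / k" using assms by (simp add: divide_simps power2_eq_square) 
  also have "\<dots> \<le> \<eta>"
  proof -
    have "1 / \<eta>\<^sup>2 + 1 / \<eta> \<le> k * \<eta>" using assms(1,4) by (simp only: pos_divide_le_eq)
    then show ?thesis using assms(2) by (simp only: pos_divide_le_eq mult.commute)
  qed
  finally show ?thesis .
qed

text \<open>
  Write \<open>a n\<close> for the quotient. With \<open>q\<close> chosen such that \<open>n / q ^ r\<close> is slightly larger than \<open>k\<close>, the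
  superadditivity gives \<open>a n \<ge> (1 - 3 * \<eta>) * a k\<close> for each large \<open>k\<close> and all \<open>n\<close> that are sufficiently
  large in terms of \<open>k\<close>. Hence the limit inferior is at least \<open>1 - 3 * \<eta>\<close> times the limit superior, which
  is finite by the upper bound, and \<open>\<eta>\<close> is arbitrary.
\<close>
lemma root_limit_of_superadditive:
  fixes L :: "nat \<Rightarrow> real" and r :: nat
  assumes r: "0 < r"
    and super: "\<And>q k n. 0 < q \<Longrightarrow> real k < n / real q ^ r \<Longrightarrow>
      q * L k * (1 - (n / real q ^ r) / (n / real q ^ r - k)\<^sup>2) \<le> L n"
    and bound: "\<And>n. 1 \<le> n \<Longrightarrow> L n \<le> C * real n powr (1 / r)"
    and mono: "\<And>k n. k \<le> n \<Longrightarrow> L k \<le> L n" and pos: "0 < L 1"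
  obtains c where "0 < c" "(\<lambda>n. L n / real n powr (1 / r)) \<longlonglongrightarrow> c"
proof -
  define a where "a n = L n / real n powr (1 / r)" for n
  have a_pos: "0 < a n" if "1 \<le> n" for n
    using pos mono[OF that] that unfolding a_def by (intro divide_pos_pos) auto
  have a_le: "a n \<le> C" if "1 \<le> n" for n
    using bound[OF that] that unfolding a_def by (simp add: divide_simps mult.commute)
  have step: "\<exists>k0\<ge>1. \<forall>k\<ge>k0. \<forall>\<^sub>F n in sequentially. (1 - 3 * \<eta>) * a k \<le> a n"
    if \<eta>: "0 < \<eta>" "\<eta> < 1 / 3" for \<eta>
  proof -
    define k0 where "k0 = max 1 (nat \<lceil>(1 / \<eta>\<^sup>2 + 1 / \<eta>) / \<eta>\<rceil>)"
    show ?thesis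
    proof (intro exI[of _ k0] conjI allI impI)
      show "1 \<le> k0" by (simp add: k0_def)
      fix k assume k: "k0 \<le> k"
      then have k1: "1 \<le> k" by (simp add: k0_def)
      have "(1 / \<eta>\<^sup>2 + 1 / \<eta>) / \<eta> \<le> real k0" unfolding k0_def by (simp add: le_max_iff_disj) linarith
      then have kk: "(1 / \<eta>\<^sup>2 + 1 / \<eta>) / \<eta> \<le> real k" using k by linarith
      have "(\<lambda>n. (real k / real n) powr (1 / r)) \<longlonglongrightarrow> 0"
        using r k1 by real_asymp
      then have "\<forall>\<^sub>F n in sequentially. (real k / real n) powr (1 / r) < \<eta>"
        using \<eta>(1) by (rule order_tendstoD)
      moreover have "\<forall>\<^sub>F n in sequentially. (1 + \<eta>) * k \<le> real n" by real_asymp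
      ultimately show "\<forall>\<^sub>F n in sequentially. (1 - 3 * \<eta>) * a k \<le> a n"
      proof eventually_elim
        case (elim n)
        define y where "y = (real n / ((1 + \<eta>) * k)) powr (1 / r)"
        define q where "q = nat \<lfloor>y\<rfloor>"
        have n1: "1 \<le> n" using elim(2) k1 \<eta> by (cases n) (auto simp: mult_le_0_iff)
        have y1: "1 \<le> y" unfolding y_def using elim(2) k1 \<eta> by (intro ge_one_powr_ge_zero) auto
        then have q: "0 < q" "y - 1 \<le> q" "q \<le> y" unfolding q_def by linarith+
        have yr: "y ^ r = real n / ((1 + \<eta>) * k)"
          unfolding y_def using n1 k1 \<eta> r by (simp add: powr_realpow[symmetric] powr_powr)
        have "real q ^ r \<le> real n / ((1 + \<eta>) * k)" using power_mono[OF q(3), of r] yr by simp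
        then have mu: "(1 + \<eta>) * k \<le> n / real q ^ r"
          using q(1) k1 \<eta> n1 by (simp add: divide_simps mult.commute)
        have k': "real k < n / real q ^ r"
          using mu \<eta>(1) k1 by (smt (verit) mult_le_cancel_right1 of_nat_1 of_nat_mono mult_pos_pos distrib_right mult_1)
        have "(n / real q ^ r) / (n / real q ^ r - k)\<^sup>2 \<le> \<eta>"
          using \<eta> k1 mu kk by (intro chebyshev_factor) auto
        then have "q * L k * (1 - \<eta>) \<le> q * L k * (1 - (n / real q ^ r) / (n / real q ^ r - k)\<^sup>2)"
          using pos mono[OF k1] by (intro mult_left_mono) auto
        also have "\<dots> \<le> L n" using super[OF q(1) k'] .
        finally have Ln: "q * L k * (1 - \<eta>) \<le> L n" .
        have split: "y * real k powr (1 / r) = (1 / (1 + \<eta>)) powr (1 / r) * real n powr (1 / r)"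
          unfolding y_def using k1 n1 \<eta> by (simp add: powr_mult[symmetric])
        have "1 - \<eta> \<le> 1 / (1 + \<eta>)" using \<eta> by (simp add: divide_simps algebra_simps)
        also have "\<dots> \<le> (1 / (1 + \<eta>)) powr (1 / r)"
          using powr_mono'[of "1 / r" 1 "1 / (1 + \<eta>)"] r \<eta> by simp
        finally have "(1 - \<eta>) * real n powr (1 / r) \<le> y * real k powr (1 / r)"
          unfolding split by (intro mult_right_mono) auto
        moreover have "real k powr (1 / r) \<le> \<eta> * real n powr (1 / r)"
          using elim(1) n1 k1 by (simp add: powr_divide divide_simps)
        moreover have "y * real k powr (1 / r) - real k powr (1 / r) \<le> q * real k powr (1 / r)"
          using mult_right_mono[OF q(2), of "real k powr (1 / r)"] by (simp add: algebra_simps)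
        ultimately have "(1 - 2 * \<eta>) * real n powr (1 / r) \<le> q * real k powr (1 / r)"
          by (simp add: algebra_simps)
        then have "(1 - 2 * \<eta>) * real n powr (1 / r) * (a k * (1 - \<eta>)) \<le> q * real k powr (1 / r) * (a k * (1 - \<eta>))"
          using a_pos[OF k1] \<eta> by (intro mult_right_mono) auto
        also have "\<dots> = q * L k * (1 - \<eta>)" using k1 unfolding a_def by simp
        finally have "(1 - 2 * \<eta>) * (1 - \<eta>) * a k * real n powr (1 / r) \<le> L n"
          using Ln by (simp add: mult.commute mult.left_commute)
        then have "(1 - 2 * \<eta>) * (1 - \<eta>) * a k \<le> a n"
          using n1 unfolding a_def[of n] by (simp add: pos_le_divide_eq)
        moreover have "(1 - 3 * \<eta>) * a k \<le> (1 - 2 * \<eta>) * (1 - \<eta>) * a k"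
          using a_pos[OF k1] by (intro mult_right_mono) (auto simp: algebra_simps)
        ultimately show ?case by linarith
      qed
    qed
  qed
  have liminf_ge: "ereal ((1 - 3 * \<eta>) * a k) \<le> liminf (\<lambda>n. ereal (a n))"
    if "\<forall>\<^sub>F n in sequentially. (1 - 3 * \<eta>) * a k \<le> a n" for \<eta> k
    by (rule Liminf_bounded) (use that in \<open>auto elim: eventually_mono\<close>)
  let ?lo = "liminf (\<lambda>n. ereal (a n))" and ?hi = "limsup (\<lambda>n. ereal (a n))"
  have hiC: "?hi \<le> ereal C"
    by (rule Limsup_bounded) (use a_le in \<open>auto intro: eventually_sequentiallyI[of 1]\<close>)
  have lohi: "?lo \<le> ?hi" by (rule Liminf_le_Limsup) simp
  (* Already one value of \<eta> shows that the limit inferior is positive. *)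
  obtain k1 where k1: "1 \<le> k1" "\<And>k. k1 \<le> k \<Longrightarrow> \<forall>\<^sub>F n in sequentially. (1 - 3 * (1 / 6)) * a k \<le> a n"
    using step[of "1 / 6"] by auto
  have lopos: "ereal ((1 - 3 * (1 / 6)) * a k1) \<le> ?lo" using liminf_ge[OF k1(2)[of k1]] by simp
  moreover have "0 < (1 - 3 * (1 / 6)) * a k1" using a_pos[OF k1(1)] by simp
  ultimately have lo0: "0 < ?lo" by (metis ereal_less(2) less_le_trans)
  have "\<bar>?lo\<bar> \<noteq> \<infinity>" "\<bar>?hi\<bar> \<noteq> \<infinity>" using hiC lohi lo0 by auto
  then obtain lo hi where lo: "?lo = ereal lo" and hi: "?hi = ereal hi" by (metis ereal_real)
  have hl: "hi * (1 - 3 * \<eta>) \<le> lo" if \<eta>: "0 < \<eta>" "\<eta> < 1 / 3" for \<eta>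
  proof -
    obtain k0 where k0: "1 \<le> k0" "\<And>k. k0 \<le> k \<Longrightarrow> \<forall>\<^sub>F n in sequentially. (1 - 3 * \<eta>) * a k \<le> a n"
      using step[OF \<eta>] by auto
    have "?hi \<le> ereal (lo / (1 - 3 * \<eta>))"
    proof (rule Limsup_bounded, rule eventually_sequentiallyI[of k0])
      fix k assume "k0 \<le> k"
      then have "(1 - 3 * \<eta>) * a k \<le> lo" using liminf_ge[OF k0(2)] lo by simp
      then show "ereal (a k) \<le> ereal (lo / (1 - 3 * \<eta>))" using \<eta> by (simp add: pos_le_divide_eq mult.commute)
    qed
    then show ?thesis using hi \<eta> by (simp add: pos_le_divide_eq)
  qed
  have "((\<lambda>\<eta>. hi * (1 - 3 * \<eta>)) \<longlongrightarrow> hi * (1 - 3 * 0)) (at_right 0)" by (intro tendsto_intros)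
  moreover have "\<forall>\<^sub>F \<eta> in at_right (0::real). hi * (1 - 3 * \<eta>) \<le> lo"
    using hl by (auto simp: eventually_at_right_field intro!: exI[of _ "1 / 3"])
  ultimately have "hi * (1 - 3 * 0) \<le> lo" by (rule tendsto_upperbound) simp
  then have "?lo = ?hi" using lohi lo hi by simp
  then have "(\<lambda>n. ereal (a n)) \<longlonglongrightarrow> ereal lo"
    using lo by (intro Liminf_eq_Limsup) auto
  then have "a \<longlonglongrightarrow> lo" by simp
  moreover have "0 < lo" using lo0 lo by simp
  ultimately show ?thesis using that unfolding a_def by blast
qed

context block_sizes
begin

text \<open>
  The expectation depends neither on the directions nor on the ground sets beyond their sizes: order
  preserving or order reversing bijections with initial segments of the natural numbers, and their inverses,
  transport the laws.
\<close>
lemma expected_clique_tuple_pmf_le_box: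
  assumes fin: "\<And>j. j < l \<Longrightarrow> finite (A j)"
  shows "expected_clique (comparable d) n (tuple_pmf A) \<le> expected_clique (comparable asc) n (tuple_pmf (box (\<lambda>j. card (A j))))"
    and "expected_clique (comparable asc) n (tuple_pmf (box (\<lambda>j. card (A j)))) \<le> expected_clique (comparable d) n (tuple_pmf A)"
proof -
  let ?s = "\<lambda>j. card (A j)"
  have "\<forall>j. \<exists>f. j < l \<longrightarrow> bij_betw f {..<?s j} (A j) \<and> strict_mono_on {..<?s j} f"
  proof
    fix j show "\<exists>f. j < l \<longrightarrow> bij_betw f {..<?s j} (A j) \<and> strict_mono_on {..<?s j} f"
      using ex_strict_mono_bij[of "A j"] fin[of j] by metis
  qed
  from choice[OF this] obtain f where f: "\<And>j. j < l \<Longrightarrow> bij_betw (f j) {..<?s j} (A j)"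
    "\<And>j. j < l \<Longrightarrow> strict_mono_on {..<?s j} (f j)" by blast
  define \<phi> where "\<phi> j x = f j (if d j then x else ?s j - 1 - x)" for j x
  have fl: "f j x < f j x' \<longleftrightarrow> x < x'" if "j < l" "x < ?s j" "x' < ?s j" for j x x'
    using strict_mono_on_less[OF f(2)[OF that(1)], of x x'] that by simp
  have bij: "bij_betw (\<phi> j) {..<?s j} (A j)" if "j < l" for j
  proof -
    have "bij_betw (\<lambda>x. if d j then x else ?s j - 1 - x) {..<?s j} {..<?s j}"
      by (rule bij_betwI[of _ _ _ "\<lambda>x. if d j then x else ?s j - 1 - x"]) auto
    from bij_betw_trans[OF this f(1)[OF that]] show ?thesis by (simp add: \<phi>_def[abs_def] o_def)
  qed
  have mono: "if d j then x < x' else x' < x" if "j < l" "x < ?s j" "x' < ?s j" "\<phi> j x < \<phi> j x'" for j x x'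
  proof (cases "d j")
    case True
    then show ?thesis using that fl[of j x x'] by (simp add: \<phi>_def)
  next
    case False
    then have "f j (?s j - 1 - x) < f j (?s j - 1 - x')" using that by (simp add: \<phi>_def)
    then have "?s j - 1 - x < ?s j - 1 - x'" using that by (subst (asm) fl) auto
    then show ?thesis using False by simp
  qed
  show "expected_clique (comparable d) n (tuple_pmf A) \<le> expected_clique (comparable asc) n (tuple_pmf (box ?s))"
  proof (rule expected_clique_tuple_pmf_compare[of "box ?s" A \<phi> "\<lambda>_. 1"])
    fix j y assume j: "j < l" "y \<in> A j"
    then have "y \<in> \<phi> j ` {..<?s j}" using bij_betw_imp_surj_on[OF bij[OF j(1)]] by simp
    then obtain x where x: "x < ?s j" "\<phi> j x = y" by auto
    have "{x \<in> box ?s j. \<phi> j x = y} = {x}"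
      using x bij_betw_imp_inj_on[OF bij[OF j(1)]] by (auto simp: box_def inj_on_def)
    then show "card {x \<in> box ?s j. \<phi> j x = y} = 1" by simp
  next
    fix j x assume "j < l" "x \<in> box ?s j"
    then show "\<phi> j x \<in> A j" using bij_betw_apply[OF bij, of j x] by (simp add: box_def)
  next
    fix j x x' assume "j < l" "x \<in> box ?s j" "x' \<in> box ?s j" "\<phi> j x < \<phi> j x'"
    then show "if True = d j then x < x' else x' < x" using mono[of j x x'] by (simp add: box_def)
  qed (simp_all add: fin)
  define \<psi> where "\<psi> j = the_inv_into {..<?s j} (\<phi> j)" for j
  have bij': "bij_betw (\<psi> j) (A j) {..<?s j}" if "j < l" for j
    unfolding \<psi>_def by (rule bij_betw_the_inv_into[OF bij[OF that]])
  have inv: "\<phi> j (\<psi> j y) = y" if "j < l" "y \<in> A j" for j y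
    unfolding \<psi>_def using f_the_inv_into_f_bij_betw[OF bij[OF that(1)]] that(2) by simp
  have inv': "\<psi> j (\<phi> j x) = x" if "j < l" "x < ?s j" for j x
    unfolding \<psi>_def using the_inv_into_f_f[OF bij_betw_imp_inj_on[OF bij[OF that(1)]]] that(2) by simp
  show "expected_clique (comparable asc) n (tuple_pmf (box ?s)) \<le> expected_clique (comparable d) n (tuple_pmf A)"
  proof (rule expected_clique_tuple_pmf_compare[of A "box ?s" \<psi> "\<lambda>_. 1"])
    fix j y assume j: "j < l" "y \<in> box ?s j"
    then have y: "y < ?s j" by (simp add: box_def)
    have "{x \<in> A j. \<psi> j x = y} = {\<phi> j y}"
      using inv[OF j(1)] inv'[OF j(1) y] bij_betw_apply[OF bij[OF j(1)]] y by force
    then show "card {x \<in> A j. \<psi> j x = y} = 1" by simp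
  next
    fix j x x' assume j: "j < l" "x \<in> A j" "x' \<in> A j" "\<psi> j x < \<psi> j x'"
    have p: "\<psi> j x < ?s j" "\<psi> j x' < ?s j" using bij_betw_apply[OF bij'[OF j(1)]] j by auto
    show "if d j = True then x < x' else x' < x"
    proof (cases "d j")
      case True
      then have "f j (\<psi> j x) < f j (\<psi> j x')" using fl[OF j(1) p] j(4) by simp
      then show ?thesis using inv[OF j(1)] j True by (simp add: \<phi>_def)
    next
      case False
      have "f j (?s j - 1 - \<psi> j x') < f j (?s j - 1 - \<psi> j x)" using p j(1,4) by (subst fl) auto
      then show ?thesis using inv[OF j(1) j(2)] inv[OF j(1) j(3)] False by (simp add: \<phi>_def)
    qed
  next
    fix j x assume "j < l" "x \<in> A j"
    then show "\<psi> j x \<in> box ?s j" using bij_betw_apply[OF bij', of j x] by (simp add: box_def)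
  qed (simp_all add: fin)
qed

text \<open>
  The supremum over all box sizes removes the discretisation: refining a box does not decrease the expected
  chain length, so this is the expected length for independent uniform points of the unit interval.
\<close>
definition chain_growth :: "nat \<Rightarrow> real" where
  "chain_growth n = (SUP s. expected_clique (comparable asc) n (tuple_pmf (box s)))"

lemma expected_clique_box_le_chain_growth: "expected_clique (comparable asc) n (tuple_pmf (box s)) \<le> chain_growth n"
  unfolding chain_growth_def by (rule cSUP_upper) (auto intro!: bdd_aboveI[of _ "real n"] expected_clique_le finite_set_tuple_pmf)

lemma expected_clique_tuple_pmf_le_chain_growth: "(\<And>j. j < l \<Longrightarrow> finite (A j)) \<Longrightarrow> expected_clique (comparable d) n (tuple_pmf A) \<le> chain_growth n"
  using expected_clique_tuple_pmf_le_box(1)[of A d n] expected_clique_box_le_chain_growth order_trans by blast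

lemma chain_growth_le: "(\<And>s. expected_clique (comparable asc) n (tuple_pmf (box s)) \<le> x) \<Longrightarrow> chain_growth n \<le> x"
  unfolding chain_growth_def by (rule cSUP_least) auto

lemma chain_growth_mono: "k \<le> n \<Longrightarrow> chain_growth k \<le> chain_growth n"
  by (rule chain_growth_le, rule order_trans[OF expected_clique_mono expected_clique_box_le_chain_growth]) (auto intro: finite_set_tuple_pmf)

lemma chain_growth_one_pos: "0 < chain_growth 1"
proof -
  let ?A = "box m"
  define Y where "Y = (\<lambda>j\<in>{..<l}. {..<m j})"
  have Y: "Y \<in> block_tuples ?A" unfolding Y_def block_tuples_def box_def by auto
  have fin: "finite (set_pmf (tuple_pmf ?A))" by (rule finite_set_tuple_pmf) simp
  let ?S = "block_tuples ?A"
  have finS: "finite ?S" by (rule finite_block_tuples) simp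
  have one: "clique_number (comparable asc) {Z} = 1" for Z
    using card_le_clique_number[of "{Z}" "{Z}" "comparable asc"] clique_number_le_card[of "{Z}" "comparable asc"]
    by (simp add: pairwise_def)
  have "0 < tuple_weight ?A" unfolding tuple_weight_def using m_pos by (intro prod_pos) auto
  also have "\<dots> = pmf (tuple_pmf ?A) (Some Y)" using Y by (simp add: pmf_tuple_pmf)
  also have "\<dots> \<le> (\<Sum>Z\<in>?S. pmf (tuple_pmf ?A) (Some Z))" using Y finS by (intro member_le_sum) auto
  also have "\<dots> = expected_clique (comparable asc) 1 (tuple_pmf ?A)"
    unfolding expected_clique_def One_nat_def expectation_sample_set_Suc[OF fin]
    using tuple_pmf_support[of ?A] by (subst expectation_option[OF fin finS]) (auto simp: one)
  finally show ?thesis using expected_clique_box_le_chain_growth[of 1 m] by linarith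
qed

lemma ex_chain_growth_limit: "\<exists>c>0. (\<lambda>n. chain_growth n / real n powr (1 / r)) \<longlonglongrightarrow> c"
proof -
  have super: "q * chain_growth k * (1 - (n / real q ^ r) / (n / real q ^ r - k)\<^sup>2) \<le> chain_growth n"
    if q: "0 < q" and k: "real k < n / real q ^ r" for q k n
  proof (cases "0 < 1 - (n / real q ^ r) / (n / real q ^ r - k)\<^sup>2")
    case True
    define f where "f = 1 - (n / real q ^ r) / (n / real q ^ r - k)\<^sup>2"
    have p: "1 / real q ^ r \<in> {0..1}" using q by (simp add: divide_simps)
    have "chain_growth k \<le> chain_growth n / (q * f)"
    proof (rule chain_growth_le)
      fix s
      have "expected_clique (comparable asc) k (tuple_pmf (box s)) * f \<le> expected_clique (comparable asc) n (thin (1 / real q ^ r) (tuple_pmf (box s)))"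
        using expected_clique_thin_ge[OF p, of k n "tuple_pmf (box s)" "comparable asc"] k finite_set_tuple_pmf[of "box s"] unfolding f_def by simp
      then have "q * (expected_clique (comparable asc) k (tuple_pmf (box s)) * f) \<le> q * expected_clique (comparable asc) n (thin (1 / real q ^ r) (tuple_pmf (box s)))"
        by (intro mult_left_mono) auto
      also have "\<dots> \<le> expected_clique (comparable asc) n (tuple_pmf (box (\<lambda>j. q * s j)))" by (rule expected_clique_tuple_pmf_box_superadditive[OF q])
      also have "\<dots> \<le> chain_growth n" by (rule expected_clique_box_le_chain_growth)
      finally show "expected_clique (comparable asc) k (tuple_pmf (box s)) \<le> chain_growth n / (q * f)"
        using True q unfolding f_def[symmetric] by (simp add: pos_le_divide_eq mult.commute mult.left_commute)
    qed
    then show ?thesis using True q unfolding f_def[symmetric] by (simp add: pos_le_divide_eq mult.commute mult.left_commute)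
  next
    case False
    have "0 \<le> chain_growth k" "0 \<le> chain_growth n" using expected_clique_nonneg expected_clique_box_le_chain_growth order_trans by blast+
    then show ?thesis using False by (meson mult_nonneg_nonneg mult_nonneg_nonpos not_less of_nat_0_le_iff order_trans)
  qed
  have bound: "chain_growth n \<le> 8 * real n powr (1 / r)" if "1 \<le> n" for n
    by (rule chain_growth_le, rule expected_clique_tuple_pmf_le) (use that in auto)
  show ?thesis
    by (rule root_limit_of_superadditive[of r chain_growth 8, OF r_pos super bound chain_growth_mono chain_growth_one_pos]) auto
qed

definition chain_constant :: real where
  "chain_constant = (SOME c. 0 < c \<and> (\<lambda>n. chain_growth n / real n powr (1 / r)) \<longlonglongrightarrow> c)"

lemma chain_constant_pos: "0 < chain_constant" and chain_growth_limit: "(\<lambda>n. chain_growth n / real n powr (1 / r)) \<longlonglongrightarrow> chain_constant"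
  using someI_ex[OF ex_chain_growth_limit] unfolding chain_constant_def by auto

end

section \<open>Uniform bounds for perturbed sampling laws\<close>

text \<open>
  Bernoulli's inequality for the \<open>r\<close>-th power of \<open>(x / a) powr (1 / r)\<close>; this is the tangent at \<open>a\<close> of a
  concave function.
\<close>
lemma root_tangent:
  fixes a x :: real
  assumes "0 < a" "0 \<le> x" "0 < r"
  shows "x powr (1 / real r) \<le> a powr (1 / r) * (1 + (x / a - 1) / r)"
proof -
  define u where "u = (x / a) powr (1 / real r)"
  have ur: "u ^ r = x / a"
    using assms unfolding u_def by (cases "x = 0") (auto simp: powr_realpow[symmetric] powr_powr power_0_left)
  have "1 + real r * (u - 1) \<le> (1 + (u - 1)) ^ r" by (rule Bernoulli_inequality) (simp add: u_def)
  then have "real r * (u - 1) \<le> x / a - 1" using ur by simp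
  then have "u - 1 \<le> (x / a - 1) / r" using assms(3) by (simp only: pos_le_divide_eq of_nat_0_less_iff mult.commute)
  then have "u \<le> 1 + (x / a - 1) / r" by simp
  then have "a powr (1 / r) * u \<le> a powr (1 / r) * (1 + (x / a - 1) / r)" by (intro mult_left_mono) auto
  moreover have "a powr (1 / r) * u = x powr (1 / r)"
    using assms unfolding u_def by (simp add: powr_mult[symmetric])
  ultimately show ?thesis by simp
qed

lemma root_plus_one_le:
  fixes u :: real
  assumes "0 \<le> u" "0 < r"
  shows "(u + 1) powr (1 / real r) \<le> u powr (1 / r) + 1"
proof -
  define a where "a = u powr (1 / real r)"
  have a0: "0 \<le> a" unfolding a_def by simp
  have ar: "a ^ r = u"
    using assms unfolding a_def by (cases "u = 0") (auto simp: powr_realpow[symmetric] powr_powr power_0_left)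
  have "a ^ n + 1 \<le> (a + 1) ^ n" if "0 < n" for n
    using that
  proof (induction n rule: nat_induct_non_zero)
    case (Suc n)
    have "a ^ Suc n + 1 \<le> (a + 1) * (a ^ n + 1)" using a0 by (simp add: algebra_simps)
    also have "\<dots> \<le> (a + 1) * (a + 1) ^ n" using Suc a0 by (intro mult_left_mono) auto
    finally show ?case by simp
  qed simp
  then have "u + 1 \<le> (a + 1) ^ r" using ar assms(2) by metis
  then have "(u + 1) powr (1 / r) \<le> ((a + 1) ^ r) powr (1 / r)" using assms(1) by (intro powr_mono2) auto
  also have "\<dots> = a + 1" using a0 assms(2) by (simp add: powr_realpow[symmetric] powr_powr)
  finally show ?thesis unfolding a_def .
qed

text \<open>
  Jensen's inequality, by means of the tangent at the mean.
\<close>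
lemma expectation_root_binomial_le:
  assumes p: "p \<in> {0..1}" and r: "0 < r"
  shows "measure_pmf.expectation (binomial_pmf n p) (\<lambda>k. real k powr (1 / real r)) \<le> (n * p) powr (1 / r)"
proof (cases "n * p = 0")
  case True
  then have "binomial_pmf n p = return_pmf 0"
  proof (cases "n = 0")
    case False
    then have "p = 0" using True by simp
    then show ?thesis by (simp add: set_pmf_subset_singleton[symmetric])
  qed (use p in \<open>simp add: binomial_pmf_0\<close>)
  then show ?thesis by simp
next
  case False
  let ?a = "n * p"
  have a: "0 < ?a" using False p by (simp add: zero_less_mult_iff)
  have fin: "finite (set_pmf (binomial_pmf n p))" using p by (rule finite_set_pmf_binomial_pmf)
  have int: "integrable (binomial_pmf n p) f" for f :: "nat \<Rightarrow> real" using fin by (rule integrable_measure_pmf_finite)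
  have "measure_pmf.expectation (binomial_pmf n p) (\<lambda>k. real k powr (1 / real r)) \<le>
      measure_pmf.expectation (binomial_pmf n p) (\<lambda>k. ?a powr (1 / r) * (1 + (k / ?a - 1) / r))"
    by (intro expectation_mono_finite fin root_tangent a r) simp
  also have "\<dots> = ?a powr (1 / r) * (1 + (measure_pmf.expectation (binomial_pmf n p) real / ?a - 1) / r)"
    by (simp add: int)
  also have "\<dots> = ?a powr (1 / r)" using a by (simp add: binomial_mean[OF p])
  finally show ?thesis .
qed

lemma expected_clique_le_0:
  assumes "finite (set_pmf \<nu>)" "\<And>y. Some y \<notin> set_pmf \<nu>"
  shows "expected_clique R n \<nu> \<le> 0"
proof -
  have "expected_clique R n \<nu> \<le> measure_pmf.expectation (sample_set n \<nu>) (\<lambda>_. 0)"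
    unfolding expected_clique_def
  proof (rule expectation_mono_finite[OF finite_set_pmf_sample_set[OF assms(1)]])
    fix A assume "A \<in> set_pmf (sample_set n \<nu>)"
    then have "Some ` A \<subseteq> set_pmf \<nu>" using set_pmf_sample_set by blast
    then have "A = {}" using assms(2) by auto
    then show "real (clique_number R A) \<le> 0" by simp
  qed
  then show ?thesis by simp
qed

context block_sizes
begin

lemma chain_growth_affine_bound:
  assumes "0 < \<eta>"
  obtains C where "0 \<le> C" "\<And>n. chain_growth n \<le> (chain_constant + \<eta>) * real n powr (1 / r) + C"
proof -
  have "\<forall>\<^sub>F n in sequentially. chain_growth n / real n powr (1 / r) < chain_constant + \<eta>"
    using chain_growth_limit by (rule order_tendstoD) (use assms in simp)
  then obtain N where N: "\<And>n. N \<le> n \<Longrightarrow> chain_growth n / real n powr (1 / r) < chain_constant + \<eta>"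
    by (auto simp: eventually_sequentially)
  have "0 \<le> chain_growth (Suc N)" using expected_clique_nonneg expected_clique_box_le_chain_growth order_trans by blast
  moreover have "chain_growth n \<le> (chain_constant + \<eta>) * real n powr (1 / r) + chain_growth (Suc N)" for n
  proof (cases "n \<le> Suc N")
    case True
    have "0 \<le> (chain_constant + \<eta>) * real n powr (1 / r)" using chain_constant_pos assms by simp
    then show ?thesis using chain_growth_mono[OF True] by linarith
  next
    case False
    then have "chain_growth n / real n powr (1 / r) < chain_constant + \<eta>" "0 < real n powr (1 / r)" using N[of n] by auto
    then have "chain_growth n < (chain_constant + \<eta>) * real n powr (1 / r)" by (simp add: pos_divide_less_eq)
    then show ?thesis using \<open>0 \<le> chain_growth (Suc N)\<close> by linarith
  qed
  ultimately show ?thesis using that by blast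
qed

text \<open>
  Here \<open>\<mu>\<close> is uniform on an arbitrary set \<open>G\<close> of tuples, each having mass \<open>\<rho>\<close>. A site of \<open>tuple_pmf A\<close> lies in
  \<open>G\<close> with probability \<open>p = card G * tuple_weight A\<close>, so about \<open>k / p\<close> of its sites contain \<open>k\<close> uniform elements
  of \<open>G\<close>, and the expected clique number of \<open>k\<close> such elements is at most \<open>(k / p) powr (1 / r)\<close> times roughly the
  growth constant. The number \<open>k\<close> of occupied sites of \<open>\<mu>\<close> has mean \<open>n * card G * \<rho>\<close>. The size of \<open>G\<close>
  cancels, so it may be much smaller than \<open>block_tuples A\<close>, and \<open>n * \<rho> / tuple_weight A\<close> may exceed \<open>n\<close>. The
  additive constant \<open>C\<close> is the same for all \<open>n\<close>, \<open>A\<close> and \<open>\<mu>\<close>.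
\<close>
lemma expected_clique_uniform_le:
  assumes "0 < \<epsilon>"
  obtains C where "\<And>n d A \<mu> \<rho>. \<lbrakk>\<And>j. j < l \<Longrightarrow> finite (A j); finite (set_pmf \<mu>); 0 < \<rho>;
      \<And>Y. Some Y \<in> set_pmf \<mu> \<Longrightarrow> Y \<in> block_tuples A \<and> pmf \<mu> (Some Y) = \<rho>\<rbrakk> \<Longrightarrow>
    expected_clique (comparable d) n \<mu> \<le> (chain_constant + \<epsilon>) * (n * \<rho> / tuple_weight A) powr (1 / r) + C"
proof -
  have "((\<lambda>\<eta>. (chain_constant + \<eta>) * (1 + \<eta>) / (1 - \<eta>)) \<longlongrightarrow> (chain_constant + 0) * (1 + 0) / (1 - 0)) (at_right 0)"
    by (intro tendsto_intros) auto
  then have "\<forall>\<^sub>F \<eta> in at_right 0. (chain_constant + \<eta>) * (1 + \<eta>) / (1 - \<eta>) < chain_constant + \<epsilon>"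
    by (rule order_tendstoD) (use assms in simp)
  moreover have "\<forall>\<^sub>F \<eta> in at_right (0::real). 0 < \<eta> \<and> \<eta> < 1"
    by (auto simp: eventually_at_right_field intro!: exI[of _ 1])
  ultimately have "\<exists>\<eta>. (chain_constant + \<eta>) * (1 + \<eta>) / (1 - \<eta>) < chain_constant + \<epsilon> \<and> 0 < \<eta> \<and> \<eta> < 1"
    using eventually_happens'[OF trivial_limit_at_right_real] eventually_conj by blast
  then obtain \<eta> where \<eta>: "(chain_constant + \<eta>) * (1 + \<eta>) / (1 - \<eta>) < chain_constant + \<epsilon>" "0 < \<eta>" "\<eta> < 1" by blast
  obtain C1 where C1: "0 \<le> C1" "\<And>n. chain_growth n \<le> (chain_constant + \<eta>) * real n powr (1 / r) + C1"
    using chain_growth_affine_bound[OF \<eta>(2)] by blast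
  define k0 where "k0 = max 1 (nat \<lceil>(1 / \<eta>\<^sup>2 + 1 / \<eta>) / \<eta>\<rceil>)"
  define \<alpha> where "\<alpha> = (chain_constant + \<eta>) * (1 + \<eta>) / (1 - \<eta>)"
  define C2 where "C2 = (chain_constant + \<eta> + C1) / (1 - \<eta>) + k0"
  have a0: "0 \<le> \<alpha>" and C20: "0 \<le> C2" using chain_constant_pos \<eta> C1(1) unfolding \<alpha>_def C2_def by auto
  show ?thesis
  proof (rule that[of C2])
    fix n :: nat and d :: "nat \<Rightarrow> bool" and A \<mu> and \<rho> :: real
    assume finA: "\<And>j. j < l \<Longrightarrow> finite (A j)" and fin: "finite (set_pmf \<mu>)" and rho: "0 < \<rho>"
      and mu: "\<And>Y. Some Y \<in> set_pmf \<mu> \<Longrightarrow> Y \<in> block_tuples A \<and> pmf \<mu> (Some Y) = \<rho>"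
    define G where "G = {Y. Some Y \<in> set_pmf \<mu>}"
    have finG: "finite G" by (rule finite_subset[of _ "the ` set_pmf \<mu>"]) (use fin in \<open>force simp: G_def\<close>)+
    have R0: "0 \<le> (chain_constant + \<epsilon>) * (n * \<rho> / tuple_weight A) powr (1 / r)" using chain_constant_pos assms by simp
    show "expected_clique (comparable d) n \<mu> \<le> (chain_constant + \<epsilon>) * (n * \<rho> / tuple_weight A) powr (1 / r) + C2"
    proof (cases "G = {}")
      case True
      have "expected_clique (comparable d) n \<mu> \<le> 0" using True fin by (intro expected_clique_le_0) (auto simp: G_def)
      then show ?thesis using R0 C20 by linarith
    next
      case False
      define \<nu> where "\<nu> = map_pmf Some (pmf_of_set G)"
      define P where "P = \<rho> * card G"
      define p where "p = card G * tuple_weight A"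
      have pmf_nu: "pmf \<nu> (Some Y) = (if Y \<in> G then 1 / card G else 0)" for Y
      proof -
        have "pmf \<nu> (Some Y) = pmf (pmf_of_set G) Y" unfolding \<nu>_def by (rule pmf_map_inj') simp
        then show ?thesis using False finG by (simp add: indicator_def)
      qed
      have g0: "0 < card G" using False finG by (simp add: card_gt_0_iff)
      have finnu: "finite (set_pmf \<nu>)" unfolding \<nu>_def using False finG by simp
      have Gt: "G \<subseteq> block_tuples A" using mu by (auto simp: G_def)
      obtain Y0 where "Y0 \<in> block_tuples A" using Gt False by auto
      then have "0 < card (A j)" if "j < l" for j
        using block_tuplesD[OF \<open>Y0 \<in> block_tuples A\<close> that] finA[OF that] by (auto simp: card_gt_0_iff)
      then have w0: "0 < tuple_weight A" unfolding tuple_weight_def by (intro prod_pos) auto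
      have "P = (\<Sum>z\<in>Some ` G. pmf \<mu> z)" unfolding P_def using mu by (simp add: sum.reindex G_def mult.commute)
      also have "\<dots> \<le> 1" using finG by (subst measure_measure_pmf_finite[symmetric]) auto
      finally have P: "P \<in> {0..1}" using rho by (simp add: P_def)
      have finT: "finite (block_tuples A)" by (rule finite_block_tuples) (rule finA)
      have "p \<le> card (block_tuples A) * tuple_weight A" unfolding p_def using card_mono[OF finT Gt] w0 by (intro mult_right_mono) auto
      also have "\<dots> \<le> 1" using mass_tuple_pmf[of A] finA by simp
      finally have p: "p \<in> {0..1}" "0 < p" using w0 g0 by (simp_all add: p_def)
      have finW: "finite (set_pmf (tuple_pmf A))" by (rule finite_set_tuple_pmf) (rule finA)
      have expected_clique_nu: "expected_clique (comparable d) k \<nu> \<le> \<alpha> * (k / p) powr (1 / r) + C2" for k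
      proof (cases "k < k0")
        case True
        have "expected_clique (comparable d) k \<nu> \<le> k" by (rule expected_clique_le[OF finnu])
        also have "real k \<le> C2" using True chain_constant_pos C1(1) \<eta> unfolding C2_def
          by (smt (verit) divide_nonneg_pos of_nat_less_iff)
        finally show ?thesis using a0 by (smt (verit) mult_nonneg_nonneg powr_ge_zero)
      next
        case False
        then have "k0 \<le> k" by simp
        moreover have "1 \<le> k0" unfolding k0_def by simp
        ultimately have k1: "1 \<le> k" "k0 \<le> k" by linarith+
        have "nat \<lceil>(1 / \<eta>\<^sup>2 + 1 / \<eta>) / \<eta>\<rceil> \<le> k" using k1(2) by (simp add: k0_def)
        then have kk: "(1 / \<eta>\<^sup>2 + 1 / \<eta>) / \<eta> \<le> real k" by linarith
        (* As many sites as are needed for k of them to lie in G with probability close to one. *)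
        define k' where "k' = nat \<lceil>(1 + \<eta>) * k / p\<rceil>"
        have k': "(1 + \<eta>) * k / p \<le> k'" "k' \<le> (1 + \<eta>) * k / p + 1"
          unfolding k'_def using p \<eta> by (linarith, simp)
        have mu: "(1 + \<eta>) * k \<le> k' * p" using k'(1) p by (simp add: pos_divide_le_eq)
        have "0 < \<eta> * k" using \<eta> k1 by simp
        then have less: "real k < k' * p" using mu by (simp add: algebra_simps)
        have cf: "k' * p / (k' * p - k)\<^sup>2 \<le> \<eta>"
          using \<eta> k1 mu kk by (intro chebyshev_factor) auto
        have "expected_clique (comparable d) k \<nu> * (1 - \<eta>) \<le> expected_clique (comparable d) k \<nu> * (1 - k' * p / (k' * p - k)\<^sup>2)"
          using cf expected_clique_nonneg by (intro mult_left_mono) auto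
        also have "\<dots> \<le> expected_clique (comparable d) k' (thin p \<nu>)" by (rule expected_clique_thin_ge[OF p(1) less finnu])
        also have "\<dots> \<le> expected_clique (comparable d) k' (tuple_pmf A)"
        proof (rule expected_clique_dominated[OF finite_set_thin[OF finnu] finW])
          fix Y show "pmf (thin p \<nu>) (Some Y) \<le> pmf (tuple_pmf A) (Some Y)"
            using Gt g0 w0 pmf_tuple_pmf[of A Y] finA unfolding pmf_thin[OF p(1)] pmf_nu by (auto simp: p_def)
        qed
        also have "\<dots> \<le> chain_growth k'" by (rule expected_clique_tuple_pmf_le_chain_growth) (rule finA)
        also have "\<dots> \<le> (chain_constant + \<eta>) * real k' powr (1 / r) + C1" by (rule C1)
        also have "real k' powr (1 / r) \<le> ((1 + \<eta>) * k / p + 1) powr (1 / r)"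
          using k'(2) by (intro powr_mono2) auto
        also have "\<dots> \<le> ((1 + \<eta>) * k / p) powr (1 / r) + 1"
          using p \<eta> r_pos by (intro root_plus_one_le) auto
        also have "((1 + \<eta>) * k / p) powr (1 / r) = (1 + \<eta>) powr (1 / r) * (k / p) powr (1 / r)"
          using \<eta> p by (simp add: powr_mult[symmetric])
        also have "\<dots> \<le> (1 + \<eta>) * (k / p) powr (1 / r)"
        proof (intro mult_right_mono)
          show "(1 + \<eta>) powr (1 / r) \<le> 1 + \<eta>" using powr_mono[of "1 / r" 1 "1 + \<eta>"] r_pos \<eta> by simp
        qed simp
        finally have "expected_clique (comparable d) k \<nu> * (1 - \<eta>) \<le> (chain_constant + \<eta>) * ((1 + \<eta>) * (k / p) powr (1 / r) + 1) + C1"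
          using chain_constant_pos \<eta> by (simp add: mult_left_mono)
        then have "expected_clique (comparable d) k \<nu> \<le> ((chain_constant + \<eta>) * ((1 + \<eta>) * (k / p) powr (1 / r) + 1) + C1) / (1 - \<eta>)"
          using \<eta> by (simp add: pos_le_divide_eq)
        also have "\<dots> = \<alpha> * (k / p) powr (1 / r) + (chain_constant + \<eta> + C1) / (1 - \<eta>)"
        proof -
          have "((chain_constant + \<eta>) * ((1 + \<eta>) * z + 1) + C1) / (1 - \<eta>) = (chain_constant + \<eta>) * (1 + \<eta>) / (1 - \<eta>) * z + (chain_constant + \<eta> + C1) / (1 - \<eta>)" for z
            by (simp add: add_divide_distrib[symmetric] times_divide_eq_left) (simp add: algebra_simps)
          then show ?thesis unfolding \<alpha>_def .
        qed
        finally show ?thesis unfolding C2_def by simp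
      qed
      have finB: "finite (set_pmf (binomial_pmf n P))" using P by (rule finite_set_pmf_binomial_pmf)
      have int: "integrable (binomial_pmf n P) f" for f :: "nat \<Rightarrow> real" using finB by (rule integrable_measure_pmf_finite)
      have "expected_clique (comparable d) n \<mu> \<le> expected_clique (comparable d) n (thin P \<nu>)"
      proof (rule expected_clique_dominated[OF fin finite_set_thin[OF finnu]])
        fix Y show "pmf \<mu> (Some Y) \<le> pmf (thin P \<nu>) (Some Y)"
          using mu[of Y] g0 unfolding pmf_thin[OF P] pmf_nu
          by (cases "Y \<in> G") (auto simp: P_def G_def pmf_eq_0_set_pmf)
      qed
      also have "\<dots> = measure_pmf.expectation (binomial_pmf n P) (\<lambda>k. expected_clique (comparable d) k \<nu>)"
        by (rule expected_clique_thin[OF P finnu])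
      also have "\<dots> \<le> measure_pmf.expectation (binomial_pmf n P) (\<lambda>k. \<alpha> * (k / p) powr (1 / r) + C2)"
        by (intro expectation_mono_finite finB expected_clique_nu)
      also have "\<dots> = \<alpha> / p powr (1 / r) * measure_pmf.expectation (binomial_pmf n P) (\<lambda>k. real k powr (1 / r)) + C2"
        using p by (simp add: int powr_divide)
      also have "\<dots> \<le> \<alpha> / p powr (1 / r) * (n * P) powr (1 / r) + C2"
        using a0 by (intro add_right_mono mult_left_mono expectation_root_binomial_le P r_pos) auto
      also have "\<dots> = \<alpha> * (n * P / p) powr (1 / r) + C2"
        using p P by (simp add: powr_divide)
      also have "n * P / p = n * \<rho> / tuple_weight A" unfolding P_def p_def using g0 by simp
      also have "\<alpha> * (n * \<rho> / tuple_weight A) powr (1 / r) \<le> (chain_constant + \<epsilon>) * (n * \<rho> / tuple_weight A) powr (1 / r)"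
        using \<eta>(1) unfolding \<alpha>_def by (intro mult_right_mono) auto
      finally show ?thesis by simp
    qed
  qed
qed

lemma expected_clique_tuple_pmf_box_refine:
  assumes s: "\<And>j. j < l \<Longrightarrow> 0 < s j" and q: "\<And>j. j < l \<Longrightarrow> 0 < q j" and t: "\<And>j. j < l \<Longrightarrow> t j = q j * s j"
  shows "expected_clique (comparable asc) n (tuple_pmf (box s)) \<le> expected_clique (comparable asc) n (tuple_pmf (box t))"
proof (rule expected_clique_tuple_pmf_compare[of "box t" "box s" "\<lambda>j x. x div q j" q])
  fix j y assume j: "j < l" "y \<in> box s j"
  have "{x \<in> box t j. x div q j = y} = {y * q j..<y * q j + q j}"
  proof -
    have "x div q j = y \<longleftrightarrow> y * q j \<le> x \<and> x < y * q j + q j" for x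
    proof -
      have "x div q j = y \<longleftrightarrow> y \<le> x div q j \<and> x div q j < Suc y" by linarith
      also have "\<dots> \<longleftrightarrow> y * q j \<le> x \<and> x < y * q j + q j"
        using q[OF j(1)] by (simp only: less_eq_div_iff_mult_less_eq div_less_iff_less_mult mult_Suc add.commute)
      finally show ?thesis .
    qed
    moreover have "y * q j + q j \<le> t j"
    proof -
      have "(y + 1) * q j \<le> s j * q j" using j by (intro mult_right_mono) (auto simp: box_def)
      then show ?thesis using t[OF j(1)] by (simp add: algebra_simps)
    qed
    ultimately have "x < t j \<and> x div q j = y \<longleftrightarrow> y * q j \<le> x \<and> x < y * q j + q j" for x
      by (metis less_le_trans)
    then show ?thesis unfolding box_def by (intro set_eqI) simp
  qed
  then show "card {x \<in> box t j. x div q j = y} = q j" by simp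
next
  fix j x x' assume "x div q j < x' div q j"
  moreover have "x' div q j \<le> x div q j" if "x' \<le> x" using that by (rule div_le_mono)
  ultimately have "x < x'" by (cases "x' \<le> x") auto
  then show "if asc j = asc j then x < x' else x' < x" by simp
next
  fix j x assume j: "j < l" "x \<in> box t j"
  then have "x < s j * q j" using t[OF j(1)] by (simp add: box_def mult.commute)
  then show "x div q j \<in> box s j" using less_mult_imp_div_less by (simp add: box_def)
qed (simp_all add: q)

text \<open>
  About \<open>n * p\<close> sites of \<open>\<mu>\<close> are distributed like sites of \<open>tuple_pmf A\<close>. The scale \<open>s\<close> is chosen after \<open>n\<close>, as
  a multiple of the sizes of a box that is nearly optimal for \<open>n\<close>, so that \<open>A\<close> refines this box.
\<close>
lemma expected_clique_uniform_ge:
  fixes p \<epsilon> :: real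
  assumes p: "0 < p" "p \<le> 1" and eps: "0 < \<epsilon>"
  shows "\<forall>\<^sub>F n in sequentially. \<forall>s1. \<exists>s\<ge>s1. \<forall>d A \<mu>.
    (\<forall>j<l. finite (A j) \<and> card (A j) = s * m j) \<longrightarrow> finite (set_pmf \<mu>) \<longrightarrow>
    (\<forall>Y\<in>block_tuples A. p * tuple_weight A \<le> pmf \<mu> (Some Y)) \<longrightarrow> (chain_constant - \<epsilon>) * (n * p) powr (1 / r) \<le> expected_clique (comparable d) n \<mu>"
proof -
  have "((\<lambda>\<eta>. (1 - \<eta>) ^ 2 * chain_constant * (1 - \<eta>) powr (1 / r)) \<longlongrightarrow> (1 - 0) ^ 2 * chain_constant * (1 - 0) powr (1 / r)) (at_right 0)"
    by (intro tendsto_intros) auto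
  then have "\<forall>\<^sub>F \<eta> in at_right 0. chain_constant - \<epsilon> < (1 - \<eta>) ^ 2 * chain_constant * (1 - \<eta>) powr (1 / r)"
    by (rule order_tendstoD) (use eps in simp)
  moreover have "\<forall>\<^sub>F \<eta> in at_right (0::real). 0 < \<eta> \<and> \<eta> < 1"
    by (auto simp: eventually_at_right_field intro!: exI[of _ 1])
  ultimately have "\<exists>\<eta>. chain_constant - \<epsilon> < (1 - \<eta>) ^ 2 * chain_constant * (1 - \<eta>) powr (1 / r) \<and> 0 < \<eta> \<and> \<eta> < 1"
    using eventually_happens'[OF trivial_limit_at_right_real] eventually_conj by blast
  then obtain \<eta> where \<eta>: "chain_constant - \<epsilon> < (1 - \<eta>) ^ 2 * chain_constant * (1 - \<eta>) powr (1 / r)" "0 < \<eta>" "\<eta> < 1" by blast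
  define k where "k n = nat \<lfloor>(1 - \<eta>) * p * real n\<rfloor>" for n
  have pe: "0 < (1 - \<eta>) * p" using \<eta> p by simp
  have k_inf: "filterlim k at_top sequentially" unfolding k_def using pe by real_asymp
  have k_ratio: "(\<lambda>n. real (k n) / (real n * p)) \<longlonglongrightarrow> 1 - \<eta>"
  proof -
    have "(\<lambda>n. real (nat \<lfloor>((1 - \<eta>) * p) * real n\<rfloor>) / real n) \<longlonglongrightarrow> (1 - \<eta>) * p" using pe by real_asymp
    then have "(\<lambda>n. real (k n) / real n / p) \<longlonglongrightarrow> (1 - \<eta>) * p / p" unfolding k_def using p by (intro tendsto_divide) auto
    then show ?thesis using p by simp
  qed
  have "(\<lambda>n. (1 - \<eta>) ^ 2 * (chain_growth (k n) / real (k n) powr (1 / r)) * (real (k n) / (real n * p)) powr (1 / r))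
      \<longlonglongrightarrow> (1 - \<eta>) ^ 2 * chain_constant * (1 - \<eta>) powr (1 / r)"
    using \<eta> by (intro tendsto_intros k_ratio filterlim_compose[OF chain_growth_limit k_inf]) auto
  then have ev1: "\<forall>\<^sub>F n in sequentially. chain_constant - \<epsilon> <
      (1 - \<eta>) ^ 2 * (chain_growth (k n) / real (k n) powr (1 / r)) * (real (k n) / (real n * p)) powr (1 / r)"
    using \<eta>(1) by (rule order_tendstoD)
  have ev2: "\<forall>\<^sub>F n in sequentially. max 1 (nat \<lceil>(1 / \<eta>\<^sup>2 + 1 / \<eta>) / \<eta>\<rceil>) \<le> k n"
    using k_inf by (simp only: filterlim_at_top)
  from ev1 ev2 show ?thesis
  proof eventually_elim
    case (elim n)
    let ?k = "k n"
    have k1: "1 \<le> ?k" and kk: "(1 / \<eta>\<^sup>2 + 1 / \<eta>) / \<eta> \<le> real ?k" using elim(2) by (simp, linarith)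
    have kle: "real ?k \<le> (1 - \<eta>) * p * n" unfolding k_def using pe by simp
    have n0: "0 < n" using k1 kle by (cases n) auto
    have "(1 + \<eta>) * ?k \<le> (1 + \<eta>) * ((1 - \<eta>) * p * n)" using kle \<eta> by (intro mult_left_mono) auto
    also have "\<dots> = n * p - \<eta>\<^sup>2 * (n * p)" by (simp add: algebra_simps power2_eq_square)
    also have "\<dots> \<le> n * p" using p by simp
    finally have mu: "(1 + \<eta>) * ?k \<le> n * p" .
    have "0 < \<eta> * ?k" using \<eta> k1 by simp
    then have less: "real ?k < n * p" using mu by (simp add: algebra_simps)
    have cf: "n * p / (n * p - ?k)\<^sup>2 \<le> \<eta>" using \<eta> k1 mu kk by (intro chebyshev_factor) auto
    have Lk: "0 < chain_growth ?k" using chain_growth_one_pos chain_growth_mono[OF k1] by linarith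
    then have "(1 - \<eta>) * chain_growth ?k < chain_growth ?k" using \<eta> by simp
    then have "\<exists>s. (1 - \<eta>) * chain_growth ?k < expected_clique (comparable asc) ?k (tuple_pmf (box s))"
      by (metis chain_growth_le not_le)
    then obtain s0 where s0: "(1 - \<eta>) * chain_growth ?k < expected_clique (comparable asc) ?k (tuple_pmf (box s0))" ..
    have s0_pos: "0 < s0 j" if j: "j < l" for j
    proof (rule ccontr)
      assume "\<not> 0 < s0 j"
      then have "block_tuples (box s0) = {}" using block_tuplesD[of _ "box s0" j] j by (auto simp: box_def)
      then have "set_pmf (tuple_pmf (box s0)) \<subseteq> {None}" using set_pmf_tuple_pmf[of "box s0"] by simp
      then have "expected_clique (comparable asc) ?k (tuple_pmf (box s0)) \<le> 0" by (intro expected_clique_le_0 finite_set_tuple_pmf) auto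
      then show False using s0 Lk \<eta> by (smt (verit) mult_pos_pos)
    qed
    define S where "S = (\<Prod>j<l. s0 j)"
    show ?case
    proof (intro allI)
      fix s1
      show "\<exists>s\<ge>s1. \<forall>d A \<mu>.
        (\<forall>j<l. finite (A j) \<and> card (A j) = s * m j) \<longrightarrow> finite (set_pmf \<mu>) \<longrightarrow>
        (\<forall>Y\<in>block_tuples A. p * tuple_weight A \<le> pmf \<mu> (Some Y)) \<longrightarrow> (chain_constant - \<epsilon>) * (n * p) powr (1 / r) \<le> expected_clique (comparable d) n \<mu>"
      (* A common multiple of the sizes s0 j that is at least s1. *)
      proof (intro exI[of _ "Suc s1 * S"] conjI allI impI)
        have S0: "0 < S" unfolding S_def using s0_pos by (intro prod_pos) auto
        then show "s1 \<le> Suc s1 * S" by (metis Suc_leI le_SucI le_trans less_eq_nat.simps(1) mult_le_mono nat_mult_1_right not_less_eq_eq order_refl One_nat_def)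
        fix d A \<mu> assume A: "\<forall>j<l. finite (A j) \<and> card (A j) = Suc s1 * S * m j"
          and fin: "finite (set_pmf \<mu>)" and dom: "\<forall>Y\<in>block_tuples A. p * tuple_weight A \<le> pmf \<mu> (Some Y)"
        have p': "p \<in> {0..1}" using p by simp
        have finA: "finite (A j)" if "j < l" for j using A that by simp
        have finW: "finite (set_pmf (tuple_pmf A))" by (rule finite_set_tuple_pmf) (rule finA)
        define q where "q j = card (A j) div s0 j" for j
        have q: "card (A j) = q j * s0 j" "0 < q j" if j: "j < l" for j
        proof -
          have "s0 j dvd S" unfolding S_def using j by (intro dvd_prodI) auto
          then have "s0 j dvd card (A j)" using A j by (simp add: dvd_mult dvd_mult2)
          then show e: "card (A j) = q j * s0 j" unfolding q_def by simp
          have "0 < card (A j)" using A j S0 m_pos[OF j] by simp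
          then show "0 < q j" using e by (cases "q j") auto
        qed
        have "(1 - \<eta>) * chain_growth ?k \<le> expected_clique (comparable asc) ?k (tuple_pmf (box s0))" using s0 by simp
        also have "\<dots> \<le> expected_clique (comparable asc) ?k (tuple_pmf (box (\<lambda>j. card (A j))))"
          by (rule expected_clique_tuple_pmf_box_refine[of s0 q]) (use s0_pos q in auto)
        also have "\<dots> \<le> expected_clique (comparable d) ?k (tuple_pmf A)" by (rule expected_clique_tuple_pmf_le_box(2)) (rule finA)
        finally have "(1 - \<eta>) * chain_growth ?k * (1 - \<eta>) \<le> expected_clique (comparable d) ?k (tuple_pmf A) * (1 - n * p / (n * p - ?k)\<^sup>2)"
          using cf \<eta> expected_clique_nonneg[of "comparable d" ?k "tuple_pmf A"] by (intro mult_mono) auto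
        also have "\<dots> \<le> expected_clique (comparable d) n (thin p (tuple_pmf A))" by (rule expected_clique_thin_ge[OF p' less finW])
        also have "\<dots> \<le> expected_clique (comparable d) n \<mu>"
        proof (rule expected_clique_dominated[OF finite_set_thin[OF finW] fin])
          fix Y show "pmf (thin p (tuple_pmf A)) (Some Y) \<le> pmf \<mu> (Some Y)"
            using dom pmf_tuple_pmf[of A Y] finA by (auto simp: pmf_thin[OF p'])
        qed
        finally have "(1 - \<eta>)\<^sup>2 * chain_growth ?k \<le> expected_clique (comparable d) n \<mu>" by (simp add: power2_eq_square mult.commute mult.left_commute)
        moreover have "(chain_constant - \<epsilon>) * (n * p) powr (1 / r) \<le> (1 - \<eta>)\<^sup>2 * chain_growth ?k"
        proof -
          have np: "0 < (n * p) powr (1 / r)" using n0 p by simp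
          have "(chain_constant - \<epsilon>) * (n * p) powr (1 / r) \<le> (1 - \<eta>) ^ 2 * (chain_growth ?k / real ?k powr (1 / r)) * (real ?k / (real n * p)) powr (1 / r) * (n * p) powr (1 / r)"
            using elim(1) np by (intro mult_right_mono) auto
          also have "\<dots> = (1 - \<eta>)\<^sup>2 * chain_growth ?k" using k1 n0 p np by (simp add: powr_divide)
          finally show ?thesis .
        qed
        ultimately show "(chain_constant - \<epsilon>) * (n * p) powr (1 / r) \<le> expected_clique (comparable d) n \<mu>" by linarith
      qed
    qed
  qed
qed

end

section \<open>The structure of collectable patterns\<close>

definition elt :: "nat set \<Rightarrow> nat \<Rightarrow> nat" where
  "elt e u = sorted_list_of_set e ! u"

lemma elt_less_iff: "finite e \<Longrightarrow> u < card e \<Longrightarrow> v < card e \<Longrightarrow> elt e u < elt e v \<longleftrightarrow> u < v"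
proof -
  assume a: "finite e" "u < card e" "v < card e"
  have *: "elt e u < elt e v" if "u < v" "v < card e" for u v
    using sorted_wrt_nth_less[OF strict_sorted_list_of_set[of e] that(1)] that(2) a(1)
    by (simp add: elt_def)
  show ?thesis using *[of u v] *[of v u] a by (cases u v rule: linorder_cases) auto
qed

lemma elt_eq_iff: "finite e \<Longrightarrow> u < card e \<Longrightarrow> v < card e \<Longrightarrow> elt e u = elt e v \<longleftrightarrow> u = v"
  using elt_less_iff[of e u v] elt_less_iff[of e v u] by (metis linorder_neqE_nat less_irrefl)

lemma elt_image: "finite e \<Longrightarrow> elt e ` {..<card e} = e"
proof -
  assume "finite e"
  then show ?thesis using nth_image[of "card e" "sorted_list_of_set e"]
    by (simp add: elt_def[abs_def] lessThan_atLeast0)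
qed

lemma elt_mem: "finite e \<Longrightarrow> u < card e \<Longrightarrow> elt e u \<in> e"
  using elt_image[of e] by blast

lemma elt_cases:
  assumes "finite e" "x \<in> e" obtains u where "u < card e" "x = elt e u"
proof -
  have "x \<in> elt e ` {..<card e}" using assms elt_image by simp
  then show ?thesis using that by auto
qed

lemma elt_image_strict_mono:
  assumes "finite e" "strict_mono_on e f" "u < card e"
  shows "elt (f ` e) u = f (elt e u)"
proof -
  have "sorted_list_of_set (f ` e) = map f (sorted_list_of_set e)"
  proof (rule sorted_list_of_set_unique[THEN iffD1])
    show "finite (f ` e)" using assms by simp
    have "sorted_wrt (\<lambda>x y. f x < f y) (sorted_list_of_set e)"
      using strict_sorted_list_of_set[of e]
      by (rule sorted_wrt_mono_rel[rotated]) (use assms in \<open>auto simp: strict_mono_on_def\<close>)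
    then show "sorted_wrt (<) (map f (sorted_list_of_set e)) \<and> set (map f (sorted_list_of_set e)) = f ` e \<and>
        length (map f (sorted_list_of_set e)) = card (f ` e)"
      using assms by (simp add: sorted_wrt_map card_image strict_mono_on_imp_inj_on)
  qed
  then show ?thesis using assms by (simp add: elt_def)
qed

text \<open>
  The order pattern of two edges of a clique, \<open>e\<close> being the first one, for a pattern whose blocks correspond to the
  classes of positions \<open>cls\<close> and have the directions \<open>d\<close>.
\<close>
definition edge_precedes :: "nat \<Rightarrow> (nat \<Rightarrow> nat) \<Rightarrow> (nat \<Rightarrow> bool) \<Rightarrow> nat set \<Rightarrow> nat set \<Rightarrow> bool" where
  "edge_precedes r cls d e f \<longleftrightarrow> (\<forall>u<r. \<forall>v<r.
     if (if cls u = cls v then d (cls u) else u < v) then elt e u < elt f v else elt f v < elt e u)"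

text \<open>
  The table \<open>T\<close> lists the outcomes of all comparisons between positions of \<open>e\<close> and of \<open>f\<close>; the strict
  inequalities in both cases force \<open>e\<close> and \<open>f\<close> to be disjoint.
\<close>
definition interleaved :: "nat \<Rightarrow> (nat \<Rightarrow> nat \<Rightarrow> bool) \<Rightarrow> nat set \<Rightarrow> nat set \<Rightarrow> bool" where
  "interleaved r T e f \<longleftrightarrow> (\<forall>u<r. \<forall>v<r. if T u v then elt e u < elt f v else elt f v < elt e u)"

text \<open>
  An order isomorphism maps the \<open>u\<close>-th vertex of an edge to the \<open>u\<close>-th vertex of its image, so it preserves all
  comparisons between positions. Conversely, the map that sends the \<open>u\<close>-th vertices to each other is an
  isomorphism if all these comparisons agree. The disjunction reflects which of the two edges is mapped to \<open>A\<close>.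
\<close>
lemma order_isomorphic_pair_iff:
  assumes A: "finite A" "card A = r" and B: "finite B" "card B = r" and AB: "A \<inter> B = {}" and r: "1 \<le> r"
    and e: "finite e" "card e = r" and f: "finite f" "card f = r"
  defines "T \<equiv> \<lambda>u v. elt A u < elt B v"
  shows "order_isomorphic {e, f} {A, B} \<longleftrightarrow> interleaved r T e f \<or> interleaved r T f e"
proof
  have neAB: "elt A u \<noteq> elt B v" if "u < r" "v < r" for u v
    using elt_mem[OF A(1), of u] elt_mem[OF B(1), of v] A B AB that by auto
  have forward: "interleaved r T e f"
    if e: "finite e" "card e = r" and f: "finite f" "card f = r" and g: "strict_mono_on (e \<union> f) g" "g ` e = A" "g ` f = B"
    for e f g
    unfolding interleaved_def T_def
  proof (intro allI impI)
    fix u v assume uv: "u < r" "v < r"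
    have m: "strict_mono_on e g" "strict_mono_on f g" using g(1) by (auto simp: strict_mono_on_def)
    have eq: "elt A u = g (elt e u)" "elt B v = g (elt f v)"
      using elt_image_strict_mono[OF e(1) m(1)] elt_image_strict_mono[OF f(1) m(2)] uv e f g by auto
    have mem: "elt e u \<in> e \<union> f" "elt f v \<in> e \<union> f" using elt_mem[OF e(1)] elt_mem[OF f(1)] e f uv by auto
    have lt: "g (elt e u) < g (elt f v) \<longleftrightarrow> elt e u < elt f v" using strict_mono_on_less[OF g(1) mem] .
    have "elt e u \<noteq> elt f v" using neAB[OF uv] eq by auto
    then show "if elt A u < elt B v then elt e u < elt f v else elt f v < elt e u" using lt eq by auto
  qed
  assume "order_isomorphic {e, f} {A, B}"
  then obtain g where g: "strict_mono_on (e \<union> f) g" "{g ` e, g ` f} = {A, B}"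
    unfolding order_isomorphic_def by auto
  have "A \<noteq> B" using AB A r by auto
  then consider "g ` e = A" "g ` f = B" | "g ` e = B" "g ` f = A" using g(2) by (auto simp: doubleton_eq_iff)
  then show "interleaved r T e f \<or> interleaved r T f e"
  proof cases
    case 1
    then show ?thesis using forward[OF e f g(1)] by simp
  next
    case 2
    have "strict_mono_on (f \<union> e) g" using g(1) by (simp add: Un_commute)
    from forward[OF f e this] 2 show ?thesis by simp
  qed
next
  have neAB: "elt A u \<noteq> elt B v" if "u < r" "v < r" for u v
    using elt_mem[OF A(1), of u] elt_mem[OF B(1), of v] A B AB that by auto
  have backward: "order_isomorphic {e, f} {A, B}"
    if e: "finite e" "card e = r" and f: "finite f" "card f = r" and M: "interleaved r T e f" for e f
  proof -
    have ltT: "elt e u < elt f v \<longleftrightarrow> elt A u < elt B v" and ne: "elt e u \<noteq> elt f v" if "u < r" "v < r" for u v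
    proof -
      have "if elt A u < elt B v then elt e u < elt f v else elt f v < elt e u"
        using M that unfolding interleaved_def T_def by blast
      then show "elt e u < elt f v \<longleftrightarrow> elt A u < elt B v" "elt e u \<noteq> elt f v" by (auto split: if_splits)
    qed
    define idx where "idx e x = the_inv_into {..<r} (elt e) x" for e x
    have idx: "idx h (elt h u) = u" if "finite h" "card h = r" "u < r" for h u
      unfolding idx_def by (rule the_inv_into_f_f) (use that elt_eq_iff in \<open>auto intro: inj_onI\<close>)
    define g where "g x = (if x \<in> e then elt A (idx e x) else elt B (idx f x))" for x
    have ge: "g (elt e u) = elt A u" if "u < r" for u
      using elt_mem[OF e(1)] e that idx[OF e that] by (simp add: g_def)
    have gf: "g (elt f u) = elt B u" if u: "u < r" for u
    proof -
      have "elt f u \<notin> e"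
      proof
        assume "elt f u \<in> e"
        then obtain v where "v < card e" "elt f u = elt e v" using elt_cases[OF e(1)] by metis
        then show False using ne[of v u] u e by simp
      qed
      then show ?thesis using idx[OF f u] by (simp add: g_def)
    qed
    have img: "g ` e = A" "g ` f = B"
    proof -
      have "g ` elt e ` {..<r} = elt A ` {..<r}" "g ` elt f ` {..<r} = elt B ` {..<r}"
        unfolding image_image using ge gf by auto
      then show "g ` e = A" "g ` f = B" using elt_image A B e f by metis+
    qed
    have "strict_mono_on (e \<union> f) g"
    proof (rule strict_mono_onI)
      fix x y assume xy: "x \<in> e \<union> f" "y \<in> e \<union> f" "x < y"
      have rep: "(\<exists>u<r. z = elt e u) \<or> (\<exists>u<r. z = elt f u)" if "z \<in> e \<union> f" for z
        using that elt_cases[OF e(1)] elt_cases[OF f(1)] e(2) f(2) by (metis Un_iff)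
      from rep[OF xy(1)] rep[OF xy(2)] show "g x < g y"
      proof (elim disjE exE conjE)
        fix u v assume "u < r" "x = elt e u" "v < r" "y = elt e v"
        then show ?thesis using xy(3) elt_less_iff[OF e(1)] elt_less_iff[OF A(1)] e A by (simp add: ge)
      next
        fix u v assume "u < r" "x = elt e u" "v < r" "y = elt f v"
        then show ?thesis using xy(3) ltT[of u v] by (simp add: ge gf)
      next
        fix u v assume uv: "u < r" "x = elt f u" "v < r" "y = elt e v"
        then have "\<not> elt A v < elt B u" using xy(3) ltT[of v u] by simp
        then show ?thesis using neAB[of v u] uv by (simp add: ge gf)
      next
        fix u v assume "u < r" "x = elt f u" "v < r" "y = elt f v"
        then show ?thesis using xy(3) elt_less_iff[OF f(1)] elt_less_iff[OF B(1)] f B by (simp add: gf)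
      qed
    qed
    then show ?thesis unfolding order_isomorphic_def using img by (intro exI[of _ g]) auto
  qed
  assume "interleaved r T e f \<or> interleaved r T f e"
  then show "order_isomorphic {e, f} {A, B}"
    using backward[OF e f] backward[OF f e] by (auto simp: insert_commute)
qed

lemma r_matching_disjoint:
  assumes "r_matching r V P" "e \<in> P" "f \<in> P" "e \<noteq> f" shows "e \<inter> f = {}"
  using assms unfolding r_matching_def by blast

lemma r_patternE:
  assumes "r_pattern r P" "1 \<le> r"
  obtains A B where "P = {A, B}" "finite A" "card A = r" "finite B" "card B = r" "A \<inter> B = {}"
    "A \<union> B = {1..2 * r}" "elt A 0 < elt B 0"
proof -
  have M: "r_matching r {1..2 * r} P" and "card P = 2" using assms by (auto simp: r_pattern_def)
  then obtain A B where P: "P = {A, B}" "A \<noteq> B" by (auto simp: card_2_iff)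
  have AB: "A \<inter> B = {}" using r_matching_disjoint[OF M, of A B] P by auto
  have c: "card A = r" "card B = r" and sub: "A \<subseteq> {1..2 * r}" "B \<subseteq> {1..2 * r}"
    using M P by (auto simp: r_matching_def)
  have fin: "finite A" "finite B" using sub finite_subset by blast+
  have U: "A \<union> B = {1..2 * r}" using M P sub unfolding r_matching_def by blast
  have "elt A 0 \<noteq> elt B 0" using elt_mem[OF fin(1), of 0] elt_mem[OF fin(2), of 0] c assms(2) AB by auto
  then consider "elt A 0 < elt B 0" | "elt B 0 < elt A 0" by linarith
  then show ?thesis
  proof cases
    case 1
    show ?thesis by (rule that[OF P(1) fin(1) c(1) fin(2) c(2) AB U 1])
  next
    case 2
    show ?thesis by (rule that[OF _ fin(2) c(2) fin(1) c(1) _ _ 2]) (use P AB U in auto)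
  qed
qed

lemma map_eq_of_image_mset:
  "image_mset f M = mset ys \<Longrightarrow> \<exists>xs. mset xs = M \<and> map f xs = ys"
proof (induction ys arbitrary: M)
  case (Cons y ys)
  then obtain M1 x where x: "M = add_mset x M1" "f x = y" "image_mset f M1 = mset ys"
    by (auto dest!: msed_map_invR)
  obtain xs where "mset xs = M1" "map f xs = ys" using Cons.IH[OF x(3)] by blast
  then show ?case using x by (intro exI[of _ "x # xs"]) auto
qed simp

text \<open>
  Only a clique of three edges \<open>e1\<close>, \<open>e2\<close>, \<open>e3\<close> is used. As each pair of them realises the same table \<open>T\<close> of
  comparisons, comparing \<open>e1\<close> with \<open>e3\<close> through \<open>e2\<close> shows that \<open>T\<close> and its negation are transitive. Two
  positions \<open>u\<close>, \<open>v\<close> are put into the same class if \<open>T u v\<close> and \<open>T v u\<close> agree, which means that the segments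
  from the \<open>u\<close>-th to the \<open>v\<close>-th vertex of two edges do not overlap. This is an equivalence relation with
  convex classes, and a class of \<open>m\<close> positions starting at \<open>a\<close> occupies the block \<open>{1 + 2 * a..<1 + 2 * a + 2 * m}\<close>
  of \<open>P\<close>. The classes are finally relabelled such that their sizes appear in the order of the sorted type; patterns
  of the same type then have the same list of sizes.
\<close>
lemma collectable_structure:
  assumes r: "1 \<le> r" and P: "r_pattern r P" and coll: "collectable r P"
  defines "ms \<equiv> sorted_list_of_multiset (pattern_type P)"
  obtains cls d where "\<And>u. u < r \<Longrightarrow> cls u < length ms"
    "\<And>j. j < length ms \<Longrightarrow> card {u. u < r \<and> cls u = j} = ms ! j"
    "\<And>j. j < length ms \<Longrightarrow> 0 < ms ! j"
    "\<And>u v w. u < v \<Longrightarrow> v < w \<Longrightarrow> w < r \<Longrightarrow> cls u = cls w \<Longrightarrow> cls v = cls u"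
    "\<And>e f. finite e \<Longrightarrow> card e = r \<Longrightarrow> finite f \<Longrightarrow> card f = r \<Longrightarrow>
       order_isomorphic {e, f} P \<longleftrightarrow> edge_precedes r cls d e f \<or> edge_precedes r cls d f e"
proof -
  obtain A B where PAB: "P = {A, B}" and A: "finite A" "card A = r" and B: "finite B" "card B = r"
    and AB: "A \<inter> B = {}" and U: "A \<union> B = {1..2 * r}" and A0: "elt A 0 < elt B 0"
    using r_patternE[OF P r] by metis
  define T where "T = (\<lambda>u v. elt A u < elt B v)"
  have pair_iso: "order_isomorphic {e, f} P \<longleftrightarrow> interleaved r T e f \<or> interleaved r T f e"
    if "finite e" "card e = r" "finite f" "card f = r" for e f
    unfolding PAB T_def by (rule order_isomorphic_pair_iff[OF A B AB r that])
  have T0: "T 0 0" using A0 by (simp add: T_def)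
  have monoT: "T u' v'" if "T u v" "u' \<le> u" "v \<le> v'" "u < r" "v' < r" for u u' v v'
  proof -
    have "elt A u' \<le> elt A u" using elt_less_iff[OF A(1), of u u'] that A by (metis le_less_trans not_le)
    moreover have "elt B v \<le> elt B v'" using elt_less_iff[OF B(1), of v' v] that B by (metis le_less_trans not_le)
    ultimately show ?thesis using that(1) unfolding T_def by linarith
  qed
  (* Order three edges of a clique by their first vertices, which compare like the edges because T 0 0. *)
  obtain e1 e2 e3 where I: "interleaved r T e1 e2" "interleaved r T e2 e3" "interleaved r T e1 e3"
  proof -
    obtain C where C: "is_clique r P C" "3 \<le> card C" using coll unfolding collectable_def by blast
    then obtain S where S: "S \<subseteq> C" "card S = 3" using obtain_subset_with_card_n by metis
    have Sf: "finite e" "card e = r" if "e \<in> S" for e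
    proof -
      have "e \<in> C" using S(1) that by (rule subsetD)
      then show "card e = r" using C(1) unfolding is_clique_def r_matching_def by simp
      then show "finite e" using r by (intro card_ge_0_finite) simp
    qed
    have cmp: "interleaved r T e f" if "e \<in> S" "f \<in> S" "elt e 0 < elt f 0" for e f
    proof -
      have "e \<in> C" "f \<in> C" "e \<noteq> f" using S(1) that by auto
      then have "order_isomorphic {e, f} P" using C(1) unfolding is_clique_def by simp
      then have "interleaved r T e f \<or> interleaved r T f e" using pair_iso Sf that by blast
      moreover have "\<not> interleaved r T f e"
      proof
        assume "interleaved r T f e"
        then have "elt f 0 < elt e 0" using T0 r unfolding interleaved_def by auto
        then show False using that(3) by simp
      qed
      ultimately show ?thesis by blast
    qed
    let ?h = "\<lambda>e. elt e 0"
    have ne: "?h e \<noteq> ?h f" if "e \<in> S" "f \<in> S" "e \<noteq> f" for e f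
    proof -
      have "e \<in> C" "f \<in> C" using S(1) that by auto
      then have "e \<inter> f = {}" using C(1) that(3) r_matching_disjoint[of r "\<Union>C" C e f] unfolding is_clique_def by simp
      then show ?thesis using elt_mem[of e 0] elt_mem[of f 0] Sf[OF that(1)] Sf[OF that(2)] r by auto
    qed
    then have "inj_on ?h S" by (auto intro: inj_onI)
    then have c3: "card (?h ` S) = 3" using S by (simp add: card_image)
    have fin: "finite (?h ` S)" using c3 by (intro card_ge_0_finite) simp
    have ex: "\<exists>e. e \<in> S \<and> elt e 0 = elt (?h ` S) i" if "i < 3" for i
    proof -
      have "elt (?h ` S) i \<in> ?h ` S" using elt_mem[OF fin, of i] c3 that by simp
      then show ?thesis by auto
    qed
    obtain e1 where e1: "e1 \<in> S" "elt e1 0 = elt (?h ` S) 0" using ex[of 0] by auto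
    obtain e2 where e2: "e2 \<in> S" "elt e2 0 = elt (?h ` S) 1" using ex[of 1] by auto
    obtain e3 where e3: "e3 \<in> S" "elt e3 0 = elt (?h ` S) 2" using ex[of 2] by auto
    note e = e1 e2 e3
    have "elt e1 0 < elt e2 0" "elt e2 0 < elt e3 0"
      using e elt_less_iff[OF fin, of 0 1] elt_less_iff[OF fin, of 1 2] c3 by auto
    note lt = this less_trans[OF this]
    show ?thesis by (rule that[OF cmp[OF e(1,3) lt(1)] cmp[OF e(3,5) lt(2)] cmp[OF e(1,5) lt(3)]])
  qed
  have trans: "T u w" if "T u v" "T v w" "u < r" "v < r" "w < r" for u v w
  proof (rule ccontr)
    assume "\<not> T u w"
    then have "elt e3 w < elt e1 u" using I(3) that unfolding interleaved_def by auto
    moreover have "elt e1 u < elt e2 v" "elt e2 v < elt e3 w" using I(1,2) that unfolding interleaved_def by auto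
    ultimately show False by linarith
  qed
  have cotrans: "\<not> T u w" if "\<not> T u v" "\<not> T v w" "u < r" "v < r" "w < r" for u v w
  proof
    assume "T u w"
    then have "elt e1 u < elt e3 w" using I(3) that unfolding interleaved_def by auto
    moreover have "elt e2 v < elt e1 u" "elt e3 w < elt e2 v" using I(1,2) that unfolding interleaved_def by auto
    ultimately show False by linarith
  qed
  define E where "E u v \<longleftrightarrow> T u v = T v u" for u v
  have Esym: "E u v \<Longrightarrow> E v u" for u v by (auto simp: E_def)
  have Etrans: "E u w" if "E u v" "E v w" "u < r" "v < r" "w < r" for u v w
    using that trans cotrans unfolding E_def by metis
  have Econvex: "E u v" if "u \<le> v" "v \<le> w" "w < r" "E u w" for u v w
  proof (cases "T u w")
    case True
    then have "T w u" using that(4) by (simp add: E_def)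
    then have "T v u" "T u v" using monoT[of w u] that by auto
    then show ?thesis by (simp add: E_def)
  next
    case False
    then have "\<not> T u v" "\<not> T v u" using monoT[of u v u w] monoT[of v u u w] that by auto
    then show ?thesis by (simp add: E_def)
  qed
  have Ed: "T u v = T u u" if "E u v" "u < r" "v < r" for u v
    using that trans[of u v u] cotrans[of u v u] unfolding E_def by metis
  have nE: "T u v \<longleftrightarrow> u < v" if "\<not> E u v" "u < r" "v < r" for u v
  proof (cases "u < v")
    case True
    then show ?thesis using monoT[of v u u v] that unfolding E_def by auto
  next
    case False
    then have "v \<le> u" by simp
    then show ?thesis using monoT[of u v v u] that False unfolding E_def by auto
  qed
  (* The least position of a class serves as its label. *)
  define rep where "rep u = (LEAST v. v < r \<and> E v u)" for u
  have rep: "rep u < r" "E (rep u) u" "rep u \<le> u" if "u < r" for u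
  proof -
    have "u < r \<and> E u u" using that by (simp add: E_def)
    from LeastI[of "\<lambda>v. v < r \<and> E v u", OF this] Least_le[of "\<lambda>v. v < r \<and> E v u", OF this]
    show "rep u < r" "E (rep u) u" "rep u \<le> u" unfolding rep_def by auto
  qed
  have rep_eq: "rep u = rep v \<longleftrightarrow> E u v" if uv: "u < r" "v < r" for u v
  proof
    assume "rep u = rep v"
    then show "E u v" using rep(2)[OF uv(1)] rep(2)[OF uv(2)] Etrans[of u "rep u" v] Esym rep(1) uv by metis
  next
    assume "E u v"
    then have "E w u \<longleftrightarrow> E w v" if "w < r" for w using Etrans Esym uv that by metis
    then have "(\<lambda>w. w < r \<and> E w u) = (\<lambda>w. w < r \<and> E w v)" by blast
    then show "rep u = rep v" unfolding rep_def by simp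
  qed
  have rep_rep: "rep (rep u) = rep u" if "u < r" for u using rep_eq[of "rep u" u] rep[OF that] that by simp
  define d0 where "d0 a = T a a" for a
  have Tform: "T u v = (if rep u = rep v then d0 (rep u) else u < v)" if uv: "u < r" "v < r" for u v
  proof (cases "rep u = rep v")
    case True
    then have "E u v" using rep_eq uv by simp
    then have "T u v = T u u" using Ed uv by simp
    also have "T u u = T (rep u) (rep u)"
      using Ed[of u "rep u"] Ed[of "rep u" u] rep[OF uv(1)] uv Esym unfolding E_def by metis
    finally show ?thesis using True by (simp add: d0_def)
  next
    case False
    then show ?thesis using nE[OF _ uv] rep_eq[OF uv] by simp
  qed
  define size where "size a = card {u. u < r \<and> rep u = a}" for a
  define Reps where "Reps = rep ` {..<r}"
  have finReps: "finite Reps" by (simp add: Reps_def)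
  have class_eq: "{u. u < r \<and> rep u = a} = {a..<a + size a}" and size_pos: "0 < size a"
    if aR: "a \<in> Reps" for a
  proof -
    let ?K = "{u. u < r \<and> rep u = a}"
    obtain u0 where u0: "u0 < r" "a = rep u0" using aR by (auto simp: Reps_def)
    have aK: "a \<in> ?K" using rep[OF u0(1)] rep_rep[OF u0(1)] u0 by simp
    have finK: "finite ?K" by simp
    define M where "M = Max ?K"
    have MK: "M \<in> ?K" unfolding M_def by (rule Max_in[OF finK]) (use aK in blast)
    have le_M: "u \<le> M" if "u \<in> ?K" for u unfolding M_def using that by (rule Max_ge[OF finK])
    have K: "?K = {a..M}"
    proof (intro equalityI subsetI)
      fix u assume u: "u \<in> ?K"
      then have "rep u \<le> u" "rep u = a" using rep(3)[of u] by simp_all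
      then show "u \<in> {a..M}" using le_M[OF u] by simp
    next
      fix u assume u: "u \<in> {a..M}"
      have a: "a < r" "rep a = a" "M < r" "rep M = a" using aK MK by simp_all
      then have "E a M" using rep_eq[of a M] by simp
      then have "E a u" using Econvex[of a u M] u a by simp
      moreover have "u < r" using u a by simp
      ultimately have "rep u = a" using rep_eq[of a u] a by simp
      then show "u \<in> ?K" using \<open>u < r\<close> by simp
    qed
    have "size a = Suc M - a" unfolding size_def K by simp
    moreover have "a \<le> M" using le_M[OF aK] .
    ultimately show "?K = {a..<a + size a}" "0 < size a" unfolding K by auto
  qed
  have class_iff: "u < r \<and> rep u = a \<longleftrightarrow> a \<le> u \<and> u < a + size a" if aR: "a \<in> Reps" for a u
  proof -
    have "u \<in> {u. u < r \<and> rep u = a} \<longleftrightarrow> u \<in> {a..<a + size a}" by (simp only: class_eq[OF aR])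
    then show ?thesis by simp
  qed
  (* The vertices of P are consecutive numbers, so a vertex equals the number of vertices
     up to it, which the table T determines. *)
  have count: "x = card {y \<in> A. y \<le> x} + card {y \<in> B. y \<le> x}" if "x \<in> {1..2 * r}" for x
  proof -
    have "{y \<in> A. y \<le> x} \<union> {y \<in> B. y \<le> x} = {y \<in> A \<union> B. y \<le> x}" by auto
    also have "\<dots> = {1..x}" using that U by auto
    finally have "{y \<in> A. y \<le> x} \<union> {y \<in> B. y \<le> x} = {1..x}" .
    then have "card {1..x} = card {y \<in> A. y \<le> x} + card {y \<in> B. y \<le> x}"
      using A B AB by (subst card_Un_disjoint[symmetric]) auto
    then show ?thesis by simp
  qed
  have count_elt: "card {y \<in> h. y \<le> x} = card {v. v < r \<and> elt h v \<le> x}" if hh: "finite h" "card h = r" for h x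
  proof -
    have "{y \<in> h. y \<le> x} = elt h ` {v. v < r \<and> elt h v \<le> x}"
    proof (intro equalityI subsetI)
      fix y assume y: "y \<in> {y \<in> h. y \<le> x}"
      then obtain v where "v < card h" "y = elt h v" using elt_cases[OF hh(1)] by blast
      then show "y \<in> elt h ` {v. v < r \<and> elt h v \<le> x}" using y hh by auto
    qed (use elt_mem[OF hh(1)] hh in auto)
    moreover have "inj_on (elt h) {v. v < r \<and> elt h v \<le> x}"
      using elt_eq_iff[OF hh(1)] hh by (auto intro: inj_onI)
    ultimately show ?thesis by (simp add: card_image)
  qed
  have neAB: "elt A u \<noteq> elt B v" if "u < r" "v < r" for u v
    using elt_mem[OF A(1), of u] elt_mem[OF B(1), of v] A B AB that by auto
  have cls_le: "a + size a \<le> r" if "a \<in> Reps" for a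
  proof -
    have "a + size a - 1 \<in> {u. u < r \<and> rep u = a}" unfolding class_eq[OF that] using size_pos[OF that] by auto
    then show ?thesis using size_pos[OF that] by auto
  qed
  have posA: "elt A u = 1 + u + a + (if d0 a then 0 else size a)" if a: "a \<in> Reps" and u: "a \<le> u" "u < a + size a" for a u
  proof -
    have uK: "u < r" "rep u = a" using class_iff[OF a, of u] u by simp_all
    have "v < r \<and> elt A v \<le> elt A u \<longleftrightarrow> v \<le> u" for v
      using elt_less_iff[OF A(1), of u v] A(2) uK(1) by (cases "v < r") (simp_all add: not_less[symmetric])
    then have "{v. v < r \<and> elt A v \<le> elt A u} = {..u}" unfolding atMost_def by simp
    moreover have "{v. v < r \<and> elt B v \<le> elt A u} = {v. v < r \<and> \<not> T u v}"
      using neAB[OF uK(1)] by (auto simp: T_def le_less)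
    moreover have "{v. v < r \<and> \<not> T u v} = {..<(if d0 a then a else a + size a)}"
    proof -
      have "v < r \<and> \<not> T u v \<longleftrightarrow> v < (if d0 a then a else a + size a)" for v
      proof (cases "v < r")
        case True
        have "a = rep v \<longleftrightarrow> a \<le> v \<and> v < a + size a" using class_iff[OF a, of v] True by (simp only: eq_commute[of a] simp_thms)
        then have "T u v = (if a \<le> v \<and> v < a + size a then d0 a else u < v)"
          using Tform[OF uK(1) True] by (simp only: uK(2))
        then show ?thesis using u True by (simp only: simp_thms) (simp, linarith)
      qed (use cls_le[OF a] in auto)
      then show ?thesis by auto
    qed
    moreover have "elt A u \<in> {1..2 * r}" using elt_mem[OF A(1), of u] A uK U by blast
    ultimately show ?thesis using count[of "elt A u"] count_elt[OF A] count_elt[OF B] by simp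
  qed
  have posB: "elt B v = 1 + v + a + (if d0 a then size a else 0)" if a: "a \<in> Reps" and v: "a \<le> v" "v < a + size a" for a v
  proof -
    have vK: "v < r" "rep v = a" using class_iff[OF a, of v] v by simp_all
    have "u < r \<and> elt B u \<le> elt B v \<longleftrightarrow> u \<le> v" for u
      using elt_less_iff[OF B(1), of v u] B(2) vK(1) by (cases "u < r") (simp_all add: not_less[symmetric])
    then have "{u. u < r \<and> elt B u \<le> elt B v} = {..v}" unfolding atMost_def by simp
    moreover have "{u. u < r \<and> elt A u \<le> elt B v} = {u. u < r \<and> T u v}"
      using neAB[OF _ vK(1)] by (auto simp: T_def le_less)
    moreover have "{u. u < r \<and> T u v} = {..<(if d0 a then a + size a else a)}"
    proof -
      have "u < r \<and> T u v \<longleftrightarrow> u < (if d0 a then a + size a else a)" for u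
      proof (cases "u < r")
        case True
        have "rep u = a \<longleftrightarrow> a \<le> u \<and> u < a + size a" using class_iff[OF a, of u] True by (simp only: simp_thms)
        then have "T u v = (if a \<le> u \<and> u < a + size a then d0 a else u < v)"
          using Tform[OF True vK(1)] by (auto simp only: vK(2) split: if_splits)
        then show ?thesis using v True by (simp only: simp_thms) (simp, linarith)
      qed (use cls_le[OF a] in auto)
      then show ?thesis by auto
    qed
    moreover have "elt B v \<in> {1..2 * r}" using elt_mem[OF B(1), of v] B vK U by blast
    ultimately show ?thesis using count[of "elt B v"] count_elt[OF A] count_elt[OF B] by simp
  qed
  define J where "J a = {1 + 2 * a..<1 + 2 * a + 2 * size a}" for a
  have mJ: "y \<in> J a \<longleftrightarrow> 1 \<le> y \<and> (y - 1) div 2 < r \<and> rep ((y - 1) div 2) = a" if a: "a \<in> Reps" for a y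
  proof -
    have "y \<in> J a \<longleftrightarrow> 1 \<le> y \<and> (y - 1) div 2 \<in> {a..<a + size a}" unfolding J_def by auto
    then show ?thesis using class_iff[OF a, of "(y - 1) div 2"] by simp
  qed
  have blocks: "is_block_partition P (J ` Reps)"
    unfolding is_block_partition_def
  proof
    show "partition_on (\<Union>P) (J ` Reps)"
    proof (rule partition_onI)
      have "J a \<noteq> {}" if "a \<in> Reps" for a using size_pos[OF that] by (simp add: J_def)
      then show "{} \<notin> J ` Reps" by auto
      have "\<Union>P = {1..2 * r}" using PAB U by simp
      moreover have "\<Union>(J ` Reps) = {1..2 * r}"
      proof (intro equalityI subsetI)
        fix y assume "y \<in> \<Union>(J ` Reps)"
        then show "y \<in> {1..2 * r}" using mJ by auto
      next
        fix y assume y: "y \<in> {1..2 * r}"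
        then have "(y - 1) div 2 < r" by auto
        then have "rep ((y - 1) div 2) \<in> Reps" "y \<in> J (rep ((y - 1) div 2))" using mJ y by (auto simp: Reps_def)
        then show "y \<in> \<Union>(J ` Reps)" by blast
      qed
      ultimately show "\<Union>(J ` Reps) = \<Union>P" by simp
      show "disjnt p q" if "p \<in> J ` Reps" "q \<in> J ` Reps" "p \<noteq> q" for p q
        using that mJ by (auto simp: disjnt_iff)
    qed
    show "\<forall>K\<in>J ` Reps. is_block P K"
    proof (intro ballI, elim imageE)
      fix K a assume K: "K = J a" and a: "a \<in> Reps"
      let ?e = "if d0 a then A else B" and ?f = "if d0 a then B else A"
      have "?e \<in> P" "?f \<in> P" "?e \<noteq> ?f" using PAB AB A r by auto
      moreover have "{1 + 2 * a..<1 + 2 * a + size a} \<subseteq> ?e"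
      proof
        fix x assume x: "x \<in> {1 + 2 * a..<1 + 2 * a + size a}"
        define u where "u = x - 1 - a"
        have u: "a \<le> u" "u < a + size a" "x = 1 + u + a" using x by (auto simp: u_def)
        have "u < r" using u cls_le[OF a] by simp
        then show "x \<in> ?e" using posA[OF a u(1,2)] posB[OF a u(1,2)] u(3) elt_mem[OF A(1), of u] elt_mem[OF B(1), of u] A B by auto
      qed
      moreover have "{1 + 2 * a + size a..<1 + 2 * a + 2 * size a} \<subseteq> ?f"
      proof
        fix x assume x: "x \<in> {1 + 2 * a + size a..<1 + 2 * a + 2 * size a}"
        define u where "u = x - 1 - a - size a"
        have u: "a \<le> u" "u < a + size a" "x = 1 + u + a + size a" using x by (auto simp: u_def)
        have "u < r" using u cls_le[OF a] by simp
        then show "x \<in> ?f" using posA[OF a u(1,2)] posB[OF a u(1,2)] u(3) elt_mem[OF A(1), of u] elt_mem[OF B(1), of u] A B by auto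
      qed
      ultimately show "is_block P K" unfolding is_block_def K J_def using size_pos[OF a]
        by (intro exI[of _ "1 + 2 * a"] exI[of _ "size a"] exI[of _ ?e] exI[of _ ?f]) (simp add: Suc_leI)
    qed
  qed
  have injJ: "inj_on J Reps"
  proof (rule inj_onI)
    fix a b assume ab: "a \<in> Reps" "b \<in> Reps" "J a = J b"
    have "1 + 2 * a \<in> J a" using size_pos[OF ab(1)] by (simp add: J_def)
    then show "a = b" using mJ[OF ab(1)] mJ[OF ab(2)] ab(3) by metis
  qed
  have "block_partition P = J ` Reps"
    using P block_partition_eq[OF _ blocks] unfolding r_pattern_def by blast
  then have "pattern_type P = image_mset (\<lambda>K. card K div 2) (mset_set (J ` Reps))"
    by (simp add: pattern_type_def)
  also have "\<dots> = image_mset size (mset_set Reps)"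
  proof -
    have "card (J a) div 2 = size a" for a by (simp add: J_def)
    then show ?thesis
      by (simp add: image_mset_mset_set[OF injJ, symmetric] image_mset.compositionality o_def)
  qed
  finally have "image_mset size (mset_set Reps) = mset ms" unfolding ms_def by simp
  (* The list reps enumerates the classes in the order of the sorted type. *)
  then obtain reps where reps: "mset reps = mset_set Reps" "map size reps = ms"
    using map_eq_of_image_mset by metis
  have set_reps: "set reps = Reps" using reps(1) finReps by (metis finite_set_mset_mset_set set_mset_mset)
  have dist: "distinct reps" using reps(1) set_reps finReps by (metis mset_set_set mset_eq_setD distinct_count_atmost_1 count_mset_set(1) count_mset_set(3))
  have len: "length reps = length ms" using reps(2) by auto
  define cls where "cls u = (THE i. i < length reps \<and> reps ! i = rep u)" for u
  have cls: "cls u < length reps \<and> reps ! cls u = rep u" if "u < r" for u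
  proof -
    have "rep u \<in> set reps" using that set_reps by (simp add: Reps_def)
    then obtain i where i: "i < length reps" "reps ! i = rep u" by (auto simp: in_set_conv_nth)
    have "\<exists>!i. i < length reps \<and> reps ! i = rep u"
    proof (rule ex1I[of _ i])
      fix k assume "k < length reps \<and> reps ! k = rep u"
      then show "k = i" using nth_eq_iff_index_eq[OF dist, of k i] i by simp
    qed (use i in simp)
    from theI'[OF this] show ?thesis unfolding cls_def .
  qed
  have cls_eq: "cls u = cls v \<longleftrightarrow> rep u = rep v" if "u < r" "v < r" for u v
    using cls[OF that(1)] cls[OF that(2)] dist by (metis nth_eq_iff_index_eq)
  have cls_i: "cls u = i \<longleftrightarrow> rep u = reps ! i" if "u < r" "i < length reps" for u i
    using cls[OF that(1)] that(2) dist by (metis nth_eq_iff_index_eq)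
  show ?thesis
  proof (rule that[of cls "\<lambda>i. d0 (reps ! i)"])
    show "cls u < length ms" if "u < r" for u using cls[OF that] len by simp
    show "card {u. u < r \<and> cls u = j} = ms ! j" if j: "j < length ms" for j
    proof -
      have "{u. u < r \<and> cls u = j} = {u. u < r \<and> rep u = reps ! j}" using cls_i len j by auto
      then have "card {u. u < r \<and> cls u = j} = size (reps ! j)" by (simp add: size_def)
      then show ?thesis using reps(2) j len by (metis nth_map)
    qed
    show "0 < ms ! j" if j: "j < length ms" for j
      using size_pos[of "reps ! j"] set_reps j len reps(2) by (metis nth_map nth_mem)
    show "cls v = cls u" if uvw: "u < v" "v < w" "w < r" "cls u = cls w" for u v w
    proof -
      have "E u w" using uvw cls_eq[of u w] rep_eq[of u w] by simp
      then have "E u v" using Econvex[of u v w] uvw by simp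
      then show ?thesis using uvw cls_eq[of v u] rep_eq[of v u] Esym by simp
    qed
    have "interleaved r T e f \<longleftrightarrow> edge_precedes r cls (\<lambda>i. d0 (reps ! i)) e f" for e f
    proof -
      have "T u v = (if cls u = cls v then d0 (reps ! cls u) else u < v)" if "u < r" "v < r" for u v
        using Tform[OF that] cls_eq[OF that] cls[OF that(1)] by simp
      then show ?thesis unfolding interleaved_def edge_precedes_def by simp
    qed
    then show "order_isomorphic {e, f} P \<longleftrightarrow>
        edge_precedes r cls (\<lambda>i. d0 (reps ! i)) e f \<or> edge_precedes r cls (\<lambda>i. d0 (reps ! i)) f e"
      if "finite e" "card e = r" "finite f" "card f = r" for e f using pair_iso[OF that] by simp
  qed
qed

section \<open>From random edges to random matchings\<close>

definition pair_iso :: "nat set set \<Rightarrow> nat set \<Rightarrow> nat set \<Rightarrow> bool" where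
  "pair_iso P e f \<longleftrightarrow> order_isomorphic {e, f} P"

definition subsets :: "nat \<Rightarrow> nat \<Rightarrow> nat set set" where
  "subsets r Q = {e. e \<subseteq> {..<Q} \<and> card e = r}"

abbreviation edge_sample :: "nat \<Rightarrow> nat \<Rightarrow> nat \<Rightarrow> nat set set pmf" where
  "edge_sample r Q n \<equiv> sample_set n (map_pmf Some (pmf_of_set (subsets r Q)))"

abbreviation matching_pmf :: "nat \<Rightarrow> nat \<Rightarrow> nat set set pmf" where
  "matching_pmf r n \<equiv> pmf_of_set (matchings_of_size r n)"

lemma finite_subsets [simp]: "finite (subsets r Q)"
  unfolding subsets_def by (rule finite_subset[of _ "Pow {..<Q}"]) auto

lemma card_subsets: "card (subsets r Q) = Q choose r"
  unfolding subsets_def using n_subsets[of "{..<Q}" r] by simp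

lemma subsets_nonempty: "r \<le> Q \<Longrightarrow> subsets r Q \<noteq> {}"
  using card_subsets[of r Q] by (metis card.empty binomial_eq_0_iff not_less)

lemma clique_number_image_ge:
  assumes "finite N" "inj_on F N" "\<And>x y. x \<in> N \<Longrightarrow> y \<in> N \<Longrightarrow> R x y \<Longrightarrow> R' (F x) (F y)"
  shows "clique_number R N \<le> clique_number R' (F ` N)"
proof -
  obtain C where C: "C \<subseteq> N" "pairwise R C" "card C = clique_number R N"
    by (rule clique_number_attained[OF assms(1)])
  have inj: "inj_on F C" using assms(2) C(1) by (rule inj_on_subset)
  have "pairwise R' (F ` C)"
  proof (rule pairwiseI)
    fix x y assume "x \<in> F ` C" "y \<in> F ` C" "x \<noteq> y"
    then obtain a b where ab: "a \<in> C" "b \<in> C" "x = F a" "y = F b" "a \<noteq> b" by auto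
    then show "R' x y" using C assms(3)[of a b] unfolding pairwise_def by auto
  qed
  then have "card (F ` C) \<le> clique_number R' (F ` N)"
    using assms(1) C(1) by (intro card_le_clique_number) auto
  then show ?thesis using C(3) card_image[OF inj] by simp
qed

text \<open>
  Both sides depend only on the comparisons between positions of the two edges.
\<close>
lemma pair_iso_strict_mono_image:
  assumes P: "r_pattern r P" and r: "1 \<le> r" and e: "finite e" "card e = r" and f: "finite f" "card f = r"
    and g: "strict_mono_on (e \<union> f) g"
  shows "pair_iso P (g ` e) (g ` f) \<longleftrightarrow> pair_iso P e f"
proof -
  obtain A B where PAB: "P = {A, B}" and A: "finite A" "card A = r" and B: "finite B" "card B = r"
    and AB: "A \<inter> B = {}"
    using r_patternE[OF P r] by metis
  have m: "strict_mono_on e g" "strict_mono_on f g" using g by (auto simp: strict_mono_on_def)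
  have ge: "finite (g ` e)" "card (g ` e) = r" "finite (g ` f)" "card (g ` f) = r"
    using e f strict_mono_on_imp_inj_on[OF m(1)] strict_mono_on_imp_inj_on[OF m(2)] by (auto simp: card_image)
  have lt: "elt (g ` h) u < elt (g ` k) v \<longleftrightarrow> elt h u < elt k v"
    if "h \<in> {e, f}" "k \<in> {e, f}" "u < r" "v < r" for h k u v
  proof -
    have h: "finite h" "card h = r" "strict_mono_on h g" "h \<subseteq> e \<union> f"
      and k: "finite k" "card k = r" "strict_mono_on k g" "k \<subseteq> e \<union> f" using that e f m by auto
    have "elt h u \<in> e \<union> f" "elt k v \<in> e \<union> f" using elt_mem[OF h(1), of u] elt_mem[OF k(1), of v] h k that by auto
    then show ?thesis using elt_image_strict_mono[OF h(1,3), of u] elt_image_strict_mono[OF k(1,3), of v] that h k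
        strict_mono_on_less[OF g] by simp
  qed
  have "interleaved r T (g ` h) (g ` k) \<longleftrightarrow> interleaved r T h k" if "h \<in> {e, f}" "k \<in> {e, f}" for h k T
    unfolding interleaved_def using lt[OF that] lt[OF that(2,1)] by auto
  then show ?thesis
    unfolding pair_iso_def PAB order_isomorphic_pair_iff[OF A B AB r ge] order_isomorphic_pair_iff[OF A B AB r e f]
    by simp
qed

lemma is_clique_iff_pairwise:
  assumes M: "r_matching r V M" and C: "C \<subseteq> M"
  shows "is_clique r P C \<longleftrightarrow> pairwise (pair_iso P) C"
proof -
  have "r_matching r (\<Union>C) C"
    unfolding r_matching_def
  proof (intro conjI ballI)
    have "\<Union>C \<subseteq> V" using M C unfolding r_matching_def by blast
    then show "finite (\<Union>C)" using M finite_subset unfolding r_matching_def by auto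
    fix e assume "e \<in> C"
    then show "e \<subseteq> \<Union>C" "card e = r" using M C unfolding r_matching_def by auto
  next
    fix v assume "v \<in> \<Union>C"
    then obtain e where e: "e \<in> C" "v \<in> e" by auto
    show "\<exists>!e. e \<in> C \<and> v \<in> e"
    proof (rule ex1I[of _ e])
      fix f assume f: "f \<in> C \<and> v \<in> f"
      show "f = e" using r_matching_disjoint[OF M, of e f] f e C by auto
    qed (use e in simp)
  qed
  then show ?thesis unfolding is_clique_def pairwise_def pair_iso_def by blast
qed

lemma largest_clique_eq:
  assumes "r_matching r V M" shows "largest_clique r P M = clique_number (pair_iso P) M"
proof -
  have "{card C | C. C \<subseteq> M \<and> is_clique r P C} = {card C | C. C \<subseteq> M \<and> pairwise (pair_iso P) C}"
    using is_clique_iff_pairwise[OF assms] by blast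
  then show ?thesis unfolding largest_clique_def clique_number_def by simp
qed

lemma pmf_replicate: "length xs = n \<Longrightarrow> pmf (replicate_pmf n p) xs = (\<Prod>x\<leftarrow>xs. pmf p x)"
proof (induction n arbitrary: xs)
  case (Suc n)
  then obtain y ys where xs: "xs = y # ys" "length ys = n" by (cases xs) auto
  have "replicate_pmf (Suc n) p = map_pmf (\<lambda>(x, xs). x # xs) (pair_pmf p (replicate_pmf n p))"
    by (simp add: pair_pmf_def map_bind_pmf)
  also have "pmf \<dots> xs = pmf (pair_pmf p (replicate_pmf n p)) (y, ys)"
    using pmf_map_inj'[of "\<lambda>(x, xs). x # xs" _ "(y, ys)"] xs by (simp add: inj_def)
  finally show ?case using Suc.IH[OF xs(2)] xs by (simp add: pmf_pair)
qed simp

text \<open>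
  The lists of edges that form a matching, listed in some order, on some subset of \<open>{..<Q}\<close>.
\<close>
definition disj_lists :: "nat \<Rightarrow> nat \<Rightarrow> nat \<Rightarrow> nat set list set" where
  "disj_lists r Q n = {xs. length xs = n \<and> set xs \<subseteq> subsets r Q \<and> distinct xs \<and> disjoint (set xs)}"

lemma finite_disj_lists: "finite (disj_lists r Q n)"
  by (rule finite_subset[OF _ finite_lists_length_eq[of "subsets r Q" n]]) (auto simp: disj_lists_def)

lemma card_Union_disj_list:
  assumes "xs \<in> disj_lists r Q n"
  shows "card (\<Union>(set xs)) = r * n" "\<Union>(set xs) \<subseteq> {..<Q}"
proof -
  have xs: "length xs = n" "distinct xs" "disjoint (set xs)" "\<And>e. e \<in> set xs \<Longrightarrow> e \<subseteq> {..<Q} \<and> card e = r"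
    using assms by (auto simp: disj_lists_def subsets_def)
  have "card (\<Union>(set xs)) = (\<Sum>e\<in>set xs. card e)"
  proof (rule card_Union_disjoint)
    show "pairwise disjnt (set xs)" using xs(3) by (simp add: disjoint_def pairwise_def disjnt_def)
    fix e assume "e \<in> set xs"
    then have "e \<subseteq> {..<Q}" using xs(4) by simp
    then show "finite e" by (rule finite_subset) simp
  qed
  also have "\<dots> = r * n" using xs distinct_card[OF xs(2)] by simp
  finally show "card (\<Union>(set xs)) = r * n" .
  show "\<Union>(set xs) \<subseteq> {..<Q}" using xs(4) by blast
qed

lemma disj_lists_Suc:
  assumes "1 \<le> r"
  shows "disj_lists r Q (Suc n) =
    (\<lambda>(xs, x). x # xs) ` (SIGMA xs:disj_lists r Q n. {x. x \<subseteq> {..<Q} - \<Union>(set xs) \<and> card x = r})"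
proof (intro equalityI subsetI)
  fix zs assume zs: "zs \<in> disj_lists r Q (Suc n)"
  then obtain x xs where x: "zs = x # xs" by (cases zs) (auto simp: disj_lists_def)
  have "x \<inter> y = {}" if "y \<in> set xs" for y
    using zs that unfolding x disj_lists_def disjoint_def by auto
  then have "x \<subseteq> {..<Q} - \<Union>(set xs)" "card x = r" "xs \<in> disj_lists r Q n"
    using zs unfolding x by (auto simp: disj_lists_def subsets_def disjoint_def)
  then show "zs \<in> (\<lambda>(xs, x). x # xs) ` (SIGMA xs:disj_lists r Q n. {x. x \<subseteq> {..<Q} - \<Union>(set xs) \<and> card x = r})"
    unfolding x by force
next
  fix zs assume "zs \<in> (\<lambda>(xs, x). x # xs) ` (SIGMA xs:disj_lists r Q n. {x. x \<subseteq> {..<Q} - \<Union>(set xs) \<and> card x = r})"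
  then obtain x xs where x: "zs = x # xs" "xs \<in> disj_lists r Q n" "x \<subseteq> {..<Q} - \<Union>(set xs)" "card x = r" by auto
  have "x \<noteq> {}" using x(4) assms by auto
  then have "x \<notin> set xs" using x(3) by blast
  moreover have "x \<inter> y = {}" if "y \<in> set xs" for y using x(3) that by blast
  moreover have "x \<subseteq> {..<Q}" using x(3) by blast
  ultimately show "zs \<in> disj_lists r Q (Suc n)"
    using x(2,4) unfolding x(1) by (auto simp: disj_lists_def subsets_def disjoint_def)
qed

text \<open>
  A new edge avoids the \<open>r * n\<close> vertices that are already covered.
\<close>
lemma card_disj_lists:
  assumes "1 \<le> r" shows "card (disj_lists r Q n) = (\<Prod>i<n. (Q - r * i) choose r)"
proof (induction n)
  case 0
  have "disj_lists r Q 0 = {[]}" by (auto simp: disj_lists_def)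
  then show ?case by simp
next
  case (Suc n)
  have "card {x. x \<subseteq> {..<Q} - \<Union>(set xs) \<and> card x = r} = (Q - r * n) choose r" if "xs \<in> disj_lists r Q n" for xs
    using card_Union_disj_list[OF that] n_subsets[of "{..<Q} - \<Union>(set xs)" r]
    by (simp add: card_Diff_subset finite_subset[OF _ finite_lessThan])
  moreover have "inj_on (\<lambda>(xs, x). x # xs) S" for S :: "('a list \<times> 'a) set" by (auto intro: inj_onI)
  ultimately have "card (disj_lists r Q (Suc n)) = (\<Sum>xs\<in>disj_lists r Q n. (Q - r * n) choose r)"
    unfolding disj_lists_Suc[OF assms]
    by (subst card_image) (auto simp: card_SigmaI finite_disj_lists intro!: inj_onI
        finite_subset[of "{x. x \<subseteq> _ - _ \<and> _ x}" "Pow {..<Q}"])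
  then show ?case by (simp add: Suc)
qed

lemma binomial_power_limit: "(\<lambda>Q. real (Q choose r) / real Q ^ r) \<longlonglongrightarrow> 1 / fact r"
proof (induction r)
  case 0 then show ?case by simp
next
  case (Suc r)
  have "(\<lambda>Q. (real Q - real r) / real Q) \<longlonglongrightarrow> 1" by real_asymp
  from tendsto_mult[OF tendsto_mult[OF Suc this] tendsto_const[of "1 / real (Suc r)"]]
  have "(\<lambda>Q. real (Q choose r) / real Q ^ r * ((real Q - real r) / real Q) * (1 / real (Suc r))) \<longlonglongrightarrow> 1 / fact (Suc r)"
    by (simp add: mult.commute)
  then show ?case
  proof (rule Lim_transform_eventually)
    show "\<forall>\<^sub>F Q in sequentially. real (Q choose r) / real Q ^ r * ((real Q - real r) / real Q) * (1 / real (Suc r)) =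
        real (Q choose Suc r) / real Q ^ Suc r"
      using eventually_ge_at_top[of "Suc r"]
    proof eventually_elim
      case (elim Q)
      have "Suc r * (Q choose Suc r) = (Q - r) * (Q choose r)"
        using binomial_absorption[of r Q] binomial_absorb_comp[of Q r] by simp
      then have "real (Suc r) * real (Q choose Suc r) = (real Q - real r) * real (Q choose r)"
        using elim by (metis of_nat_mult of_nat_diff Suc_leD)
      then have "real (Q choose Suc r) = (real Q - real r) * real (Q choose r) / real (Suc r)"
        by (simp add: nonzero_eq_divide_eq mult.commute del: of_nat_Suc)
      then show ?case using elim by (simp add: mult.commute mult.left_commute)
    qed
  qed
qed

lemma card_disj_lists_ratio:
  assumes r: "1 \<le> r"
  shows "(\<lambda>Q. real (card (disj_lists r Q n)) / real (Q choose r) ^ n) \<longlonglongrightarrow> 1"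
proof -
  have one: "(\<lambda>Q. real ((Q - a) choose r) / real (Q choose r)) \<longlonglongrightarrow> 1" for a
  proof -
    have sh: "filterlim (\<lambda>Q::nat. Q - a) at_top sequentially" by real_asymp
    have "(\<lambda>Q. real (Q - a) / real Q) \<longlonglongrightarrow> 1" by real_asymp
    then have "(\<lambda>Q. (real (Q - a) / real Q) ^ r) \<longlonglongrightarrow> 1 ^ r" by (rule tendsto_power)
    from tendsto_divide[OF tendsto_mult[OF filterlim_compose[OF binomial_power_limit[of r] sh] this] binomial_power_limit[of r]]
    have "(\<lambda>Q. real ((Q - a) choose r) / real (Q - a) ^ r * (real (Q - a) / real Q) ^ r / (real (Q choose r) / real Q ^ r)) \<longlonglongrightarrow> 1"
      by simp
    then show ?thesis
    proof (rule Lim_transform_eventually)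
      show "\<forall>\<^sub>F Q in sequentially. real ((Q - a) choose r) / real (Q - a) ^ r * (real (Q - a) / real Q) ^ r / (real (Q choose r) / real Q ^ r) =
          real ((Q - a) choose r) / real (Q choose r)"
        using eventually_gt_at_top[of a] by eventually_elim (simp add: power_divide)
    qed
  qed
  have "(\<lambda>Q. \<Prod>i<n. real ((Q - r * i) choose r) / real (Q choose r)) \<longlonglongrightarrow> (\<Prod>i<n. 1)"
    by (intro tendsto_prod one)
  then show ?thesis by (simp add: card_disj_lists[OF r] prod_dividef)
qed

text \<open>
  A list of disjoint edges is given by its vertex set \<open>U\<close> and by an ordered matching of \<open>{1..r * n}\<close>, which is
  transported to \<open>U\<close> by the increasing enumeration of \<open>U\<close>.
\<close>
lemma disj_lists_bij:
  fixes r n Q :: nat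
  assumes r: "1 \<le> r"
  defines "X \<equiv> {ys. distinct ys \<and> set ys \<in> matchings_of_size r n}"
  defines "h \<equiv> \<lambda>(U, ys). map ((`) (\<lambda>i. elt U (i - 1))) ys"
  shows "bij_betw h (subsets (r * n) Q \<times> X) (disj_lists r Q n)"
proof -
  let ?\<iota> = "\<lambda>U i. elt U (i - 1)"
  have U: "finite U" "card U = r * n" "U \<subseteq> {..<Q}" if "U \<in> subsets (r * n) Q" for U
    using that finite_subset[of U "{..<Q}"] by (auto simp: subsets_def)
  have iota: "bij_betw (?\<iota> U) {1..r * n} U" if "U \<in> subsets (r * n) Q" for U
  proof (rule bij_betw_imageI)
    show "inj_on (?\<iota> U) {1..r * n}"
    proof (rule inj_onI)
      fix i j assume ij: "i \<in> {1..r * n}" "j \<in> {1..r * n}" "elt U (i - 1) = elt U (j - 1)"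
      have "i - 1 = j - 1" using elt_eq_iff[OF U(1)[OF that], of "i - 1" "j - 1"] U(2)[OF that] ij by auto
      then show "i = j" using ij by auto
    qed
    have "(\<lambda>i. i - 1) ` {1..r * n} = {..<r * n}" by (auto simp: image_iff intro!: bexI[of _ "Suc _"])
    moreover have "?\<iota> U ` {1..r * n} = elt U ` (\<lambda>i. i - 1) ` {1..r * n}" by (simp only: image_image)
    ultimately show "?\<iota> U ` {1..r * n} = U" using elt_image[OF U(1)[OF that]] U(2)[OF that] by simp
  qed
  have X: "length ys = n" "\<Union>(set ys) = {1..r * n}" "\<And>e. e \<in> set ys \<Longrightarrow> e \<subseteq> {1..r * n} \<and> card e = r"
      "disjoint (set ys)" "distinct ys" if "ys \<in> X" for ys
  proof -
    have M: "r_matching r {1..r * n} (set ys)" "card (set ys) = n" "distinct ys"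
      using that by (auto simp: X_def matchings_of_size_def)
    show "length ys = n" "distinct ys" using M distinct_card[OF M(3)] by simp_all
    show "\<And>e. e \<in> set ys \<Longrightarrow> e \<subseteq> {1..r * n} \<and> card e = r" using M(1) unfolding r_matching_def by simp
    then show "\<Union>(set ys) = {1..r * n}" using M(1) unfolding r_matching_def by blast
    show "disjoint (set ys)" using r_matching_disjoint[OF M(1)] by (auto simp: disjoint_def)
  qed
  have inj_img: "inj_on ((`) (?\<iota> U)) {e. e \<subseteq> {1..r * n}}" if "U \<in> subsets (r * n) Q" for U
    using inj_on_image_Pow[OF bij_betw_imp_inj_on[OF iota[OF that]]] by (simp add: Pow_def)
  show ?thesis
  proof (rule bij_betw_imageI)
    show "inj_on h (subsets (r * n) Q \<times> X)"
    proof (rule inj_onI, clarify)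
      fix U ys U' ys' assume *: "U \<in> subsets (r * n) Q" "ys \<in> X" "U' \<in> subsets (r * n) Q" "ys' \<in> X" "h (U, ys) = h (U', ys')"
      have un: "\<Union>(set (h (U, ys))) = U" if "U \<in> subsets (r * n) Q" "ys \<in> X" for U ys
      proof -
        have "\<Union>(set (h (U, ys))) = ?\<iota> U ` \<Union>(set ys)" unfolding h_def by auto
        then show ?thesis using X(2)[OF that(2)] bij_betw_imp_surj_on[OF iota[OF that(1)]] by simp
      qed
      have "U = U'" using un[OF *(1,2)] un[OF *(3,4)] *(5) by simp
      moreover have "ys = ys'"
      proof (rule map_inj_on)
        show "map ((`) (?\<iota> U)) ys = map ((`) (?\<iota> U)) ys'" using *(5) \<open>U = U'\<close> by (simp add: h_def)
        show "inj_on ((`) (?\<iota> U)) (set ys \<union> set ys')"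
          by (rule inj_on_subset[OF inj_img[OF *(1)]]) (use X(3)[OF *(2)] X(3)[OF *(4)] in auto)
      qed
      ultimately show "U = U' \<and> ys = ys'" by simp
    qed
    show "h ` (subsets (r * n) Q \<times> X) = disj_lists r Q n"
    proof (intro equalityI subsetI)
      fix zs assume "zs \<in> h ` (subsets (r * n) Q \<times> X)"
      then obtain U ys where *: "U \<in> subsets (r * n) Q" "ys \<in> X" "zs = map ((`) (?\<iota> U)) ys" by (auto simp: h_def)
      note b = iota[OF *(1)] and XX = X[OF *(2)]
      have "?\<iota> U ` e \<subseteq> {..<Q} \<and> card (?\<iota> U ` e) = r" if "e \<in> set ys" for e
      proof
        show "?\<iota> U ` e \<subseteq> {..<Q}" using XX(3)[OF that] bij_betw_imp_surj_on[OF b] U(3)[OF *(1)] by blast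
        show "card (?\<iota> U ` e) = r"
          using XX(3)[OF that] inj_on_subset[OF bij_betw_imp_inj_on[OF b]] by (subst card_image) auto
      qed
      moreover have "distinct zs" unfolding *(3) distinct_map
        using XX(5) inj_on_subset[OF inj_img[OF *(1)], of "set ys"] XX(3) by auto
      moreover have "disjoint (set zs)" unfolding disjoint_def
      proof (intro ballI impI)
        fix a b assume ab: "a \<in> set zs" "b \<in> set zs" "a \<noteq> b"
        then obtain e f where ef: "e \<in> set ys" "f \<in> set ys" "a = ?\<iota> U ` e" "b = ?\<iota> U ` f" "e \<noteq> f" using *(3) by auto
        then have "e \<inter> f = {}" using XX(4) by (auto simp: disjoint_def)
        then show "a \<inter> b = {}"
          using ef XX(3) inj_on_image_Int[OF bij_betw_imp_inj_on[OF b], of e f] by auto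
      qed
      ultimately show "zs \<in> disj_lists r Q n" using XX(1) *(3) by (auto simp: disj_lists_def subsets_def)
    next
      fix zs assume zs: "zs \<in> disj_lists r Q n"
      then have z: "length zs = n" "distinct zs" "disjoint (set zs)" "\<And>e. e \<in> set zs \<Longrightarrow> card e = r"
        by (auto simp: disj_lists_def subsets_def)
      define V where "V = \<Union>(set zs)"
      have V: "V \<in> subsets (r * n) Q" using card_Union_disj_list[OF zs] by (simp add: V_def subsets_def)
      note b = iota[OF V]
      define k where "k = the_inv_into {1..r * n} (?\<iota> V)"
      have bk: "bij_betw k V {1..r * n}" unfolding k_def by (rule bij_betw_the_inv_into[OF b])
      have ik: "?\<iota> V (k v) = v" if "v \<in> V" for v
        unfolding k_def using f_the_inv_into_f_bij_betw[OF b] that by simp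
      have sub: "e \<subseteq> V" if "e \<in> set zs" for e using that by (auto simp: V_def)
      define ys where "ys = map ((`) k) zs"
      have "map ((`) (?\<iota> V)) ys = zs"
        unfolding ys_def map_map by (rule map_idI) (use ik sub in \<open>force simp: image_image\<close>)
      moreover have "ys \<in> X"
        unfolding X_def matchings_of_size_def r_matching_def
      proof (intro CollectI conjI ballI)
        have injk: "inj_on ((`) k) (Pow V)" by (rule inj_on_image_Pow[OF bij_betw_imp_inj_on[OF bk]])
        show dys: "distinct ys" unfolding ys_def distinct_map
          using z(2) inj_on_subset[OF injk, of "set zs"] sub by auto
        show "card (set ys) = n" using distinct_card[OF dys] z(1) by (simp add: ys_def)
        show "finite {1..r * n}" by simp
        fix e assume "e \<in> set ys"
        then obtain e0 where e0: "e0 \<in> set zs" "e = k ` e0" by (auto simp: ys_def)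
        show "e \<subseteq> {1..r * n}" using e0 sub bij_betw_imp_surj_on[OF bk] by blast
        show "card e = r" using e0 z(4) sub inj_on_subset[OF bij_betw_imp_inj_on[OF bk]] by (simp add: card_image)
      next
        fix v assume "v \<in> {1..r * n}"
        then have "v \<in> k ` V" using bij_betw_imp_surj_on[OF bk] by simp
        then obtain x where x: "x \<in> V" "v = k x" by auto
        obtain e0 where e0: "e0 \<in> set zs" "x \<in> e0" using x(1) by (auto simp: V_def)
        show "\<exists>!e. e \<in> set ys \<and> v \<in> e"
        proof (rule ex1I[of _ "k ` e0"])
          show "k ` e0 \<in> set ys \<and> v \<in> k ` e0" using e0 x by (auto simp: ys_def)
          fix e assume "e \<in> set ys \<and> v \<in> e"
          then obtain f0 where f0: "f0 \<in> set zs" "e = k ` f0" "v \<in> k ` f0" by (auto simp: ys_def)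
          then obtain y where y: "y \<in> f0" "v = k y" by auto
          have "x = y" using inj_onD[OF bij_betw_imp_inj_on[OF bk], of x y] x y sub[OF f0(1)] by auto
          then have "e0 = f0" using z(3) e0 f0 y by (auto simp: disjoint_def)
          then show "e = k ` e0" using f0 by simp
        qed
      qed
      ultimately show "zs \<in> h ` (subsets (r * n) Q \<times> X)" using V by (auto simp: h_def image_iff intro!: bexI[of _ V] bexI[of _ ys])
    qed
  qed
qed

text \<open>
  By the bijection, each matching arises from the same number of lists of disjoint edges, and the clique
  number is invariant under the increasing enumeration. The probability for the random matching is hence the
  conditional probability for the sampled edges given that they are disjoint, and the condition has
  probability at least one half when \<open>Q\<close> is large.
\<close>
lemma matching_prob_le:
  assumes r: "1 \<le> r" and P: "r_pattern r P"
  shows "\<forall>\<^sub>F Q in sequentially. \<forall>\<Phi>.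
    measure_pmf.prob (matching_pmf r n) {M. \<Phi> (largest_clique r P M)} \<le>
    2 * measure_pmf.prob (edge_sample r Q n) {N. \<Phi> (clique_number (pair_iso P) N)}"
proof -
  have "\<forall>\<^sub>F Q in sequentially. 1 / 2 < real (card (disj_lists r Q n)) / real (Q choose r) ^ n"
    using card_disj_lists_ratio[OF r] by (rule order_tendstoD) simp
  then show ?thesis using eventually_ge_at_top[of r]
  proof eventually_elim
    case (elim Q)
    show ?case
    proof
      fix \<Phi> :: "nat \<Rightarrow> bool"
      let ?X = "{ys. distinct ys \<and> set ys \<in> matchings_of_size r n}"
      let ?Mt = "matchings_of_size r n"
      let ?h = "\<lambda>(U, ys). map ((`) (\<lambda>i. elt U (i - 1))) ys"
      let ?S = "subsets r Q"
      define \<Psi> where "\<Psi> N = \<Phi> (clique_number (pair_iso P) N)" for N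
      have bij: "bij_betw ?h (subsets (r * n) Q \<times> ?X) (disj_lists r Q n)" by (rule disj_lists_bij[OF r])
      have inv: "clique_number (pair_iso P) (set (?h (U, ys))) = clique_number (pair_iso P) (set ys)"
        if U: "U \<in> subsets (r * n) Q" and ys: "ys \<in> ?X" for U ys
      proof -
        let ?\<iota> = "\<lambda>i. elt U (i - 1)"
        have finU: "finite U" "card U = r * n" using U finite_subset[of U "{..<Q}"] by (auto simp: subsets_def)
        have m: "strict_mono_on {1..r * n} ?\<iota>"
          by (rule strict_mono_onI) (use elt_less_iff[OF finU(1)] finU(2) in auto)
        have e: "finite e" "card e = r" "e \<subseteq> {1..r * n}" if "e \<in> set ys" for e
          using ys that finite_subset[of e "{1..r * n}"] by (auto simp: matchings_of_size_def r_matching_def)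
        have pair_iso: "pair_iso P (?\<iota> ` e) (?\<iota> ` f) \<longleftrightarrow> pair_iso P e f" if "e \<in> set ys" "f \<in> set ys" for e f
        proof (rule pair_iso_strict_mono_image[OF P r e(1,2)[OF that(1)] e(1,2)[OF that(2)]])
          show "strict_mono_on (e \<union> f) ?\<iota>" using m e(3)[OF that(1)] e(3)[OF that(2)]
            unfolding strict_mono_on_def by blast
        qed
        have inj: "inj_on ((`) ?\<iota>) (set ys)"
          using inj_on_subset[OF inj_on_image_Pow[OF strict_mono_on_imp_inj_on[OF m]], of "set ys"] e(3) by auto
        let ?F = "(`) ?\<iota>"
        have eq: "set (?h (U, ys)) = ?F ` set ys" by simp
        have "clique_number (pair_iso P) (set ys) \<le> clique_number (pair_iso P) (?F ` set ys)"
          by (rule clique_number_image_ge[OF _ inj]) (use pair_iso in auto)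
        moreover have "clique_number (pair_iso P) (?F ` set ys) \<le> clique_number (pair_iso P) (the_inv_into (set ys) ?F ` ?F ` set ys)"
        proof (rule clique_number_image_ge)
          show "inj_on (the_inv_into (set ys) ?F) (?F ` set ys)" by (rule inj_on_the_inv_into[OF inj])
          fix x y assume "x \<in> ?F ` set ys" "y \<in> ?F ` set ys" "pair_iso P x y"
          then show "pair_iso P (the_inv_into (set ys) ?F x) (the_inv_into (set ys) ?F y)"
            using pair_iso the_inv_into_f_f[OF inj] by auto
        qed simp
        moreover have "the_inv_into (set ys) ?F ` ?F ` set ys = set ys"
          using the_inv_into_f_f[OF inj] by (force simp: image_image)
        ultimately show ?thesis using eq by simp
      qed
      have count: "card {xs \<in> disj_lists r Q n. \<Theta> (set xs)} = (Q choose (r * n)) * (fact n * card {M \<in> ?Mt. \<Theta> M})"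
        if \<Theta>: "\<And>U ys. U \<in> subsets (r * n) Q \<Longrightarrow> ys \<in> ?X \<Longrightarrow> \<Theta> (set (?h (U, ys))) = \<Theta> (set ys)" for \<Theta>
      proof -
        have "bij_betw ?h {z \<in> subsets (r * n) Q \<times> ?X. \<Theta> (set (snd z))} {xs \<in> disj_lists r Q n. \<Theta> (set xs)}"
        proof (rule bij_betw_imageI)
          show "inj_on ?h {z \<in> subsets (r * n) Q \<times> ?X. \<Theta> (set (snd z))}"
            by (rule inj_on_subset[OF bij_betw_imp_inj_on[OF bij]]) auto
          show "?h ` {z \<in> subsets (r * n) Q \<times> ?X. \<Theta> (set (snd z))} = {xs \<in> disj_lists r Q n. \<Theta> (set xs)}"
          proof (intro equalityI subsetI)
            fix xs assume "xs \<in> ?h ` {z \<in> subsets (r * n) Q \<times> ?X. \<Theta> (set (snd z))}"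
            then obtain U ys where "U \<in> subsets (r * n) Q" "ys \<in> ?X" "\<Theta> (set ys)" "xs = ?h (U, ys)" by auto
            then show "xs \<in> {xs \<in> disj_lists r Q n. \<Theta> (set xs)}" using \<Theta>[of U ys] bij_betw_apply[OF bij, of "(U, ys)"] by auto
          next
            fix xs assume xs: "xs \<in> {xs \<in> disj_lists r Q n. \<Theta> (set xs)}"
            then have "xs \<in> ?h ` (subsets (r * n) Q \<times> ?X)" using bij_betw_imp_surj_on[OF bij] by simp
            then obtain U ys where *: "U \<in> subsets (r * n) Q" "ys \<in> ?X" "xs = ?h (U, ys)" by auto
            then have "\<Theta> (set ys)" using \<Theta>[OF *(1,2)] xs by simp
            then show "xs \<in> ?h ` {z \<in> subsets (r * n) Q \<times> ?X. \<Theta> (set (snd z))}"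
              using * by (intro image_eqI[of _ _ "(U, ys)"]) auto
          qed
        qed
        then have "card {xs \<in> disj_lists r Q n. \<Theta> (set xs)} = card {z \<in> subsets (r * n) Q \<times> ?X. \<Theta> (set (snd z))}"
          by (simp add: bij_betw_same_card)
        also have "{z \<in> subsets (r * n) Q \<times> ?X. \<Theta> (set (snd z))} =
            subsets (r * n) Q \<times> (\<Union>M\<in>{M \<in> ?Mt. \<Theta> M}. permutations_of_set M)"
          by (auto simp: permutations_of_set_def)
        also have "card \<dots> = (Q choose (r * n)) * (\<Sum>M\<in>{M \<in> ?Mt. \<Theta> M}. card (permutations_of_set M))"
          using finite_matchings_of_size[of r n]
          by (subst card_cartesian_product, subst card_UN_disjoint) (auto simp: card_subsets permutations_of_set_def[of "_::nat set set"] intro: finite_permutations_of_set[unfolded permutations_of_set_def])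
        also have "(\<Sum>M\<in>{M \<in> ?Mt. \<Theta> M}. card (permutations_of_set M)) = (\<Sum>M\<in>{M \<in> ?Mt. \<Theta> M}. fact n)"
        proof (rule sum.cong[OF refl])
          fix M assume "M \<in> {M \<in> ?Mt. \<Theta> M}"
          then have M: "r_matching r {1..r * n} M" "card M = n" by (auto simp: matchings_of_size_def)
          have "finite M" by (rule finite_subset[of _ "Pow {1..r * n}"]) (use M in \<open>auto simp: r_matching_def\<close>)
          then show "card (permutations_of_set M) = fact n" using M by (simp add: card_permutations_of_set)
        qed
        finally show ?thesis by simp
      qed
      have c\<Psi>: "card {xs \<in> disj_lists r Q n. \<Psi> (set xs)} = (Q choose (r * n)) * (fact n * card {M \<in> ?Mt. \<Psi> M})"
        by (rule count) (use inv in \<open>simp add: \<Psi>_def\<close>)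
      have cT: "card (disj_lists r Q n) = (Q choose (r * n)) * (fact n * card ?Mt)"
        using count[of "\<lambda>_. True"] by simp
      have Sne: "?S \<noteq> {}" using subsets_nonempty[OF elim(2)] .
      have "measure_pmf.prob (pmf_of_set ?Mt) {M. \<Phi> (largest_clique r P M)} = card {M \<in> ?Mt. \<Psi> M} / card ?Mt"
      proof -
        have "?Mt \<inter> {M. \<Phi> (largest_clique r P M)} = {M \<in> ?Mt. \<Psi> M}"
          unfolding \<Psi>_def using largest_clique_eq by (auto simp: matchings_of_size_def)
        then show ?thesis using measure_pmf_of_set[OF matchings_of_size_nonempty[OF r] finite_matchings_of_size] by simp
      qed
      also have "\<dots> = card {xs \<in> disj_lists r Q n. \<Psi> (set xs)} / card (disj_lists r Q n)"
      proof -
        have "card (disj_lists r Q n) \<noteq> 0" using elim(1) by (cases "card (disj_lists r Q n) = 0") auto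
        then have "(Q choose (r * n)) * fact n \<noteq> (0::nat)" using cT by (metis mult_zero_left mult.assoc)
        then have "real ((Q choose (r * n)) * fact n) \<noteq> 0" by (simp only: of_nat_eq_0_iff not_False_eq_True)
        then show ?thesis unfolding c\<Psi> cT mult.assoc[symmetric] of_nat_mult by (simp del: of_nat_fact)
      qed
      also have "\<dots> \<le> card {xs \<in> disj_lists r Q n. \<Psi> (set xs)} * (2 / real (Q choose r) ^ n)"
      proof -
        have pos: "0 < real (Q choose r) ^ n" using elim(2) by simp
        then have "real (Q choose r) ^ n \<le> 2 * card (disj_lists r Q n)" using elim(1) by (simp add: pos_less_divide_eq)
        moreover from this have "0 < card (disj_lists r Q n)" using pos by linarith
        ultimately have "1 / real (card (disj_lists r Q n)) \<le> 2 / real (Q choose r) ^ n"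
          using pos by (simp add: divide_simps mult.commute)
        then have "card {xs \<in> disj_lists r Q n. \<Psi> (set xs)} * (1 / real (card (disj_lists r Q n))) \<le> card {xs \<in> disj_lists r Q n. \<Psi> (set xs)} * (2 / real (Q choose r) ^ n)"
          by (intro mult_left_mono) auto
        then show ?thesis by simp
      qed
      also have "\<dots> = 2 * (\<Sum>xs\<in>{xs \<in> disj_lists r Q n. \<Psi> (set xs)}. pmf (replicate_pmf n (pmf_of_set ?S)) xs)"
      proof -
        have "pmf (replicate_pmf n (pmf_of_set ?S)) xs = 1 / real (Q choose r) ^ n" if "xs \<in> disj_lists r Q n" for xs
        proof -
          have xs: "length xs = n" "set xs \<subseteq> ?S" using that by (auto simp: disj_lists_def)
          have "map (pmf (pmf_of_set ?S)) xs = map (\<lambda>_. 1 / real (Q choose r)) xs"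
            using xs(2) Sne by (intro map_cong) (auto simp: card_subsets indicator_def)
          then show ?thesis using pmf_replicate[OF xs(1), of "pmf_of_set ?S"] xs(1)
            by (simp add: map_replicate_const power_divide prod_list_replicate)
        qed
        then show ?thesis by simp
      qed
      also have "\<dots> = 2 * measure_pmf.prob (replicate_pmf n (pmf_of_set ?S)) {xs \<in> disj_lists r Q n. \<Psi> (set xs)}"
        using finite_disj_lists[of r Q n] by (subst measure_measure_pmf_finite) auto
      also have "\<dots> \<le> 2 * measure_pmf.prob (replicate_pmf n (pmf_of_set ?S)) {xs. \<Psi> (set xs)}"
        by (intro mult_left_mono measure_pmf.finite_measure_mono) auto
      also have "measure_pmf.prob (replicate_pmf n (pmf_of_set ?S)) {xs. \<Psi> (set xs)} =
          measure_pmf.prob (sample_set n (map_pmf Some (pmf_of_set ?S))) {N. \<Psi> N}"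
      proof -
        have "sample_set n (map_pmf Some p) = map_pmf set (replicate_pmf n p)" for p :: "nat set pmf"
          by (induction n) (simp_all add: map_pmf_def bind_assoc_pmf bind_return_pmf)
        then show ?thesis by (simp add: vimage_def)
      qed
      finally show "measure_pmf.prob (pmf_of_set ?Mt) {M. \<Phi> (largest_clique r P M)} \<le>
        2 * measure_pmf.prob (sample_set n (map_pmf Some (pmf_of_set ?S))) {N. \<Phi> (clique_number (pair_iso P) N)}"
        unfolding \<Psi>_def .
    qed
  qed
qed

section \<open>Tail bounds and the optimal division\<close>

text \<open>
  Chebyshev's inequality with variance at most \<open>expected_clique R n \<nu>\<close>; the resulting bound decreases in this
  expectation, so a lower bound \<open>y\<close> for it suffices.
\<close>
lemma clique_number_lower_deviation:
  assumes fin: "finite (set_pmf \<nu>)" and th: "0 < \<theta>" "\<theta> < 1" and y: "0 < y" "y \<le> expected_clique R n \<nu>" and x: "x \<le> (1 - \<theta>) * y"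
  shows "measure_pmf.prob (sample_set n \<nu>) {A. real (clique_number R A) < x} \<le> 1 / (\<theta>\<^sup>2 * y)"
proof -
  let ?E = "expected_clique R n \<nu>"
  let ?L = "\<lambda>A. real (clique_number R A)"
  have E: "0 < ?E" using y by linarith
  have "(1 - \<theta>) * y \<le> (1 - \<theta>) * ?E" using th y by (intro mult_left_mono) auto
  then have dev: "\<theta> * ?E \<le> ?E - x" using x by (simp add: algebra_simps)
  have "measure_pmf.prob (sample_set n \<nu>) {A. ?L A < x} \<le> measure_pmf.prob (sample_set n \<nu>) {A. \<theta> * ?E \<le> \<bar>?L A - measure_pmf.expectation (sample_set n \<nu>) ?L\<bar>}"
    using dev by (intro measure_pmf.finite_measure_mono) (auto simp: expected_clique_def[symmetric])
  also have "\<dots> \<le> measure_pmf.variance (sample_set n \<nu>) ?L / (\<theta> * ?E)\<^sup>2"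
    using th E by (intro Chebyshev_finite finite_set_pmf_sample_set fin) auto
  also have "\<dots> \<le> ?E / (\<theta> * ?E)\<^sup>2"
    by (intro divide_right_mono variance_clique_number_le fin) auto
  also have "\<dots> = 1 / (\<theta>\<^sup>2 * ?E)" using E th by (simp add: power2_eq_square)
  also have "\<dots> \<le> 1 / (\<theta>\<^sup>2 * y)" using th y E by (intro divide_left_mono mult_left_mono mult_pos_pos) auto
  finally show ?thesis .
qed

lemma clique_number_upper_deviation:
  assumes fin: "finite (set_pmf \<nu>)" and t: "0 < t" and y: "expected_clique R n \<nu> \<le> y"
  shows "measure_pmf.prob (sample_set n \<nu>) {A. y + t < real (clique_number R A)} \<le> y / t\<^sup>2"
proof -
  let ?L = "\<lambda>A. real (clique_number R A)"
  have "measure_pmf.prob (sample_set n \<nu>) {A. y + t < ?L A} \<le> measure_pmf.prob (sample_set n \<nu>) {A. t \<le> \<bar>?L A - measure_pmf.expectation (sample_set n \<nu>) ?L\<bar>}"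
    using y by (intro measure_pmf.finite_measure_mono) (auto simp: expected_clique_def[symmetric])
  also have "\<dots> \<le> measure_pmf.variance (sample_set n \<nu>) ?L / t\<^sup>2"
    by (intro Chebyshev_finite finite_set_pmf_sample_set fin t)
  also have "\<dots> \<le> expected_clique R n \<nu> / t\<^sup>2" by (intro divide_right_mono variance_clique_number_le fin) auto
  also have "\<dots> \<le> y / t\<^sup>2" using y by (intro divide_right_mono) auto
  finally show ?thesis .
qed

text \<open>
  A single term of the binomial expansion of \<open>(a + b) ^ (a + b)\<close>.
\<close>
lemma power_div_fact_superadditive:
  "(real a ^ a / fact a) * (real b ^ b / fact b) \<le> real (a + b) ^ (a + b) / fact (a + b)"
proof -
  have "real ((a + b) choose a) * real a ^ a * real b ^ b \<le> (\<Sum>k\<le>a + b. real ((a + b) choose k) * real a ^ k * real b ^ (a + b - k))"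
    using member_le_sum[of a "{..a + b}" "\<lambda>k. real ((a + b) choose k) * real a ^ k * real b ^ (a + b - k)"] by simp
  also have "\<dots> = real (a + b) ^ (a + b)" by (simp add: binomial_ring)
  finally have "real ((a + b) choose a) * real a ^ a * real b ^ b \<le> real (a + b) ^ (a + b)" .
  moreover have "real ((a + b) choose a) = fact (a + b) / (fact a * fact b)"
    using binomial_fact[of a "a + b", where 'a = real] by simp
  ultimately show ?thesis by (simp add: divide_simps mult.commute mult.left_commute)
qed

text \<open>
  With \<open>z j = (x j / S) / (m j / r)\<close>, the inequality \<open>ln (z j) \<le> z j - 1\<close> gives
  \<open>(\<Sum>j. m j * ln (z j)) \<le> 0\<close>.
\<close>
lemma weighted_AM_GM:
  fixes x :: "nat \<Rightarrow> real" and m :: "nat \<Rightarrow> nat"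
  assumes m: "\<And>j. j < l \<Longrightarrow> 0 < m j" and l: "0 < l" and x: "\<And>j. j < l \<Longrightarrow> 0 < x j"
  defines "r \<equiv> \<Sum>j<l. m j" and "S \<equiv> \<Sum>j<l. x j"
  shows "(\<Prod>j<l. x j ^ m j) \<le> S ^ r * (\<Prod>j<l. (m j / real r) ^ m j)"
proof -
  have S: "0 < S" unfolding S_def using x l by (intro sum_pos) auto
  have "0 < r" unfolding r_def using m l by (intro sum_pos) auto
  define z where "z j = x j * r / (m j * S)" for j
  have z: "0 < z j" if "j < l" for j unfolding z_def using x[OF that] m[OF that] S \<open>0 < r\<close> by simp
  have "(\<Sum>j<l. m j * ln (z j)) \<le> (\<Sum>j<l. m j * (z j - 1))"
    using z by (intro sum_mono mult_left_mono ln_le_minus_one) auto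
  also have "\<dots> = (\<Sum>j<l. x j * r / S) - (\<Sum>j<l. real (m j))"
    unfolding sum_subtractf[symmetric]
  proof (rule sum.cong[OF refl])
    fix j assume "j \<in> {..<l}"
    then have "0 < m j" using m by simp
    then show "m j * (z j - 1) = x j * r / S - m j" unfolding z_def using S by (simp add: algebra_simps)
  qed
  also have "(\<Sum>j<l. x j * r / S) = r" using S by (simp add: S_def[symmetric] sum_divide_distrib[symmetric] sum_distrib_right[symmetric])
  finally have le0: "(\<Sum>j<l. m j * ln (z j)) \<le> 0" by (simp add: r_def)
  have "(\<Prod>j<l. z j ^ m j) = exp (\<Sum>j<l. m j * ln (z j))"
    unfolding exp_sum[OF finite_lessThan]
  proof (rule prod.cong[OF refl])
    fix j assume "j \<in> {..<l}"
    then have "0 < z j" using z by simp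
    then show "z j ^ m j = exp (m j * ln (z j))" by (simp add: exp_of_nat_mult)
  qed
  also have "\<dots> \<le> 1" using le0 by simp
  finally have z1: "(\<Prod>j<l. z j ^ m j) \<le> 1" .
  have "(\<Prod>j<l. x j ^ m j) = (\<Prod>j<l. z j ^ m j) * (\<Prod>j<l. S ^ m j * (m j / real r) ^ m j)"
    unfolding prod.distrib[symmetric]
  proof (rule prod.cong[OF refl])
    fix j assume "j \<in> {..<l}"
    then have "0 < m j" using m by simp
    then have "x j = z j * (S * (m j / real r))" unfolding z_def using S \<open>0 < r\<close> by simp
    then show "x j ^ m j = z j ^ m j * (S ^ m j * (m j / real r) ^ m j)" by (simp only: power_mult_distrib)
  qed
  also have "\<dots> \<le> 1 * (\<Prod>j<l. S ^ m j * (m j / real r) ^ m j)"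
    using z1 S by (intro mult_right_mono prod_nonneg) auto
  also have "\<dots> = S ^ r * (\<Prod>j<l. (m j / real r) ^ m j)"
    unfolding prod.distrib r_def by (simp add: power_sum)
  finally show ?thesis .
qed

context block_sizes
begin

text \<open>
  The asymptotic probability that a random edge respects the division of the vertex set into consecutive
  intervals with lengths proportional to the block sizes.
\<close>
definition type_probability :: real where
  "type_probability = fact r * (\<Prod>j<l. (m j / real r) ^ m j / fact (m j))"

lemma type_probability_pos: "0 < type_probability"
  unfolding type_probability_def using m_pos r_pos by (intro mult_pos_pos prod_pos) auto

lemma type_probability_le_1: "type_probability \<le> 1"
proof -
  have "(\<Prod>j<k. real (m j) ^ m j / fact (m j)) \<le> real (\<Sum>j<k. m j) ^ (\<Sum>j<k. m j) / fact (\<Sum>j<k. m j)" for k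
  proof (induction k)
    case (Suc k)
    have "(\<Prod>j<Suc k. real (m j) ^ m j / fact (m j)) \<le>
        (real (\<Sum>j<k. m j) ^ (\<Sum>j<k. m j) / fact (\<Sum>j<k. m j)) * (real (m k) ^ m k / fact (m k))"
      using Suc by (simp only: prod.lessThan_Suc) (intro mult_right_mono, auto)
    also have "\<dots> \<le> real ((\<Sum>j<k. m j) + m k) ^ ((\<Sum>j<k. m j) + m k) / fact ((\<Sum>j<k. m j) + m k)"
      by (rule power_div_fact_superadditive)
    finally show ?case by simp
  qed simp
  from this[of l] have le: "(\<Prod>j<l. real (m j) ^ m j / fact (m j)) \<le> real r ^ r / fact r" unfolding r_def .
  have "type_probability = fact r / real r ^ r * (\<Prod>j<l. real (m j) ^ m j / fact (m j))"
  proof -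
    have "(\<Prod>j<l. (m j / real r) ^ m j / fact (m j)) = (\<Prod>j<l. (real (m j) ^ m j / fact (m j)) / real r ^ m j)"
      by (simp add: power_divide mult.commute)
    also have "\<dots> = (\<Prod>j<l. real (m j) ^ m j / fact (m j)) / real r ^ r"
      unfolding prod_dividef[of "\<lambda>j. real (m j) ^ m j / fact (m j)"] by (simp add: power_sum[symmetric] r_def)
    finally show ?thesis unfolding type_probability_def by simp
  qed
  also have "\<dots> \<le> fact r / real r ^ r * (real r ^ r / fact r)" using le by (intro mult_left_mono) auto
  also have "\<dots> = 1" using r_pos by simp
  finally show ?thesis .
qed

end

section \<open>Chunks of edges, cells and bands\<close>

text \<open>
  The classes of positions need not be numbered from left to right, so that the same numbering of block sizes can be
  shared by all patterns of one type. Their geometric order is given by the order of the positions in them.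
\<close>
locale block_pattern = block_sizes +
  fixes cls :: "nat \<Rightarrow> nat" and d :: "nat \<Rightarrow> bool"
  assumes cls_less: "\<And>u. u < r \<Longrightarrow> cls u < l"
    and card_cls: "\<And>j. j < l \<Longrightarrow> card {u. u < r \<and> cls u = j} = m j"
    and cls_convex: "\<And>u v w. u < v \<Longrightarrow> v < w \<Longrightarrow> w < r \<Longrightarrow> cls u = cls w \<Longrightarrow> cls v = cls u"
begin

definition positions :: "nat \<Rightarrow> nat set" where "positions j = {u. u < r \<and> cls u = j}"

definition chunk :: "nat set \<Rightarrow> nat \<Rightarrow> nat set" where
  "chunk e = (\<lambda>j\<in>{..<l}. elt e ` positions j)"

text \<open>
  The partial map that turns sites carrying edges into sites carrying tuples.
\<close>
definition located :: "(nat \<Rightarrow> nat set) \<Rightarrow> nat set \<Rightarrow> (nat \<Rightarrow> nat set) option" where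
  "located A e = (if \<forall>j<l. chunk e j \<subseteq> A j then Some (chunk e) else None)"

text \<open>
  Classes are disjoint and convex, so any two of them are ordered as a whole.
\<close>
lemma cls_order:
  assumes "u < v" "v < r" "cls u \<noteq> cls v" "a < r" "b < r" "cls a = cls u" "cls b = cls v"
  shows "a < b"
proof (rule ccontr)
  assume "\<not> a < b"
  then have "b < a" using assms by (metis linorder_neqE_nat)
  show False
  proof (cases "v < a")
    case True
    then show False using cls_convex[of u v a] assms by auto
  next
    case False
    then have "a < v" using assms by (metis linorder_neqE_nat)
    then show False using cls_convex[of b a v] assms \<open>b < a\<close> by auto
  qed
qed

lemma card_positions: "j < l \<Longrightarrow> card (positions j) = m j" and finite_positions [simp]: "finite (positions j)"
  using card_cls by (simp_all add: positions_def)

lemma positions_less: "u \<in> positions j \<Longrightarrow> u < r" by (simp add: positions_def)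

lemma chunk_card:
  assumes e: "finite e" "card e = r" and j: "j < l"
  shows "card (chunk e j) = m j"
proof -
  have "inj_on (elt e) (positions j)" using elt_eq_iff[OF e(1)] e(2) positions_less by (intro inj_onI) auto
  then show ?thesis using j by (simp add: chunk_def card_image card_positions)
qed

lemma Union_chunk:
  assumes e: "finite e" "card e = r"
  shows "(\<Union>j<l. chunk e j) = e"
proof -
  have "(\<Union>j<l. chunk e j) = elt e ` (\<Union>j<l. positions j)" by (auto simp: chunk_def)
  also have "(\<Union>j<l. positions j) = {..<r}" using cls_less by (auto simp: positions_def)
  also have "elt e ` {..<r} = e" using elt_image[OF e(1)] e(2) by simp
  finally show ?thesis .
qed

lemma chunk_inj:
  assumes "finite e" "card e = r" "finite f" "card f = r" "chunk e = chunk f"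
  shows "e = f"
proof -
  have "(\<Union>j<l. chunk e j) = (\<Union>j<l. chunk f j)" by (simp only: assms(5))
  then show ?thesis unfolding Union_chunk[OF assms(1,2)] Union_chunk[OF assms(3,4)] .
qed

lemma chunk_mem: "j < l \<Longrightarrow> y \<in> chunk e j \<longleftrightarrow> (\<exists>u<r. cls u = j \<and> y = elt e u)"
  by (auto simp: chunk_def positions_def)

lemma edge_precedes_imp_precedes:
  assumes "edge_precedes r cls d e f" shows "precedes d (chunk e) (chunk f)"
  unfolding precedes_def
proof (intro allI impI ballI)
  fix j y y' assume j: "j < l" "y \<in> chunk e j" "y' \<in> chunk f j"
  then obtain u v where uv: "u < r" "cls u = j" "y = elt e u" "v < r" "cls v = j" "y' = elt f v"
    using chunk_mem by metis
  then have "if (if cls u = cls v then d (cls u) else u < v) then elt e u < elt f v else elt f v < elt e u"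
    using assms unfolding edge_precedes_def by blast
  then show "if d j then y < y' else y' < y" using uv by simp
qed

lemma edge_precedes_order:
  assumes "edge_precedes r cls d e f \<or> edge_precedes r cls d f e \<or> e = f" and e: "finite e" "card e = r" and uv: "u < v" "v < r" "cls u \<noteq> cls v"
  shows "elt e u < elt f v"
  using assms(1)
proof (elim disjE)
  assume "edge_precedes r cls d e f"
  then have "if (if cls u = cls v then d (cls u) else u < v) then elt e u < elt f v else elt f v < elt e u"
    using uv unfolding edge_precedes_def by (meson less_trans)
  then show ?thesis using uv by simp
next
  assume "edge_precedes r cls d f e"
  then have "if (if cls v = cls u then d (cls v) else v < u) then elt f v < elt e u else elt e u < elt f v"
    using uv unfolding edge_precedes_def by (meson less_trans)
  then show ?thesis using uv by (simp split: if_splits)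
next
  assume "e = f" then show ?thesis using elt_less_iff[OF e(1), of u v] e uv by simp
qed

definition cell_set :: "nat \<Rightarrow> (nat \<Rightarrow> nat) \<times> (nat \<Rightarrow> nat) \<Rightarrow> nat \<Rightarrow> nat set" where
  "cell_set s \<kappa> = (\<lambda>j. {fst \<kappa> j * s..<(snd \<kappa> j + 1) * s})"

text \<open>
  The vertex set \<open>{..<N * s}\<close> is divided into \<open>N\<close> cells of length \<open>s\<close>. For each block, the pair of functions gives the
  first and the last cell of an interval of cells. Intervals of different blocks may share a boundary
  cell, which is why the sum counts the last cell of no interval.
\<close>
definition cells :: "nat \<Rightarrow> ((nat \<Rightarrow> nat) \<times> (nat \<Rightarrow> nat)) set" where
  "cells N = {\<kappa> \<in> PiE {..<l} (\<lambda>_. {..<N}) \<times> PiE {..<l} (\<lambda>_. {..<N}).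
     (\<forall>j<l. fst \<kappa> j \<le> snd \<kappa> j) \<and> (\<Sum>j<l. snd \<kappa> j - fst \<kappa> j) \<le> N}"

lemma finite_cells: "finite (cells N)"
  by (rule finite_subset[of _ "PiE {..<l} (\<lambda>_. {..<N}) \<times> PiE {..<l} (\<lambda>_. {..<N})"])
     (auto simp: cells_def intro!: finite_PiE)

lemma finite_card_subset: "e \<in> subsets k Q \<Longrightarrow> finite e \<and> card e = k"
  unfolding subsets_def using finite_subset[of e "{..<Q}"] by auto

text \<open>
  For each block, take the range of cells met by the chunks of all edges of the clique. Since any
  chunk of an earlier class precedes any chunk of a later one, also for different edges, these ranges overlap at
  most in boundary cells.
\<close>
lemma clique_in_cells:
  assumes C: "C \<subseteq> subsets r (N * s)" "C \<noteq> {}" and N: "0 < N" "0 < s"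
    and rels: "\<And>e f. e \<in> C \<Longrightarrow> f \<in> C \<Longrightarrow> e \<noteq> f \<Longrightarrow> edge_precedes r cls d e f \<or> edge_precedes r cls d f e"
  obtains \<kappa> where "\<kappa> \<in> cells N" "\<And>e. e \<in> C \<Longrightarrow> located (cell_set s \<kappa>) e = Some (chunk e)"
proof -
  have Cf: "finite e" "card e = r" "e \<subseteq> {..<N * s}" if "e \<in> C" for e
    using C(1) that finite_card_subset[of e r "N * s"] by (auto simp: subsets_def)
  have finC: "finite C" using C(1) by (rule finite_subset) simp
  define D where "D j = (\<lambda>y. y div s) ` (\<Union>e\<in>C. chunk e j)" for j
  have chunk_sub: "chunk e j \<subseteq> e" if "e \<in> C" "j < l" for e j
    using Union_chunk[OF Cf(1,2)[OF that(1)]] that(2) by blast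
  have D: "finite (D j)" "D j \<noteq> {}" "D j \<subseteq> {..<N}" if j: "j < l" for j
  proof -
    have "finite (chunk e j)" for e using j by (simp add: chunk_def)
    then show "finite (D j)" unfolding D_def using finC by simp
    obtain e where e: "e \<in> C" using C(2) by auto
    have "card (chunk e j) = m j" using chunk_card[OF Cf(1,2)[OF e] j] .
    then have "chunk e j \<noteq> {}" using m_pos[OF j] by auto
    then show "D j \<noteq> {}" unfolding D_def using e by blast
    show "D j \<subseteq> {..<N}" unfolding D_def
    proof (intro image_subsetI)
      fix y assume "y \<in> (\<Union>e\<in>C. chunk e j)"
      then have "y < N * s" using chunk_sub[OF _ j] Cf(3) by blast
      then show "y div s \<in> {..<N}" by (simp add: less_mult_imp_div_less)
    qed
  qed
  define lo where "lo = (\<lambda>j\<in>{..<l}. Min (D j))"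
  define hi where "hi = (\<lambda>j\<in>{..<l}. Max (D j))"
  have lohi: "lo j \<in> D j" "hi j \<in> D j" "\<And>x. x \<in> D j \<Longrightarrow> lo j \<le> x \<and> x \<le> hi j" if j: "j < l" for j
    using D[OF j] j by (simp_all add: lo_def hi_def)
  have ordered: "hi j \<le> lo j'" if uv: "u < v" "v < r" "cls u \<noteq> cls v" "j = cls u" "j' = cls v" for u v j j'
  proof -
    have j: "j < l" "j' < l" using uv cls_less by auto
    obtain e a where e: "e \<in> C" "a \<in> positions j" "hi j = elt e a div s"
      using lohi(2)[OF j(1)] j(1) by (auto simp: D_def chunk_def)
    obtain f b where f: "f \<in> C" "b \<in> positions j'" "lo j' = elt f b div s"
      using lohi(1)[OF j(2)] j(2) by (auto simp: D_def chunk_def)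
    have ab: "a < r" "b < r" "cls a = j" "cls b = j'" using e f by (auto simp: positions_def)
    have "a < b" using cls_order[OF uv(1-3) ab(1,2)] ab uv by simp
    then have "elt e a < elt f b"
      using edge_precedes_order[of e f a b] rels[of e f] e(1) f(1) Cf[OF e(1)] ab uv by auto
    then show ?thesis unfolding e(3) f(3) by (simp add: div_le_mono)
  qed
  have "(\<Sum>j<l. hi j - lo j) = (\<Sum>j<l. card {lo j..<hi j})" by simp
  also have "\<dots> = card (\<Union>j<l. {lo j..<hi j})"
  proof (rule card_UN_disjoint[symmetric])
    show "\<forall>i\<in>{..<l}. \<forall>j\<in>{..<l}. i \<noteq> j \<longrightarrow> {lo i..<hi i} \<inter> {lo j..<hi j} = {}"
    proof (intro ballI impI)
      fix i j assume ij: "i \<in> {..<l}" "j \<in> {..<l}" "i \<noteq> j"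
      have "positions i \<noteq> {}" "positions j \<noteq> {}" using card_positions[of i] card_positions[of j] m_pos[of i] m_pos[of j] ij by auto
      then obtain u v where uv: "u \<in> positions i" "v \<in> positions j" by auto
      then have c: "u < r" "v < r" "cls u = i" "cls v = j" by (auto simp: positions_def)
      then have "u \<noteq> v" using ij by auto
      then have "hi i \<le> lo j \<or> hi j \<le> lo i"
        using ordered[of u v i j] ordered[of v u j i] c ij by (metis linorder_neqE_nat)
      then show "{lo i..<hi i} \<inter> {lo j..<hi j} = {}" by auto
    qed
  qed auto
  also have "\<dots> \<le> card {..<N}"
  proof (rule card_mono)
    show "(\<Union>j<l. {lo j..<hi j}) \<subseteq> {..<N}"
    proof (rule UN_least)
      fix j assume "j \<in> {..<l}"
      then have "hi j < N" using lohi(2)[of j] D(3)[of j] by auto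
      then show "{lo j..<hi j} \<subseteq> {..<N}" by auto
    qed
  qed simp
  finally have sum: "(\<Sum>j<l. hi j - lo j) \<le> N" by simp
  have "(lo, hi) \<in> cells N"
  proof -
    have "lo j < N \<and> hi j < N \<and> lo j \<le> hi j" if "j < l" for j
      using lohi[OF that] D(3)[OF that] by auto
    then show ?thesis using sum unfolding cells_def by (auto simp: PiE_iff lo_def hi_def)
  qed
  moreover have "located (cell_set s (lo, hi)) e = Some (chunk e)" if e: "e \<in> C" for e
  proof -
    have "chunk e j \<subseteq> cell_set s (lo, hi) j" if j: "j < l" for j
    proof
      fix y assume "y \<in> chunk e j"
      then have "y div s \<in> D j" unfolding D_def using e by blast
      then have "lo j \<le> y div s" "y div s \<le> hi j" using lohi(3)[OF j] by auto
      then have "lo j * s \<le> y" "y < (hi j + 1) * s"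
        using N(2) by (simp only: less_eq_div_iff_mult_less_eq, simp only: div_less_iff_less_mult[symmetric])
      then show "y \<in> cell_set s (lo, hi) j" by (simp add: cell_set_def)
    qed
    then show ?thesis by (simp add: located_def)
  qed
  ultimately show ?thesis using that by blast
qed

definition located_pmf :: "nat \<Rightarrow> (nat \<Rightarrow> nat set) \<Rightarrow> (nat \<Rightarrow> nat set) option pmf" where
  "located_pmf Q A = map_pmf (\<lambda>z. Option.bind z (located A)) (map_pmf Some (pmf_of_set (subsets r Q)))"

lemma sample_set_located_pmf:
  "sample_set n (located_pmf Q A) = map_pmf (\<lambda>N. {Y. \<exists>e\<in>N. located A e = Some Y}) (edge_sample r Q n)"
  unfolding located_pmf_def by (rule sample_set_map_option)

text \<open>
  An edge is the union of its chunks, so each tuple in the support comes from exactly one edge.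
\<close>
lemma located_pmf:
  assumes "r \<le> Q"
  shows "finite (set_pmf (located_pmf Q A))"
    and "e \<in> subsets r Q \<Longrightarrow> located A e = Some Y \<Longrightarrow> pmf (located_pmf Q A) (Some Y) = 1 / (Q choose r)"
    and "Some Y \<in> set_pmf (located_pmf Q A) \<Longrightarrow> \<exists>e\<in>subsets r Q. located A e = Some Y"
proof -
  have ne: "subsets r Q \<noteq> {}" using subsets_nonempty[OF assms] .
  have eq: "located_pmf Q A = map_pmf (located A) (pmf_of_set (subsets r Q))"
    unfolding located_pmf_def by (simp add: map_pmf_comp)
  show "finite (set_pmf (located_pmf Q A))" unfolding eq using ne by simp
  show "Some Y \<in> set_pmf (located_pmf Q A) \<Longrightarrow> \<exists>e\<in>subsets r Q. located A e = Some Y"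
    unfolding eq using ne by auto
  assume e: "e \<in> subsets r Q" "located A e = Some Y"
  have "subsets r Q \<inter> located A -` {Some Y} = {e}"
  proof (intro equalityI subsetI)
    fix f assume f: "f \<in> subsets r Q \<inter> located A -` {Some Y}"
    then have "chunk f = chunk e" using e by (auto simp: located_def split: if_splits)
    then show "f \<in> {e}" using chunk_inj[of f e] finite_card_subset[of f r Q] finite_card_subset[of e r Q] f e by auto
  qed (use e in auto)
  then show "pmf (located_pmf Q A) (Some Y) = 1 / (Q choose r)"
    unfolding eq pmf_map using ne by (simp add: measure_pmf_of_set card_subsets)
qed

lemma locatedD: "located A e = Some Y \<Longrightarrow> Y = chunk e \<and> (\<forall>j<l. chunk e j \<subseteq> A j)"
  unfolding located_def by (simp split: if_splits)

lemma located_block_tuples: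
  assumes "e \<in> subsets r Q" "located A e = Some Y"
  shows "Y \<in> block_tuples A"
proof -
  have e: "finite e" "card e = r" using finite_card_subset[OF assms(1)] by simp_all
  have "Y = chunk e" "\<forall>j<l. chunk e j \<subseteq> A j" using locatedD[OF assms(2)] by simp_all
  then show ?thesis using chunk_card[OF e] unfolding block_tuples_def by (simp add: PiE_iff) (simp add: chunk_def)
qed

text \<open>
  The division of \<open>{..<r * s}\<close> into intervals that is optimal for the block sizes: the numbers
  \<open>y\<close> with \<open>y div s = u\<close> belong to the position \<open>u\<close>, and hence to the class of \<open>u\<close>.
\<close>
definition band :: "nat \<Rightarrow> nat \<Rightarrow> nat set" where
  "band s j = {y. y < r * s \<and> cls (y div s) = j}"

lemma band_card:
  assumes s: "0 < s" and j: "j < l"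
  shows "finite (band s j)" "card (band s j) = s * m j"
proof -
  have "band s j = (\<Union>u\<in>positions j. {u * s..<u * s + s})"
  proof (intro equalityI subsetI)
    fix y assume y: "y \<in> band s j"
    then have "y div s < r" by (auto simp: band_def less_mult_imp_div_less)
    moreover have "y \<in> {y div s * s..<y div s * s + s}"
      unfolding atLeastLessThan_iff using div_mult_mod_eq[of y s] mod_less_divisor[OF s, of y] by linarith
    ultimately show "y \<in> (\<Union>u\<in>positions j. {u * s..<u * s + s})" using y by (auto simp: positions_def band_def)
  next
    fix y assume "y \<in> (\<Union>u\<in>positions j. {u * s..<u * s + s})"
    then obtain u where u: "u < r" "cls u = j" "u * s \<le> y" "y < u * s + s" by (auto simp: positions_def)
    then have "y div s = u" by (intro div_nat_eqI) (auto simp: mult.commute)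
    moreover have "(u + 1) * s \<le> r * s" using u by (intro mult_right_mono) auto
    ultimately show "y \<in> band s j" using u by (simp add: band_def)
  qed
  moreover have "card (\<Union>u\<in>positions j. {u * s..<u * s + s}) = (\<Sum>u\<in>positions j. card {u * s..<u * s + s})"
  proof (rule card_UN_disjoint)
    show "\<forall>u\<in>positions j. \<forall>v\<in>positions j. u \<noteq> v \<longrightarrow> {u * s..<u * s + s} \<inter> {v * s..<v * s + s} = {}"
    proof (intro ballI impI)
      fix u v :: nat assume "u \<noteq> v"
      then consider "u + 1 \<le> v" | "v + 1 \<le> u" by linarith
      then show "{u * s..<u * s + s} \<inter> {v * s..<v * s + s} = {}"
      proof cases
        case 1 from mult_right_mono[OF this, of s] show ?thesis by auto
      next
        case 2 from mult_right_mono[OF this, of s] show ?thesis by auto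
      qed
    qed
  qed auto
  ultimately show "finite (band s j)" "card (band s j) = s * m j" using card_positions[OF j] by simp_all
qed

lemma band_order:
  assumes "x \<in> band s (cls u)" "y \<in> band s (cls v)" "u < v" "v < r" "cls u \<noteq> cls v"
  shows "x < y"
proof -
  have "x div s < r" "y div s < r" "cls (x div s) = cls u" "cls (y div s) = cls v"
    using assms by (auto simp: band_def less_mult_imp_div_less)
  then have "x div s < y div s" using cls_order[OF assms(3-5)] by simp
  then show ?thesis by (meson div_le_mono leD not_le)
qed

text \<open>
  Vertices of different classes are ordered by the bands that contain them; for vertices of the same class this is
  the hypothesis on the chunks.
\<close>
lemma precedes_imp_edge_precedes:
  assumes e: "located (band s) e = Some (chunk e)" and f: "located (band s) f = Some (chunk f)"
    and precedes: "precedes d (chunk e) (chunk f)"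
  shows "edge_precedes r cls d e f"
  unfolding edge_precedes_def
proof (intro allI impI)
  fix u v assume uv: "u < r" "v < r"
  have mem: "elt e u \<in> chunk e (cls u)" "elt f v \<in> chunk f (cls v)"
    using uv cls_less by (auto simp: chunk_def positions_def)
  have "chunk e (cls u) \<subseteq> band s (cls u)" "chunk f (cls v) \<subseteq> band s (cls v)"
    using conjunct2[OF locatedD[OF e]] conjunct2[OF locatedD[OF f]] cls_less[OF uv(1)] cls_less[OF uv(2)]
    by simp_all
  note band = this(1)[THEN subsetD, OF mem(1)] this(2)[THEN subsetD, OF mem(2)]
  show "if if cls u = cls v then d (cls u) else u < v then elt e u < elt f v else elt f v < elt e u"
  proof (cases "cls u = cls v")
    case True
    have "elt f v \<in> chunk f (cls u)" unfolding True by (rule mem(2))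
    with mem(1) have "if d (cls u) then elt e u < elt f v else elt f v < elt e u"
      using precedes cls_less[OF uv(1)] unfolding precedes_def by blast
    then show ?thesis using True by simp
  next
    case False
    then have "u \<noteq> v" by auto
    then consider "u < v" | "v < u" by linarith
    then show ?thesis
    proof cases
      case 1 then show ?thesis using band_order[OF band 1 uv(2) False] False by simp
    next
      case 2 then show ?thesis using band_order[OF band(2,1) 2 uv(1)] False by auto
    qed
  qed
qed

text \<open>
  The edge is the union of the given chunks. As the bands are ordered like the classes of positions,
  the map \<open>g\<close> that sends a position to the element of equal rank in the chunk of its class is increasing, so it is the
  enumeration of the edge.
\<close>
lemma block_tuples_band_located:
  assumes s: "0 < s" and Y: "Y \<in> block_tuples (band s)"
  obtains e where "e \<in> subsets r (r * s)" "located (band s) e = Some Y"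
proof -
  define o' where "o' u = card {v. v < u \<and> cls v = cls u}" for u
  define g where "g u = elt (Y (cls u)) (o' u)" for u
  have Yj: "finite (Y j)" "card (Y j) = m j" "Y j \<subseteq> band s j" if "j < l" for j using block_tuplesD[OF Y that] by auto
  have o_less: "o' u < m (cls u)" if u: "u < r" for u
  proof -
    have "{v. v < u \<and> cls v = cls u} \<subset> positions (cls u)" using u by (auto simp: positions_def)
    then have "o' u < card (positions (cls u))" unfolding o'_def by (intro psubset_card_mono) auto
    then show ?thesis using card_positions cls_less u by simp
  qed
  have o_mono: "o' u < o' v" if "u < v" "cls u = cls v" for u v
  proof -
    have "{w. w < u \<and> cls w = cls u} \<subset> {w. w < v \<and> cls w = cls v}" using that by auto
    then show ?thesis unfolding o'_def by (intro psubset_card_mono) auto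
  qed
  have g_mem: "g u \<in> Y (cls u)" if u: "u < r" for u
    unfolding g_def using Yj[OF cls_less[OF u]] o_less[OF u] by (intro elt_mem) auto
  have g_mono: "strict_mono_on {..<r} g"
  proof (rule strict_mono_onI)
    fix u v assume uv: "u \<in> {..<r}" "v \<in> {..<r}" "u < v"
    show "g u < g v"
    proof (cases "cls u = cls v")
      case True
      have l: "cls u < l" using uv cls_less by simp
      have "o' u < o' v" "o' u < m (cls u)" "o' v < m (cls u)" using o_mono[of u v] o_less[of u] o_less[of v] True uv by auto
      then have "elt (Y (cls u)) (o' u) < elt (Y (cls u)) (o' v)" using elt_less_iff[OF Yj(1)[OF l], of "o' u" "o' v"] Yj(2)[OF l] by simp
      then show ?thesis unfolding g_def using True by simp
    next
      case False
      then show ?thesis using band_order[of "g u" s u "g v" v] g_mem[of u] g_mem[of v] Yj(3) cls_less uv by blast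
    qed
  qed
  define e where "e = g ` {..<r}"
  have inj: "inj_on g {..<r}" using g_mono by (rule strict_mono_on_imp_inj_on)
  have e: "finite e" "card e = r" by (simp_all add: e_def card_image[OF inj])
  have "elt e u = g u" if "u < r" for u
  proof -
    have "elt e u = g (elt {..<r} u)" unfolding e_def by (rule elt_image_strict_mono[OF _ g_mono]) (use that in auto)
    moreover have "elt {..<r} u = u" using that by (simp add: elt_def lessThan_atLeast0)
    ultimately show ?thesis by simp
  qed
  then have sub: "chunk e j \<subseteq> Y j" if "j < l" for j
    using that g_mem by (auto simp: chunk_def positions_def)
  have eq: "chunk e = Y"
  proof
    fix j show "chunk e j = Y j"
    proof (cases "j < l")
      case True
      then show ?thesis using sub[OF True] Yj[OF True] chunk_card[OF e True] by (intro card_subset_eq) auto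
    next
      case False
      then show ?thesis using Y by (auto simp: chunk_def block_tuples_def PiE_iff extensional_def)
    qed
  qed
  have "e \<subseteq> {..<r * s}"
  proof
    fix y assume "y \<in> e"
    then obtain u where u: "u < r" "y = g u" by (auto simp: e_def)
    then have "y \<in> band s (cls u)" using g_mem[OF u(1)] Yj(3)[OF cls_less[OF u(1)]] by blast
    then show "y \<in> {..<r * s}" by (simp add: band_def)
  qed
  then have "e \<in> subsets r (r * s)" using e by (simp add: subsets_def)
  moreover have "located (band s) e = Some Y" unfolding located_def eq using Yj(3) by auto
  ultimately show ?thesis using that by blast
qed

end

section \<open>Convergence of the largest clique\<close>

lemma const_div_powr_tendsto_0: "0 < a \<Longrightarrow> (\<lambda>n. B / real n powr a) \<longlonglongrightarrow> 0"
  by real_asymp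

lemma eventually_le_const_mult_powr: "0 < a \<Longrightarrow> 0 < e \<Longrightarrow> \<forall>\<^sub>F n in sequentially. C \<le> e * real n powr a"
  by real_asymp

context block_pattern
begin

text \<open>
  By the inequality between weighted arithmetic and geometric means, the product of the interval lengths is
  largest if they are proportional to the block sizes. Rounding to cells increases the total length by
  at most the factor \<open>1 + l / N\<close>.
\<close>
lemma inverse_tuple_weight_cell_set_le:
  assumes N: "0 < N" and s: "0 < s" and \<kappa>: "\<kappa> \<in> cells N"
  shows "1 / tuple_weight (cell_set s \<kappa>) \<le> real (N * s) ^ r * (1 + l / N) ^ r * (type_probability / fact r)"
proof -
  let ?t = "\<lambda>j. real (snd \<kappa> j - fst \<kappa> j) + 1"
  have le: "fst \<kappa> j \<le> snd \<kappa> j" if "j < l" for j using \<kappa> that by (auto simp: cells_def)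
  have card: "real (card (cell_set s \<kappa> j)) = ?t j * s" if "j < l" for j
  proof -
    have "card (cell_set s \<kappa> j) = (snd \<kappa> j + 1 - fst \<kappa> j) * s"
      by (simp add: cell_set_def diff_mult_distrib)
    also have "snd \<kappa> j + 1 - fst \<kappa> j = snd \<kappa> j - fst \<kappa> j + 1" using le[OF that] by simp
    finally show ?thesis by (simp add: distrib_right)
  qed
  have "1 / tuple_weight (cell_set s \<kappa>) = (\<Prod>j<l. real (card (cell_set s \<kappa> j)) ^ m j / fact (m j))"
    unfolding tuple_weight_def prod_dividef[symmetric] by (simp add: prod_dividef)
  also have "\<dots> = (\<Prod>j<l. ?t j ^ m j * (s ^ m j / fact (m j)))"
    by (rule prod.cong[OF refl]) (simp add: card power_mult_distrib)
  also have "\<dots> = (\<Prod>j<l. ?t j ^ m j) * (\<Prod>j<l. s ^ m j / fact (m j))" by (rule prod.distrib)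
  also have "\<dots> \<le> ((\<Sum>j<l. ?t j) ^ r * (\<Prod>j<l. (m j / real r) ^ m j)) * (\<Prod>j<l. s ^ m j / fact (m j))"
    using weighted_AM_GM[of l m ?t] m_pos l_pos unfolding r_def[symmetric]
    by (intro mult_right_mono prod_nonneg) auto
  also have "\<dots> \<le> ((real N + l) ^ r * (\<Prod>j<l. (m j / real r) ^ m j)) * (\<Prod>j<l. s ^ m j / fact (m j))"
  proof (intro mult_right_mono power_mono)
    have "(\<Sum>j<l. snd \<kappa> j - fst \<kappa> j) \<le> N" using \<kappa> by (simp add: cells_def)
    then have "real (\<Sum>j<l. snd \<kappa> j - fst \<kappa> j) \<le> real N" by (simp only: of_nat_le_iff)
    then show "(\<Sum>j<l. ?t j) \<le> real N + l" by (simp add: sum.distrib)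
  qed (auto intro!: prod_nonneg sum_nonneg)
  also have "\<dots> = (real N + l) ^ r * s ^ r * (\<Prod>j<l. (m j / real r) ^ m j / fact (m j))"
    by (simp add: prod_dividef power_sum[symmetric] r_def[symmetric])
  also have "(\<Prod>j<l. (m j / real r) ^ m j / fact (m j)) = type_probability / fact r" by (simp add: type_probability_def)
  also have "(real N + l) ^ r * s ^ r = real (N * s) ^ r * (1 + l / N) ^ r"
  proof -
    have "real N + l = N * (1 + l / N)" using N by (simp add: distrib_left)
    then have "(real N + l) ^ r * s ^ r = (N * (1 + l / N)) ^ r * s ^ r" by simp
    also have "\<dots> = real (N * s) ^ r * (1 + l / N) ^ r" by (simp add: power_mult_distrib)
    finally show ?thesis .
  qed
  finally show ?thesis .
qed

lemma clique_number_le_cells: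
  assumes pair_iso: "\<And>e f. finite e \<Longrightarrow> card e = r \<Longrightarrow> finite f \<Longrightarrow> card f = r \<Longrightarrow>
      order_isomorphic {e, f} P \<longleftrightarrow> edge_precedes r cls d e f \<or> edge_precedes r cls d f e"
    and M: "M \<subseteq> subsets r (N * s)" and N: "0 < N" "0 < s" and pos: "0 < clique_number (pair_iso P) M"
  obtains \<kappa> where "\<kappa> \<in> cells N"
    "clique_number (pair_iso P) M \<le> clique_number (comparable d) {Y. \<exists>e\<in>M. located (cell_set s \<kappa>) e = Some Y}"
proof -
  have finM: "finite M" using M by (rule finite_subset) simp
  obtain C where C: "C \<subseteq> M" "pairwise (pair_iso P) C" "card C = clique_number (pair_iso P) M"
    by (rule clique_number_attained[OF finM])
  have Cf: "finite e" "card e = r" if "e \<in> C" for e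
    using finite_card_subset[of e r "N * s"] C(1) M that by auto
  have rels: "edge_precedes r cls d e f \<or> edge_precedes r cls d f e" if "e \<in> C" "f \<in> C" "e \<noteq> f" for e f
    using C(2) that pair_iso[OF Cf[OF that(1)] Cf[OF that(2)]] unfolding pairwise_def pair_iso_def by blast
  have "C \<noteq> {}" using C(3) pos by auto
  moreover have "C \<subseteq> subsets r (N * s)" using C(1) M by (rule subset_trans)
  ultimately obtain \<kappa> where \<kappa>: "\<kappa> \<in> cells N" "\<And>e. e \<in> C \<Longrightarrow> located (cell_set s \<kappa>) e = Some (chunk e)"
    using clique_in_cells[of C N s] N rels by metis
  let ?F = "{Y. \<exists>e\<in>M. located (cell_set s \<kappa>) e = Some Y}"
  have "inj_on chunk C" by (rule inj_onI) (rule chunk_inj[OF Cf Cf])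
  moreover have "pairwise (comparable d) (chunk ` C)"
  proof (rule pairwiseI)
    fix x y assume "x \<in> chunk ` C" "y \<in> chunk ` C" "x \<noteq> y"
    then obtain e f where ef: "e \<in> C" "f \<in> C" "x = chunk e" "y = chunk f" "e \<noteq> f" by auto
    then show "comparable d x y" using rels[OF ef(1,2,5)] edge_precedes_imp_precedes unfolding comparable_def by blast
  qed
  moreover have "finite ?F"
    by (rule finite_subset[of _ "(\<lambda>e. the (located (cell_set s \<kappa>) e)) ` M"]) (use finM in force)+
  moreover have "chunk ` C \<subseteq> ?F" using \<kappa>(2) C(1) by blast
  ultimately have "card C \<le> clique_number (comparable d) ?F"
    using card_le_clique_number[of ?F "chunk ` C" "comparable d"] card_image[of chunk C] by simp
  then show ?thesis using that[OF \<kappa>(1)] C(3) by simp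
qed

text \<open>
  The number of ranges of cells is bounded in terms of \<open>N\<close> alone, so each of them can be treated separately by
  Chebyshev's inequality. First \<open>N\<close> is chosen large in terms of \<open>\<epsilon>\<close>, then \<open>n\<close>, and finally the cell length \<open>s\<close> in
  terms of \<open>n\<close>.
\<close>
lemma upper_tail:
  assumes P: "r_pattern r P"
    and pair_iso: "\<And>e f. finite e \<Longrightarrow> card e = r \<Longrightarrow> finite f \<Longrightarrow> card f = r \<Longrightarrow>
      order_isomorphic {e, f} P \<longleftrightarrow> edge_precedes r cls d e f \<or> edge_precedes r cls d f e"
    and eps: "0 < \<epsilon>"
  defines "b \<equiv> chain_constant * type_probability powr (1 / r)"
  shows "\<exists>B. \<forall>\<^sub>F n in sequentially.
    measure_pmf.prob (matching_pmf r n) {M. (b + \<epsilon>) * real n powr (1 / r) < real (largest_clique r P M)} \<le>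
    B / real n powr (1 / r)"
proof -
  have b0: "0 < b" unfolding b_def using chain_constant_pos type_probability_pos by simp
  have "(\<lambda>N. (chain_constant + 1 / real N) * type_probability powr (1 / r) * (1 + real l / N) * (1 + 1 / N)) \<longlonglongrightarrow> (chain_constant + 0) * type_probability powr (1 / r) * (1 + 0) * (1 + 0)"
    by (intro tendsto_intros lim_const_over_n)
  then have "\<forall>\<^sub>F N in sequentially. (chain_constant + 1 / real N) * type_probability powr (1 / r) * (1 + real l / N) * (1 + 1 / N) < b + \<epsilon> / 3"
    by (rule order_tendstoD) (use eps in \<open>simp add: b_def\<close>)
  then have "\<exists>N. (chain_constant + 1 / real N) * type_probability powr (1 / r) * (1 + real l / N) * (1 + 1 / N) < b + \<epsilon> / 3 \<and> 0 < N"
    using eventually_gt_at_top[of "0::nat"] eventually_conj eventually_happens'[OF sequentially_bot] by blast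
  then obtain N where N: "(chain_constant + 1 / real N) * type_probability powr (1 / r) * (1 + real l / N) * (1 + 1 / N) < b + \<epsilon> / 3" "0 < N" by blast
  have "0 < 1 / real N" using N by simp
  then obtain C where C: "\<And>n d A \<mu> \<rho>. \<lbrakk>\<And>j. j < l \<Longrightarrow> finite (A j); finite (set_pmf \<mu>); 0 < \<rho>;
      \<And>Y. Some Y \<in> set_pmf \<mu> \<Longrightarrow> Y \<in> block_tuples A \<and> pmf \<mu> (Some Y) = \<rho>\<rbrakk> \<Longrightarrow>
    expected_clique (comparable d) n \<mu> \<le> (chain_constant + 1 / real N) * (n * \<rho> / tuple_weight A) powr (1 / r) + C"
    using expected_clique_uniform_le[of "1 / real N"] by metis
  have ratio: "\<forall>\<^sub>F Q in sequentially. real Q ^ r / (fact r * real (Q choose r)) < (1 + 1 / N) ^ r"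
  proof -
    have "(\<lambda>Q. 1 / (fact r * (real (Q choose r) / real Q ^ r))) \<longlonglongrightarrow> 1 / (fact r * (1 / fact r))"
      by (intro tendsto_intros binomial_power_limit) auto
    then have "\<forall>\<^sub>F Q in sequentially. 1 / (fact r * (real (Q choose r) / real Q ^ r)) < (1 + 1 / N) ^ r"
      by (rule order_tendstoD) (use N r_pos in \<open>simp add: one_less_power\<close>)
    then show ?thesis by simp
  qed
  define B where "B = 2 * (card (cells N) * ((b + \<epsilon> / 2) / (\<epsilon> / 2)\<^sup>2))"
  have "\<forall>\<^sub>F n in sequentially. C \<le> \<epsilon> / 6 * real n powr (1 / r)" using eps r_pos by (intro eventually_le_const_mult_powr) auto
  then have "\<forall>\<^sub>F n in sequentially.
    measure_pmf.prob (matching_pmf r n) {M. (b + \<epsilon>) * real n powr (1 / r) < real (largest_clique r P M)} \<le>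
    B / real n powr (1 / r)"
    using eventually_gt_at_top[of 0]
  proof eventually_elim
    case (elim n)
    let ?x = "real n powr (1 / r)"
    have x0: "0 < ?x" using elim(2) by simp
    have r1: "1 \<le> r" using r_pos by simp
    have Ns: "filterlim (\<lambda>s. N * s) at_top sequentially" using N(2) by real_asymp
    have evQ: "\<forall>\<^sub>F Q in sequentially. (\<forall>\<Phi>. measure_pmf.prob (matching_pmf r n) {M. \<Phi> (largest_clique r P M)} \<le>
        2 * measure_pmf.prob (edge_sample r Q n) {N. \<Phi> (clique_number (pair_iso P) N)}) \<and>
        real Q ^ r / (fact r * real (Q choose r)) < (1 + 1 / N) ^ r \<and> r \<le> Q"
      using matching_prob_le[OF r1 P, of n] ratio eventually_ge_at_top[of r] by eventually_elim simp
    have "\<forall>\<^sub>F s in sequentially. ((\<forall>\<Phi>. measure_pmf.prob (matching_pmf r n) {M. \<Phi> (largest_clique r P M)} \<le>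
        2 * measure_pmf.prob (edge_sample r (N * s) n) {N. \<Phi> (clique_number (pair_iso P) N)}) \<and>
        real (N * s) ^ r / (fact r * real ((N * s) choose r)) < (1 + 1 / N) ^ r \<and> r \<le> N * s)"
      by (rule eventually_compose_filterlim[OF evQ Ns])
    then obtain s where s: "\<And>\<Phi>. measure_pmf.prob (matching_pmf r n) {M. \<Phi> (largest_clique r P M)} \<le>
        2 * measure_pmf.prob (edge_sample r (N * s) n) {N. \<Phi> (clique_number (pair_iso P) N)}"
        "real (N * s) ^ r / (fact r * real ((N * s) choose r)) < (1 + 1 / N) ^ r" "r \<le> N * s"
      using eventually_happens'[OF sequentially_bot] by blast
    have s0: "0 < s" using s(3) r_pos by (cases s) auto
    let ?Q = "N * s"
    let ?E = "map_pmf Some (pmf_of_set (subsets r ?Q))"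
    let ?F = "\<lambda>\<kappa> M. {Y. \<exists>e\<in>M. located (cell_set s \<kappa>) e = Some Y}"
    have Qr: "0 < real (?Q choose r)" using s(3) by simp
    have expected_clique: "expected_clique (comparable d) n (located_pmf ?Q (cell_set s \<kappa>)) \<le> (b + \<epsilon> / 2) * ?x" if \<kappa>: "\<kappa> \<in> cells N" for \<kappa>
    proof -
      let ?A = "cell_set s \<kappa>"
      have "expected_clique (comparable d) n (located_pmf ?Q ?A) \<le> (chain_constant + 1 / real N) * (n * (1 / (?Q choose r)) / tuple_weight ?A) powr (1 / r) + C"
      proof (rule C)
        show "finite (?A j)" for j by (simp add: cell_set_def)
        show "finite (set_pmf (located_pmf ?Q ?A))" by (rule located_pmf(1)[OF s(3)])
        show "0 < 1 / real (?Q choose r)" using Qr by simp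
        fix Y assume "Some Y \<in> set_pmf (located_pmf ?Q ?A)"
        then obtain e where e: "e \<in> subsets r ?Q" "located ?A e = Some Y" using located_pmf(3)[OF s(3)] by blast
        then show "Y \<in> block_tuples ?A \<and> pmf (located_pmf ?Q ?A) (Some Y) = 1 / real (?Q choose r)"
          using located_block_tuples[OF e] located_pmf(2)[OF s(3) e] by simp
      qed
      also have "n * (1 / (?Q choose r)) / tuple_weight ?A \<le> n * type_probability * ((1 + l / N) * (1 + 1 / N)) ^ r"
      proof -
        have "n * (1 / (?Q choose r)) / tuple_weight ?A = n / (?Q choose r) * (1 / tuple_weight ?A)" by simp
        also have "\<dots> \<le> n / (?Q choose r) * (real ?Q ^ r * (1 + l / N) ^ r * (type_probability / fact r))"
          by (intro mult_left_mono inverse_tuple_weight_cell_set_le N s0 \<kappa>) auto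
        also have "\<dots> = n * type_probability * (1 + l / N) ^ r * (real ?Q ^ r / (fact r * real (?Q choose r)))" by (simp add: mult_ac)
        also have "\<dots> \<le> n * type_probability * (1 + l / N) ^ r * (1 + 1 / N) ^ r"
          using s(2) type_probability_pos by (intro mult_left_mono) auto
        finally show ?thesis by (simp add: power_mult_distrib mult.assoc)
      qed
      then have "(chain_constant + 1 / real N) * (n * (1 / (?Q choose r)) / tuple_weight ?A) powr (1 / r) + C \<le>
          (chain_constant + 1 / real N) * (n * type_probability * ((1 + l / N) * (1 + 1 / N)) ^ r) powr (1 / r) + C"
        using chain_constant_pos tuple_weight_nonneg[of ?A] by (intro add_right_mono mult_left_mono powr_mono2) auto
      also have "(n * type_probability * ((1 + l / N) * (1 + 1 / N)) ^ r) powr (1 / r) = ?x * type_probability powr (1 / r) * ((1 + l / N) * (1 + 1 / N))"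
      proof -
        define z where "z = (1 + l / N) * (1 + 1 / real N)"
        have "0 < z" unfolding z_def using N by (intro mult_pos_pos add_pos_nonneg) auto
        then have "(z ^ r) powr (1 / r) = z" using r_pos by (simp add: powr_realpow[symmetric] powr_powr)
        then show ?thesis unfolding z_def[symmetric] using type_probability_pos \<open>0 < z\<close> by (simp add: powr_mult)
      qed
      also have "(chain_constant + 1 / real N) * (?x * type_probability powr (1 / r) * ((1 + l / N) * (1 + 1 / N))) =
          ((chain_constant + 1 / real N) * type_probability powr (1 / r) * (1 + real l / N) * (1 + 1 / N)) * ?x" by (simp only: mult_ac)
      also have "\<dots> \<le> (b + \<epsilon> / 3) * ?x" using N(1) x0 by (intro mult_right_mono) auto
      also have "(b + \<epsilon> / 3) * ?x + C \<le> (b + \<epsilon> / 2) * ?x" using elim(1) by (simp add: algebra_simps)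
      finally show ?thesis by simp
    qed
    have "measure_pmf.prob (matching_pmf r n) {M. (b + \<epsilon>) * ?x < real (largest_clique r P M)} \<le>
        2 * measure_pmf.prob (sample_set n ?E) {M. (b + \<epsilon>) * ?x < real (clique_number (pair_iso P) M)}"
      by (rule s(1))
    also have "measure_pmf.prob (sample_set n ?E) {M. (b + \<epsilon>) * ?x < real (clique_number (pair_iso P) M)} \<le>
        measure_pmf.prob (sample_set n ?E) (\<Union>\<kappa>\<in>cells N. {M. (b + \<epsilon>) * ?x < real (clique_number (comparable d) (?F \<kappa> M))})"
    proof (rule measure_pmf.finite_measure_mono_AE)
      show "AE M in sample_set n ?E. M \<in> {M. (b + \<epsilon>) * ?x < real (clique_number (pair_iso P) M)} \<longrightarrow>
          M \<in> (\<Union>\<kappa>\<in>cells N. {M. (b + \<epsilon>) * ?x < real (clique_number (comparable d) (?F \<kappa> M))})"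
      proof (rule AE_pmfI, rule impI)
        fix M assume M: "M \<in> set_pmf (sample_set n ?E)" "M \<in> {M. (b + \<epsilon>) * ?x < real (clique_number (pair_iso P) M)}"
        have "Some ` M \<subseteq> set_pmf ?E" using set_pmf_sample_set[OF M(1)] by simp
        then have sub: "M \<subseteq> subsets r ?Q" using subsets_nonempty[OF s(3)] by auto
        have "0 < (b + \<epsilon>) * ?x" using b0 eps x0 by simp
        then have "0 < real (clique_number (pair_iso P) M)" using M(2) by simp
        then have pos: "0 < clique_number (pair_iso P) M" by simp
        obtain \<kappa> where "\<kappa> \<in> cells N" "clique_number (pair_iso P) M \<le> clique_number (comparable d) (?F \<kappa> M)"
          using clique_number_le_cells[OF pair_iso sub N(2) s0 pos] by blast
        then show "M \<in> (\<Union>\<kappa>\<in>cells N. {M. (b + \<epsilon>) * ?x < real (clique_number (comparable d) (?F \<kappa> M))})"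
          using M(2) by force
      qed
    qed simp
    also have "\<dots> \<le> (\<Sum>\<kappa>\<in>cells N. measure_pmf.prob (sample_set n ?E) {M. (b + \<epsilon>) * ?x < real (clique_number (comparable d) (?F \<kappa> M))})"
      by (intro measure_pmf.finite_measure_subadditive_finite finite_cells) auto
    also have "\<dots> \<le> (\<Sum>\<kappa>\<in>cells N. ((b + \<epsilon> / 2) / (\<epsilon> / 2)\<^sup>2) / ?x)"
    proof (rule sum_mono)
      fix \<kappa> assume \<kappa>: "\<kappa> \<in> cells N"
      have split: "(b + \<epsilon>) * ?x = (b + \<epsilon> / 2) * ?x + \<epsilon> / 2 * ?x" by (simp add: field_simps)
      have "measure_pmf.prob (sample_set n ?E) {M. (b + \<epsilon>) * ?x < real (clique_number (comparable d) (?F \<kappa> M))} =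
          measure_pmf.prob (sample_set n (located_pmf ?Q (cell_set s \<kappa>))) {A. (b + \<epsilon> / 2) * ?x + \<epsilon> / 2 * ?x < real (clique_number (comparable d) A)}"
        unfolding sample_set_located_pmf measure_map_pmf split by (simp add: vimage_def)
      also have "\<dots> \<le> ((b + \<epsilon> / 2) * ?x) / (\<epsilon> / 2 * ?x)\<^sup>2"
        using x0 eps by (intro clique_number_upper_deviation located_pmf(1)[OF s(3)] expected_clique[OF \<kappa>]) auto
      also have "\<dots> = ((b + \<epsilon> / 2) / (\<epsilon> / 2)\<^sup>2) / ?x"
      proof -
        have "(a * x) / (e * x)\<^sup>2 = (a / e\<^sup>2) / x" if "0 < x" for a e x :: real
          using that by (simp add: power2_eq_square)
        then show ?thesis using x0 by blast
      qed
      finally show "measure_pmf.prob (sample_set n ?E) {M. (b + \<epsilon>) * ?x < real (clique_number (comparable d) (?F \<kappa> M))} \<le> ((b + \<epsilon> / 2) / (\<epsilon> / 2)\<^sup>2) / ?x" .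
    qed
    finally show ?case unfolding B_def by simp
  qed
  then show ?thesis by blast
qed

text \<open>
  The left hand side equals \<open>r! / Q ^ r\<close> with \<open>Q = r * s\<close>.
\<close>
lemma type_probability_tuple_weight_band_le:
  assumes s: "0 < s" and r: "r \<le> r * s"
  shows "type_probability * tuple_weight (band s) \<le> 1 / real ((r * s) choose r)"
proof -
  have "type_probability * tuple_weight (band s) = fact r * ((\<Prod>j<l. (m j / real r) ^ m j / fact (m j)) * (\<Prod>j<l. fact (m j) / real (s * m j) ^ m j))"
    unfolding type_probability_def tuple_weight_def using band_card(2)[OF s] by simp
  also have "(\<Prod>j<l. (m j / real r) ^ m j / fact (m j)) * (\<Prod>j<l. fact (m j) / real (s * m j) ^ m j) = (\<Prod>j<l. 1 / real (r * s) ^ m j)"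
    unfolding prod.distrib[symmetric]
  proof (rule prod.cong[OF refl])
    fix j assume "j \<in> {..<l}"
    then have "0 < m j" using m_pos by simp
    then show "(m j / real r) ^ m j / fact (m j) * (fact (m j) / real (s * m j) ^ m j) = 1 / real (r * s) ^ m j"
      by (simp add: power_divide power_mult_distrib)
  qed
  also have "(\<Prod>j<l. 1 / real (r * s) ^ m j) = 1 / real (r * s) ^ r"
    by (simp add: prod_dividef power_sum[symmetric] r_def[symmetric] del: of_nat_mult)
  finally have e: "type_probability * tuple_weight (band s) = fact r / real (r * s) ^ r" by simp
  have "real (((r * s) choose r) * fact r) \<le> real ((r * s) ^ r)"
    using binomial_fact_pow[of "r * s" r] by (simp only: of_nat_le_iff)
  then have "real ((r * s) choose r) * fact r \<le> real (r * s) ^ r" by simp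
  moreover have "0 < real ((r * s) choose r)" using r by simp
  moreover have "0 < real (r * s) ^ r" using r_pos s by simp
  ultimately show ?thesis unfolding e by (simp add: pos_divide_le_eq pos_le_divide_eq mult.commute del: of_nat_mult)
qed

text \<open>
  Among the edges whose chunks lie in their bands, a chain of tuples is a \<open>P\<close>-clique.
\<close>
lemma lower_tail:
  assumes P: "r_pattern r P"
    and pair_iso: "\<And>e f. finite e \<Longrightarrow> card e = r \<Longrightarrow> finite f \<Longrightarrow> card f = r \<Longrightarrow>
      order_isomorphic {e, f} P \<longleftrightarrow> edge_precedes r cls d e f \<or> edge_precedes r cls d f e"
    and eps: "0 < \<epsilon>" 
  defines "b \<equiv> chain_constant * type_probability powr (1 / r)"
  assumes eps_b: "\<epsilon> \<le> b"
  shows "\<exists>B. \<forall>\<^sub>F n in sequentially.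
    measure_pmf.prob (matching_pmf r n) {M. real (largest_clique r P M) < (b - \<epsilon>) * real n powr (1 / r)} \<le>
    B / real n powr (1 / r)"
proof -
  have b0: "0 < b" unfolding b_def using chain_constant_pos type_probability_pos by simp
  (* This choice leaves room for a relative deviation \<theta> between b - \<epsilon> and b - \<epsilon> / 2. *)
  define \<theta> where "\<theta> = \<epsilon> / (2 * b)"
  have th: "0 < \<theta>" "\<theta> < 1" using eps eps_b b0 by (simp_all add: \<theta>_def)
  have b': "0 < b - \<epsilon> / 2" using eps eps_b by simp
  have th': "b - \<epsilon> \<le> (1 - \<theta>) * (b - \<epsilon> / 2)"
  proof -
    have "(1 - \<theta>) * (b - \<epsilon> / 2) = b - \<epsilon> / 2 - \<theta> * b + \<theta> * \<epsilon> / 2" by (simp add: field_simps)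
    moreover have "\<theta> * b = \<epsilon> / 2" using b0 by (simp add: \<theta>_def)
    moreover have "0 \<le> \<theta> * \<epsilon>" using th eps by simp
    ultimately show ?thesis by simp
  qed
  define \<epsilon>1 where "\<epsilon>1 = (\<epsilon> / 2) / type_probability powr (1 / r)"
  have e1: "0 < \<epsilon>1" "(chain_constant - \<epsilon>1) * type_probability powr (1 / r) = b - \<epsilon> / 2"
    using eps type_probability_pos by (simp_all add: \<epsilon>1_def b_def left_diff_distrib)
  define B where "B = 2 * (1 / (\<theta>\<^sup>2 * (b - \<epsilon> / 2)))"
  from expected_clique_uniform_ge[OF type_probability_pos type_probability_le_1 e1(1)] eventually_gt_at_top[of 0]
  have "\<forall>\<^sub>F n in sequentially.
    measure_pmf.prob (matching_pmf r n) {M. real (largest_clique r P M) < (b - \<epsilon>) * real n powr (1 / r)} \<le>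
    B / real n powr (1 / r)"
  proof eventually_elim
    case (elim n)
    let ?x = "real n powr (1 / r)"
    have x0: "0 < ?x" using elim(2) by simp
    have r1: "1 \<le> r" using r_pos by simp
    have "\<forall>\<^sub>F Q in sequentially. (\<forall>\<Phi>. measure_pmf.prob (matching_pmf r n) {M. \<Phi> (largest_clique r P M)} \<le>
        2 * measure_pmf.prob (edge_sample r Q n) {N. \<Phi> (clique_number (pair_iso P) N)}) \<and> r \<le> Q"
      using matching_prob_le[OF r1 P, of n] eventually_ge_at_top[of r] by eventually_elim simp
    then obtain Q0 where Q0: "\<And>Q. Q0 \<le> Q \<Longrightarrow> (\<forall>\<Phi>. measure_pmf.prob (matching_pmf r n) {M. \<Phi> (largest_clique r P M)} \<le>
        2 * measure_pmf.prob (edge_sample r Q n) {N. \<Phi> (clique_number (pair_iso P) N)}) \<and> r \<le> Q"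
      unfolding eventually_sequentially by blast
    obtain s where s: "Suc Q0 \<le> s" and expected_clique_ge: "\<And>d A \<mu>. \<lbrakk>\<forall>j<l. finite (A j) \<and> card (A j) = s * m j; finite (set_pmf \<mu>);
        \<forall>Y\<in>block_tuples A. type_probability * tuple_weight A \<le> pmf \<mu> (Some Y)\<rbrakk> \<Longrightarrow> (chain_constant - \<epsilon>1) * (n * type_probability) powr (1 / r) \<le> expected_clique (comparable d) n \<mu>"
      using elim(1) by metis
    let ?Q = "r * s"
    have s0: "0 < s" using s by simp
    have "s \<le> ?Q" using r_pos by simp
    then have Q: "Q0 \<le> ?Q" using s by linarith
    have rQ: "r \<le> ?Q" using Q0[OF Q] by simp
    let ?E = "map_pmf Some (pmf_of_set (subsets r ?Q))"
    let ?F = "\<lambda>M. {Y. \<exists>e\<in>M. located (band s) e = Some Y}"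
    have "(chain_constant - \<epsilon>1) * (n * type_probability) powr (1 / r) \<le> expected_clique (comparable d) n (located_pmf ?Q (band s))"
    proof (rule expected_clique_ge)
      show "\<forall>j<l. finite (band s j) \<and> card (band s j) = s * m j" using band_card[OF s0] by simp
      show "finite (set_pmf (located_pmf ?Q (band s)))" by (rule located_pmf(1)[OF rQ])
      show "\<forall>Y\<in>block_tuples (band s). type_probability * tuple_weight (band s) \<le> pmf (located_pmf ?Q (band s)) (Some Y)"
      proof
        fix Y assume "Y \<in> block_tuples (band s)"
        then obtain e where e: "e \<in> subsets r ?Q" "located (band s) e = Some Y" by (rule block_tuples_band_located[OF s0])
        show "type_probability * tuple_weight (band s) \<le> pmf (located_pmf ?Q (band s)) (Some Y)"
          using type_probability_tuple_weight_band_le[OF s0 rQ] located_pmf(2)[OF rQ e] by simp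
      qed
    qed
    also have "(chain_constant - \<epsilon>1) * (n * type_probability) powr (1 / r) = ((chain_constant - \<epsilon>1) * type_probability powr (1 / r)) * ?x"
      using type_probability_pos by (simp add: powr_mult)
    finally have expected_clique: "(b - \<epsilon> / 2) * ?x \<le> expected_clique (comparable d) n (located_pmf ?Q (band s))" unfolding e1(2) .
    have "measure_pmf.prob (matching_pmf r n) {M. real (largest_clique r P M) < (b - \<epsilon>) * ?x} \<le>
        2 * measure_pmf.prob (sample_set n ?E) {M. real (clique_number (pair_iso P) M) < (b - \<epsilon>) * ?x}"
      by (rule Q0[OF Q, THEN conjunct1, THEN spec, of "\<lambda>v. real v < (b - \<epsilon>) * ?x"])
    also have "measure_pmf.prob (sample_set n ?E) {M. real (clique_number (pair_iso P) M) < (b - \<epsilon>) * ?x} \<le>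
        measure_pmf.prob (sample_set n ?E) {M. real (clique_number (comparable d) (?F M)) < (b - \<epsilon>) * ?x}"
    proof (rule measure_pmf.finite_measure_mono_AE)
      show "AE M in sample_set n ?E. M \<in> {M. real (clique_number (pair_iso P) M) < (b - \<epsilon>) * ?x} \<longrightarrow>
          M \<in> {M. real (clique_number (comparable d) (?F M)) < (b - \<epsilon>) * ?x}"
      proof (rule AE_pmfI, rule impI)
        fix M assume M: "M \<in> set_pmf (sample_set n ?E)" "M \<in> {M. real (clique_number (pair_iso P) M) < (b - \<epsilon>) * ?x}"
        have finM: "finite M" and "Some ` M \<subseteq> set_pmf ?E" using set_pmf_sample_set[OF M(1)] by simp_all
        then have sub: "M \<subseteq> subsets r ?Q" using subsets_nonempty[OF rQ] by auto
        have "(\<Sum>i\<in>{()}. clique_number (comparable d) (?F M)) \<le> clique_number (pair_iso P) M"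
        proof (rule sum_clique_number_le[OF finM, where \<phi> = "\<lambda>_. located (band s)"])
          fix e f y y' assume *: "e \<in> M" "f \<in> M" "located (band s) e = Some y" "located (band s) f = Some y'" "comparable d y y'"
          have ef: "finite e" "card e = r" "finite f" "card f = r"
            using finite_card_subset[of e r ?Q] finite_card_subset[of f r ?Q] * sub by auto
          have y: "y = chunk e" "y' = chunk f" using locatedD[OF *(3)] locatedD[OF *(4)] by simp_all
          have "edge_precedes r cls d e f \<or> edge_precedes r cls d f e"
            using *(5) precedes_imp_edge_precedes[of s e f] precedes_imp_edge_precedes[of s f e] *(3,4) unfolding y comparable_def by blast
          then show "pair_iso P e f" unfolding pair_iso_def using pair_iso[OF ef] by simp
        qed auto
        then have "real (clique_number (comparable d) (?F M)) \<le> real (clique_number (pair_iso P) M)" by simp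
        then show "M \<in> {M. real (clique_number (comparable d) (?F M)) < (b - \<epsilon>) * ?x}" using M(2) by simp
      qed
    qed simp
    also have "\<dots> = measure_pmf.prob (sample_set n (located_pmf ?Q (band s))) {A. real (clique_number (comparable d) A) < (b - \<epsilon>) * ?x}"
      unfolding sample_set_located_pmf measure_map_pmf by (simp add: vimage_def)
    also have "\<dots> \<le> 1 / (\<theta>\<^sup>2 * ((b - \<epsilon> / 2) * ?x))"
    proof (rule clique_number_lower_deviation[OF located_pmf(1)[OF rQ] th _ expected_clique])
      show "0 < (b - \<epsilon> / 2) * ?x" using b' x0 by simp
      show "(b - \<epsilon>) * ?x \<le> (1 - \<theta>) * ((b - \<epsilon> / 2) * ?x)"
        using mult_right_mono[OF th', of ?x] x0 by (simp add: mult.assoc)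
    qed
    also have "2 * (1 / (\<theta>\<^sup>2 * ((b - \<epsilon> / 2) * ?x))) = B / ?x" by (simp add: B_def)
    finally show ?case by simp
  qed
  then show ?thesis by blast
qed

lemma largest_clique_converges:
  assumes P: "r_pattern r P"
    and pair_iso: "\<And>e f. finite e \<Longrightarrow> card e = r \<Longrightarrow> finite f \<Longrightarrow> card f = r \<Longrightarrow>
      order_isomorphic {e, f} P \<longleftrightarrow> edge_precedes r cls d e f \<or> edge_precedes r cls d f e"
  shows "converges_in_probability (\<lambda>n. matching_pmf r n)
    (\<lambda>n M. real (largest_clique r P M) / real n powr (1 / real r)) (chain_constant * type_probability powr (1 / r))"
  unfolding converges_in_probability_def
proof (intro allI impI)
  fix \<epsilon> :: real assume eps: "0 < \<epsilon>"
  define b where "b = chain_constant * type_probability powr (1 / r)"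
  have b0: "0 < b" unfolding b_def using chain_constant_pos type_probability_pos by simp
  (* Decreasing \<epsilon> enlarges the event of the lower tail, so it may be replaced by a value of at most b. *)
  define \<epsilon>' where "\<epsilon>' = min \<epsilon> b"
  have eps': "0 < \<epsilon>'" "\<epsilon>' \<le> b" "\<epsilon>' \<le> \<epsilon>" using eps b0 by (auto simp: \<epsilon>'_def)
  let ?p = "\<lambda>n. matching_pmf r n"
  obtain B1 where B1: "\<forall>\<^sub>F n in sequentially. measure_pmf.prob (?p n) {M. (b + \<epsilon>) * real n powr (1 / r) < real (largest_clique r P M)} \<le> B1 / real n powr (1 / r)"
    using upper_tail[OF P pair_iso eps] unfolding b_def by blast
  obtain B2 where B2: "\<forall>\<^sub>F n in sequentially. measure_pmf.prob (?p n) {M. real (largest_clique r P M) < (b - \<epsilon>') * real n powr (1 / r)} \<le> B2 / real n powr (1 / r)"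
    using lower_tail[OF P pair_iso eps'(1) eps'(2)[unfolded b_def]] unfolding b_def by blast
  have "(\<lambda>n. (B1 + B2) / real n powr (1 / r)) \<longlonglongrightarrow> 0" using r_pos by (intro const_div_powr_tendsto_0) simp
  then show "(\<lambda>n. measure_pmf.prob (?p n) {M. \<bar>real (largest_clique r P M) / real n powr (1 / r) - chain_constant * type_probability powr (1 / r)\<bar> > \<epsilon>}) \<longlonglongrightarrow> 0"
  proof (rule tendsto_sandwich[OF _ _ tendsto_const, rotated 2])
    show "\<forall>\<^sub>F n in sequentially. 0 \<le> measure_pmf.prob (?p n) {M. \<bar>real (largest_clique r P M) / real n powr (1 / r) - chain_constant * type_probability powr (1 / r)\<bar> > \<epsilon>}"
      by simp
    show "\<forall>\<^sub>F n in sequentially. measure_pmf.prob (?p n) {M. \<bar>real (largest_clique r P M) / real n powr (1 / r) - chain_constant * type_probability powr (1 / r)\<bar> > \<epsilon>} \<le> (B1 + B2) / real n powr (1 / r)"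
      using B1 B2 eventually_gt_at_top[of 0]
    proof eventually_elim
      case (elim n)
      let ?x = "real n powr (1 / r)"
      have x0: "0 < ?x" using elim(3) by simp
      have "{M. \<bar>real (largest_clique r P M) / ?x - b\<bar> > \<epsilon>} \<subseteq>
          {M. (b + \<epsilon>) * ?x < real (largest_clique r P M)} \<union> {M. real (largest_clique r P M) < (b - \<epsilon>') * ?x}"
      proof
        fix M assume "M \<in> {M. \<bar>real (largest_clique r P M) / ?x - b\<bar> > \<epsilon>}"
        then have "b + \<epsilon> < real (largest_clique r P M) / ?x \<or> real (largest_clique r P M) / ?x < b - \<epsilon>'"
          using eps'(3) by (auto simp: abs_if split: if_splits)
        then show "M \<in> {M. (b + \<epsilon>) * ?x < real (largest_clique r P M)} \<union> {M. real (largest_clique r P M) < (b - \<epsilon>') * ?x}"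
          using x0 by (simp only: pos_less_divide_eq pos_divide_less_eq mem_Collect_eq Un_iff)
      qed
      then have "measure_pmf.prob (?p n) {M. \<bar>real (largest_clique r P M) / ?x - b\<bar> > \<epsilon>} \<le>
          measure_pmf.prob (?p n) ({M. (b + \<epsilon>) * ?x < real (largest_clique r P M)} \<union> {M. real (largest_clique r P M) < (b - \<epsilon>') * ?x})"
        by (intro measure_pmf.finite_measure_mono) auto
      also have "\<dots> \<le> measure_pmf.prob (?p n) {M. (b + \<epsilon>) * ?x < real (largest_clique r P M)} +
          measure_pmf.prob (?p n) {M. real (largest_clique r P M) < (b - \<epsilon>') * ?x}"
        by (intro measure_Un_le) auto
      also have "\<dots> \<le> (B1 + B2) / ?x" using elim(1,2) by (simp add: add_divide_distrib)
      finally show ?case unfolding b_def .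
    qed
  qed
qed

end

theorem theorem1p10:
  fixes r :: nat
  assumes "r \<ge> 1"
  shows "\<exists>b :: nat set set \<Rightarrow> real.
    (\<forall>P. r_pattern r P \<and> collectable r P \<longrightarrow>
       b P > 0 \<and>
       converges_in_probability
         (\<lambda>n. pmf_of_set (matchings_of_size r n))
         (\<lambda>n M. real (largest_clique r P M) / real n powr (1 / real r))
         (b P)) \<and>
    (\<forall>P P'. r_pattern r P \<and> collectable r P \<and> r_pattern r P' \<and> collectable r P' \<and>
       pattern_type P = pattern_type P' \<longrightarrow> b P = b P')"
proof -
  define sizes where "sizes P = sorted_list_of_multiset (pattern_type P)" for P
  define b where "b P = block_sizes.chain_constant (length (sizes P)) (\<lambda>j. sizes P ! j) *
    block_sizes.type_probability (length (sizes P)) (\<lambda>j. sizes P ! j) powr (1 / real r)" for P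
  have main: "b P > 0 \<and> converges_in_probability (\<lambda>n. pmf_of_set (matchings_of_size r n))
      (\<lambda>n M. real (largest_clique r P M) / real n powr (1 / real r)) (b P)"
    if P: "r_pattern r P" "collectable r P" for P
  proof -
    obtain cls d where cls: "\<And>u. u < r \<Longrightarrow> cls u < length (sizes P)"
      "\<And>j. j < length (sizes P) \<Longrightarrow> card {u. u < r \<and> cls u = j} = sizes P ! j"
      "\<And>j. j < length (sizes P) \<Longrightarrow> 0 < sizes P ! j"
      "\<And>u v w. u < v \<Longrightarrow> v < w \<Longrightarrow> w < r \<Longrightarrow> cls u = cls w \<Longrightarrow> cls v = cls u"
      and pair_iso: "\<And>e f. finite e \<Longrightarrow> card e = r \<Longrightarrow> finite f \<Longrightarrow> card f = r \<Longrightarrow>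
       order_isomorphic {e, f} P \<longleftrightarrow> edge_precedes r cls d e f \<or> edge_precedes r cls d f e"
    proof (rule collectable_structure[OF assms P, folded sizes_def], goal_cases)
      case (1 cls d)
      show thesis by (rule 1(1)[of cls d]) (fact 1)+
    qed
    interpret block_sizes "length (sizes P)" "\<lambda>j. sizes P ! j"
    proof
      show "0 < length (sizes P)" using cls(1)[of 0] assms by linarith
      show "\<And>j. j < length (sizes P) \<Longrightarrow> 0 < sizes P ! j" by (rule cls(3))
    qed
    have req: "block_sizes.r (length (sizes P)) (\<lambda>j. sizes P ! j) = r"
    proof -
      have "{..<r} = (\<Union>j<length (sizes P). {u. u < r \<and> cls u = j})" using cls(1) by auto
      then have "r = card (\<Union>j<length (sizes P). {u. u < r \<and> cls u = j})" by (metis card_lessThan)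
      also have "\<dots> = (\<Sum>j<length (sizes P). card {u. u < r \<and> cls u = j})"
        by (rule card_UN_disjoint) auto
      also have "\<dots> = (\<Sum>j<length (sizes P). sizes P ! j)" using cls(2) by simp
      finally show ?thesis by (simp add: r_def)
    qed
    interpret block_pattern "length (sizes P)" "\<lambda>j. sizes P ! j" cls d
    proof (unfold_locales, unfold req)
      show "cls u < length (sizes P)" if "u < r" for u using cls(1) that .
      show "card {u. u < r \<and> cls u = j} = sizes P ! j" if "j < length (sizes P)" for j using cls(2) that .
      show "cls v = cls u" if "u < v" "v < w" "w < r" "cls u = cls w" for u v w using cls(4) that .
    qed
    have "0 < b P" unfolding b_def using chain_constant_pos type_probability_pos by simp
    then show ?thesis using largest_clique_converges[of P] P(1) pair_iso unfolding req b_def by simp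
  qed
  show ?thesis
  proof (intro exI[of _ b] conjI allI impI)
    fix P P' assume "r_pattern r P \<and> collectable r P \<and> r_pattern r P' \<and> collectable r P' \<and> pattern_type P = pattern_type P'"
    then show "b P = b P'" by (simp add: b_def sizes_def)
  qed (use main in auto)
qed

end
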